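(* Let $\alpha>0$ and let $\xi_k$, $k\in\mathbb{Z}$, be i.i.d. random variables such that, for some $\sigma_\xi>0$ and $p\in[0,1]$, $P\{|\xi_k|>x\}\sim\sigma_\xi^\alpha x^{-\alpha}$ and $P\{\xi_k>x\}/P\{|\xi_k|>x\}\to p$ as $x\to\infty$. Let $\{c_i\}_{i\in\mathbb{Z}}$ be real numbers such that $\sum_{i=-\infty}^\infty c_i^2<\infty$ if $\alpha>2$, and $\sum_{i=-\infty}^\infty|c_i|^{\alpha-\epsilon}<\infty$ for some $\epsilon>0$ if $\alpha\le2$. Consider the linear process $$X(k)=\sum_{i=-\infty}^\infty c_i\xi_{k-i},\qquad k\in\mathbb{Z}.$$ Let $c_+=\max_{i\ge0}c_i$ and $c_-=\max_{i\ge0}(-c_i)$, and suppose that either $p\,c_+>0$ or $(1-p)\,c_->0$. Then, with $X_m(k)=\max_{1\le i\le m}X(m(k-1)+i)$, $$\Big\{\frac1{m^{1/\alpha}}X_m(k)\Big\}_{k\in\mathbb{N}}\stackrel{d}{\longrightarrow}\{Z(k)\}_{k\in\mathbb{N}},\qquad m\to\infty,$$ in the sense of convergence of finite-dimensional distributions, where the $Z(k)$ are i.i.d. $\alpha$-Fréchet random variables with scale coefficient $\sigma_\xi\,(p\,c_+^\alpha+(1-p)\,c_-^\alpha)^{1/\alpha}$.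
   Context: A random variable $Z$ is $\alpha$-Fréchet with scale coefficient $\sigma>0$ if $P\{Z\le x\}=\exp\{-\sigma^\alpha x^{-\alpha}\}$ for $x>0$ and $0$ for $x\le0$. The relation $a(x)\sim b(x)$ means $a(x)/b(x)\to1$.
   Formalization: The maxima c_+ and c_- are taken over all integers i instead of i≥0 (as stated, the claim fails for two-sided sums, e.g. p=1, c_0=1, c_{-1}=2), and the series defining X(k) is assumed to converge almost surely, through symmetric partial sums. *)

theory Defs
  imports "HOL-Probability.Probability" "HOL-Library.Landau_Symbols"
begin

definition frechet_rv :: "'a measure \<Rightarrow> real \<Rightarrow> real \<Rightarrow> ('a \<Rightarrow> real) \<Rightarrow> bool" where
  "frechet_rv N \<alpha> \<sigma> Z \<longleftrightarrow> \<sigma> > 0 \<and> Z \<in> borel_measurable N \<and>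
     (\<forall>x. \<P>(\<omega> in N. Z \<omega> \<le> x) = (if x > 0 then exp (- (\<sigma> powr \<alpha> * x powr (- \<alpha>))) else 0))"

definition iid_vars :: "'a measure \<Rightarrow> ('i \<Rightarrow> 'a \<Rightarrow> real) \<Rightarrow> 'i set \<Rightarrow> bool" where
  "iid_vars M Y I \<longleftrightarrow> prob_space.indep_vars M (\<lambda>_. borel) Y I \<and>
     (\<forall>i\<in>I. \<forall>j\<in>I. distr M borel (Y i) = distr M borel (Y j))"

text \<open>Convergence of the series \<open>\<Sum>\<^sub>i f i\<close> over all integers, to the sum \<open>s\<close>, through its
  symmetric partial sums. Separate convergence of the two one-sided series, and absolute
  convergence, are both stronger. Absolute convergence (the library's \<open>has_sum\<close> on the reals)
  would be too much to ask of a linear process whose coefficients are only square summable.\<close>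

definition bi_sums :: "(int \<Rightarrow> real) \<Rightarrow> real \<Rightarrow> bool" where
  "bi_sums f s \<longleftrightarrow> (\<lambda>n. \<Sum>i = - int n..int n. f i) \<longlonglongrightarrow> s"

definition block_max :: "(int \<Rightarrow> 'a \<Rightarrow> real) \<Rightarrow> nat \<Rightarrow> nat \<Rightarrow> 'a \<Rightarrow> real" where
  "block_max X m k \<omega> = (MAX i\<in>{1..m}. X (int m * (int k - 1) + int i) \<omega>)"

definition weak_conv_borel :: "(nat \<Rightarrow> 'a::topological_space measure) \<Rightarrow> 'a measure \<Rightarrow> bool" where
  "weak_conv_borel \<mu> \<nu> \<longleftrightarrow>
     (\<forall>f :: 'a \<Rightarrow> real. continuous_on UNIV f \<and> bounded (range f) \<longrightarrow>
        (\<lambda>n. \<integral>x. f x \<partial>\<mu> n) \<longlonglongrightarrow> (\<integral>x. f x \<partial>\<nu>))"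

text \<open>Finite-dimensional distributions are taken as Borel laws on \<open>nat \<Rightarrow> real\<close> with the product
  topology. Restriction to the finite set \<open>J\<close> makes the coordinates outside \<open>J\<close> constant, so
  for each \<open>J\<close> this is weak convergence of random vectors with coordinates indexed by \<open>J\<close>.\<close>

definition fdd_conv ::
  "nat set \<Rightarrow> 'a measure \<Rightarrow> (nat \<Rightarrow> nat \<Rightarrow> 'a \<Rightarrow> real) \<Rightarrow> 'b measure \<Rightarrow> (nat \<Rightarrow> 'b \<Rightarrow> real) \<Rightarrow> bool" where
  "fdd_conv T M Y N Z \<longleftrightarrow>
     (\<forall>J. finite J \<and> J \<subseteq> T \<longrightarrow>
        weak_conv_borel (\<lambda>m. distr M borel (\<lambda>\<omega>. restrict (\<lambda>k. Y m k \<omega>) J))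
                        (distr N borel (\<lambda>\<omega>. restrict (\<lambda>k. Z k \<omega>) J)))"

text \<open>The coefficients tend to \<open>0\<close>, so both suprema are nonnegative, and each is attained
  whenever it is positive. They range over all integers, like the sum defining the linear process;
  for a one-sided process (\<open>c i = 0\<close> for \<open>i < 0\<close>) they equal the suprema over \<open>i \<ge> 0\<close>.
  With a two-sided sum the range \<open>i \<ge> 0\<close> would be wrong: for \<open>p = 1\<close>,
  \<open>c 0 = 1\<close>, \<open>c (-1) = 2\<close> and all other coefficients \<open>0\<close>, the limiting scale is
  \<open>2 * \<sigma>\<close>, not \<open>\<sigma>\<close>.\<close>

definition c_plus :: "(int \<Rightarrow> real) \<Rightarrow> real" where
  "c_plus c = (SUP i. c i)"

definition c_minus :: "(int \<Rightarrow> real) \<Rightarrow> real" where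
  "c_minus c = (SUP i. - c i)"

end

(* The proof is the one-big-jump principle. Put u = m^(1/alpha) and
   w_i = c_i xi_{j-i}. Truncating the w_i at a small multiple of y and applying a Chernoff
   bound with exponent of order (ln y)/y shows that the truncated series exceeds eps y with
   probability o(y^(-alpha)), after centering; the centering itself is negligible because the
   partial sums, which converge almost surely, are tight and have a law not depending on j.
   Two of the w_i exceed a multiple of y with probability O(y^(-2 alpha)). Hence
   X(j) > y forces, up to probability o(y^(-alpha)), a single w_i > (1 - eps) y; conversely,
   w_i > (1 + eps) y forces X(j) > y because X(j) - w_i is tight and independent of w_i.
   Taking y = x u and summing over a block of length m, the block maximum is at most x u essentially
   when phi(xi_l) <= x u for all l in the block, where phi t = max (c_+ t) (-c_- t) is the
   supremum of c_i t over i. These events are independent for different blocks, so the joint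
   distribution functions converge to products of Frechet distribution functions. *)

theory Submission
  imports Defs "HOL-Real_Asymp.Real_Asymp"
begin

subsection \<open>Weak convergence from joint distribution functions\<close>

text \<open>Uniformity shapes the argument. Errors at single sites are summed over the
  \<open>m\<close> sites of a block, so they must be \<open>o(1/m)\<close> uniformly in the site,
  while the series converges only almost surely along symmetric partial sums. Hence every estimate
  is proved for finite partial sums with constants free of \<open>n\<close> and of the site, and
  only then passed to the limit. One exponent \<open>r\<close> with \<open>r \<le> 2\<close> and
  \<open>r < \<alpha>\<close>, for which the innovations have a finite \<open>r\<close>-th moment
  and the \<open>r\<close>-th powers of the coefficients are summable, covers finite and infinite
  variance alike: the second moments of the terms truncated at \<open>D\<close> sum to
  \<open>O(D powr (2 - r))\<close>. The innovations are not assumed centered and may have no mean,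
  so the centering of the truncated series is never computed; tightness bounds it. Distribution
  functions must converge at nonpositive thresholds too, where the limit is 0; there the positivity
  of the limiting scale enters.\<close>

lemma dist_fun_le:
  fixes x y :: "'i::countable \<Rightarrow> 'b::metric_space"
  assumes "\<And>i. dist (x i) (y i) \<le> e"
  shows "dist x y \<le> 2 * e"
proof -
  have e: "e \<ge> 0" using assms[of undefined] zero_le_dist[of "x undefined" "y undefined"] by linarith
  \<comment> \<open>The metric on functions weights the \<open>n\<close>-th coordinate by
    \<open>(1/2)^n\<close> and caps each distance at 1; the geometric series supplies the constant
    2.\<close>
  have "(\<Sum>n. (1/2)^n * min (dist (x (from_nat n)) (y (from_nat n))) 1) \<le> (\<Sum>n. (1/2)^n * e)"
  proof (rule suminf_le)
    show "summable (\<lambda>n. (1/2)^n * e)" by (intro summable_mult2 summable_geometric) auto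
    show "summable (\<lambda>n. (1/2::real)^n * min (dist (x (from_nat n)) (y (from_nat n))) 1)"
      by (rule summable_comparison_test'[of "\<lambda>n. (1/2)^n"])
         (auto simp add: summable_geometric_iff)
    show "(1/2)^n * min (dist (x (from_nat n)) (y (from_nat n))) 1 \<le> (1/2)^n * e" for n
      using assms[of "from_nat n"] by (intro mult_left_mono) auto
  qed
  also have "\<dots> = 2 * e"
    using suminf_mult2[of "\<lambda>n. (1/2::real)^n" e] suminf_geometric[of "1/2::real"]
    by (simp add: summable_geometric_iff)
  finally show ?thesis unfolding dist_fun_def .
qed

text \<open>Coordinates outside \<open>J\<close> are pinned to \<open>undefined\<close>, so the box
  is a full product of intervals and singletons, and Tychonoff's theorem applies.\<close>

lemma compact_extensional_box:
  fixes J :: "nat set"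
  shows "compact (PiE J (\<lambda>_. {-A..A::real}))"
proof -
  have eq: "PiE J (\<lambda>_. {-A..A::real}) = PiE UNIV (\<lambda>k. if k \<in> J then {-A..A} else {undefined})"
    by (auto simp: PiE_iff extensional_def split: if_splits)
  have "compactin (product_topology (\<lambda>i. euclidean::real topology) (UNIV::nat set))
          (PiE UNIV (\<lambda>k. if k \<in> J then {-A..A} else {undefined}))"
    by (subst compactin_PiE) auto
  then show ?thesis unfolding eq euclidean_product_topology by simp
qed

text \<open>Cells are open on the left and closed on the right: they tile \<open>(-A, A]\<close>
  without overlap, and their probabilities are differences of distribution functions.\<close>

lemma grid_cell:
  fixes t A :: real
  assumes "- A < t" "t \<le> A" "n > 0"
  shows "\<exists>!i. i < n \<and> - A + 2 * A * real i / real n < t \<and> t \<le> - A + 2 * A * real (Suc i) / real n"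
proof -
  \<comment> \<open>In this coordinate the cells become the unit intervals
    \<open>(i, i + 1]\<close>, so the index is the ceiling of \<open>s\<close> minus one.\<close>
  define s where "s = (t + A) * real n / (2 * A)"
  have A: "A > 0" using assms by linarith
  have eq1: "- A + 2 * A * real i / real n < t \<longleftrightarrow> real i < s" for i
    using A assms(3) unfolding s_def by (simp add: field_simps)
  have eq2: "t \<le> - A + 2 * A * real i / real n \<longleftrightarrow> s \<le> real i" for i
    using A assms(3) unfolding s_def by (simp add: field_simps)
  have "0 < (t + A) * real n" "(t + A) * real n \<le> (2 * A) * real n"
    using assms by (auto intro!: mult_right_mono)
  then have s: "0 < s" "s \<le> real n"
    using A unfolding s_def by (auto simp: divide_le_eq mult.commute)
  have ex: "nat (\<lceil>s\<rceil> - 1) < n \<and> real (nat (\<lceil>s\<rceil> - 1)) < s \<and> s \<le> real (Suc (nat (\<lceil>s\<rceil> - 1)))"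
  proof -
    have "\<lceil>s\<rceil> \<ge> 1" "\<lceil>s\<rceil> \<le> int n" using s by (simp_all add: ceiling_le_iff)
    then have "real (nat (\<lceil>s\<rceil> - 1)) = of_int \<lceil>s\<rceil> - 1" "nat (\<lceil>s\<rceil> - 1) < n" by linarith+
    then show ?thesis using ceiling_correct[of s] by auto
  qed
  show ?thesis unfolding eq1 eq2
  proof (rule ex1I)
    show "nat (\<lceil>s\<rceil> - 1) < n \<and> real (nat (\<lceil>s\<rceil> - 1)) < s \<and> s \<le> real (Suc (nat (\<lceil>s\<rceil> - 1)))" by (rule ex)
    fix i assume i: "i < n \<and> real i < s \<and> s \<le> real (Suc i)"
    then have "\<lceil>s\<rceil> = int i + 1" by (simp add: ceiling_eq_iff)
    then show "i = nat (\<lceil>s\<rceil> - 1)" by simp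
  qed
qed

definition grid_corner :: "nat set \<Rightarrow> real \<Rightarrow> nat \<Rightarrow> (nat \<Rightarrow> nat) \<Rightarrow> nat \<Rightarrow> real" where
  "grid_corner J A n \<tau> = restrict (\<lambda>k. - A + 2 * A * real (Suc (\<tau> k)) / real n) J"

text \<open>Lower and upper bounds stand under separate quantifiers to match the rectangles whose
  probabilities are later computed by induction on the set of coordinates with a lower
  bound.\<close>

definition in_cell :: "nat set \<Rightarrow> real \<Rightarrow> nat \<Rightarrow> (nat \<Rightarrow> nat) \<Rightarrow> (nat \<Rightarrow> real) \<Rightarrow> bool" where
  "in_cell J A n \<tau> v \<longleftrightarrow> (\<forall>k\<in>J. - A + 2 * A * real (\<tau> k) / real n < v k) \<and>
     (\<forall>k\<in>J. v k \<le> - A + 2 * A * real (Suc (\<tau> k)) / real n)"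

text \<open>On the compact box \<open>f\<close> is uniformly continuous, so moving a point to the
  upper corner of its cell costs at most \<open>e\<close>. Outside the box all indicators vanish and
  the error is at most \<open>B\<close>. The sum is finite, and each term integrates to a cell
  probability.\<close>

lemma grid_approximation:
  fixes f :: "(nat \<Rightarrow> real) \<Rightarrow> real"
  assumes J: "finite J" and cont: "continuous_on UNIV f" and bd: "\<And>x. \<bar>f x\<bar> \<le> B"
    and A: "A > 0" and e: "e > 0"
  obtains n where "n > 0"
    "\<And>v. \<bar>f (restrict v J) - (\<Sum>\<tau>\<in>PiE J (\<lambda>_. {..<n}). f (grid_corner J A n \<tau>) * of_bool (in_cell J A n \<tau> v))\<bar>
       \<le> e + B * of_bool (\<not> ((\<forall>k\<in>J. - A < v k) \<and> (\<forall>k\<in>J. v k \<le> A)))"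
proof -
  have B: "B \<ge> 0" using bd[of undefined] by linarith
  let ?K = "PiE J (\<lambda>_. {-A..A::real})"
  have "uniformly_continuous_on ?K f"
    by (rule compact_uniformly_continuous[OF continuous_on_subset[OF cont] compact_extensional_box]) auto
  then obtain d where d: "d > 0" "\<And>x y. x \<in> ?K \<Longrightarrow> y \<in> ?K \<Longrightarrow> dist y x < d \<Longrightarrow> dist (f y) (f x) < e"
    using e unfolding uniformly_continuous_on_def by meson
  \<comment> \<open>This makes the cell width smaller than \<open>d / 4\<close>;
    \<open>dist_fun_le\<close> doubles it, which still stays below \<open>d\<close>.\<close>
  obtain n :: nat where n: "real n > 8 * A / d" using reals_Archimedean2 by blast
  have n0: "n > 0" 
  proof -
    have "0 < 8 * A / d" using A d(1) by simp
    then show ?thesis using n by linarith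
  qed
  have w: "2 * A / real n < d / 4" using n n0 d(1) by (simp add: field_simps)
  show ?thesis
  proof (rule that[OF n0])
    fix v :: "nat \<Rightarrow> real"
    let ?T = "PiE J (\<lambda>_. {..<n})"
    let ?c = "grid_corner J A n" and ?in = "in_cell J A n"
    have finT: "finite ?T" using J by (intro finite_PiE) auto
    show "\<bar>f (restrict v J) - (\<Sum>\<tau>\<in>?T. f (?c \<tau>) * of_bool (?in \<tau> v))\<bar>
       \<le> e + B * of_bool (\<not> ((\<forall>k\<in>J. - A < v k) \<and> (\<forall>k\<in>J. v k \<le> A)))"
    proof (cases "(\<forall>k\<in>J. - A < v k) \<and> (\<forall>k\<in>J. v k \<le> A)")
      case True
      define i where "i k = (THE i. i < n \<and> - A + 2 * A * real i / real n < v k \<and> v k \<le> - A + 2 * A * real (Suc i) / real n)" for k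
      have i: "i k < n \<and> - A + 2 * A * real (i k) / real n < v k \<and> v k \<le> - A + 2 * A * real (Suc (i k)) / real n"
        if "k \<in> J" for k
        unfolding i_def by (rule theI') (rule grid_cell, use True that n0 in auto)
      have uniq: "j = i k" if "k \<in> J" "j < n" "- A + 2 * A * real j / real n < v k" "v k \<le> - A + 2 * A * real (Suc j) / real n" for j k
        using grid_cell[of A "v k" n] i[OF that(1)] True that n0 by blast
      define \<tau> where "\<tau> = restrict i J"
      have \<tau>: "\<tau> \<in> ?T" "?in \<tau> v" using i by (auto simp: \<tau>_def in_cell_def)
      have only: "\<tau>' = \<tau>" if "\<tau>' \<in> ?T" "?in \<tau>' v" for \<tau>'
      proof (rule PiE_ext[OF that(1) \<tau>(1)])
        fix k assume "k \<in> J"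
        then show "\<tau>' k = \<tau> k"
          using uniq[of k "\<tau>' k"] that unfolding in_cell_def \<tau>_def by auto
      qed
      have "(\<Sum>\<tau>\<in>?T. f (?c \<tau>) * of_bool (?in \<tau> v)) = (\<Sum>\<tau>'\<in>?T. if \<tau>' = \<tau> then f (?c \<tau>) else 0)"
      proof (rule sum.cong[OF refl])
        fix \<tau>' assume "\<tau>' \<in> ?T"
        then have "?in \<tau>' v \<longleftrightarrow> \<tau>' = \<tau>" using only \<tau>(2) by blast
        then show "f (?c \<tau>') * of_bool (?in \<tau>' v) = (if \<tau>' = \<tau> then f (?c \<tau>) else 0)" by simp
      qed
      also have "\<dots> = f (?c \<tau>)" using \<tau>(1) finT by simp
      finally have S: "(\<Sum>\<tau>\<in>?T. f (?c \<tau>) * of_bool (?in \<tau> v)) = f (?c \<tau>)" .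
      have "restrict v J \<in> ?K" using True by (auto simp: less_imp_le)
      moreover have "?c \<tau> \<in> ?K"
      proof -
        have bds: "- A \<le> - A + 2 * A * real (Suc (i k)) / real n"
          "- A + 2 * A * real (Suc (i k)) / real n \<le> A" if "k \<in> J" for k
        proof -
          have "real (Suc (i k)) \<le> real n" using i[OF that] by linarith
          then have "2 * A * real (Suc (i k)) / real n \<le> 2 * A"
            using A n0 by (simp add: divide_le_eq del: of_nat_Suc)
          then show "- A + 2 * A * real (Suc (i k)) / real n \<le> A" by linarith
        qed (use A in simp)
        then show ?thesis unfolding grid_corner_def \<tau>_def
          by (intro restrict_PiE_iff[THEN iffD2] ballI) (simp add: bds del: of_nat_Suc)
      qed
      moreover have "dist (restrict v J) (?c \<tau>) < d"
      proof -
        have "dist (restrict v J k) (?c \<tau> k) \<le> d / 4" for k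
        proof (cases "k \<in> J")
          case True
          have "2 * A * real (Suc (i k)) / real n = 2 * A * real (i k) / real n + 2 * A / real n"
            using n0 by (simp add: divide_simps) (simp add: algebra_simps)
          then show ?thesis using i[OF True] w True
            by (simp add: grid_corner_def \<tau>_def dist_real_def del: of_nat_Suc)
        qed (use d(1) in \<open>simp add: grid_corner_def\<close>)
        then have "dist (restrict v J) (?c \<tau>) \<le> 2 * (d / 4)" by (rule dist_fun_le)
        then show ?thesis using d(1) by linarith
      qed
      ultimately have "dist (f (restrict v J)) (f (?c \<tau>)) < e" by (intro d(2))
      then show ?thesis using S True by (simp add: dist_real_def)
    next
      case False
      have no: "\<not> ?in \<tau> v" if "\<tau> \<in> ?T" for \<tau>
      proof
        assume in1: "?in \<tau> v"
        have "- A < v k \<and> v k \<le> A" if k: "k \<in> J" for k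
        proof -
          have "real (Suc (\<tau> k)) \<le> real n" using \<open>\<tau> \<in> ?T\<close> k by (auto simp: PiE_iff Suc_le_eq)
          then have "2 * A * real (Suc (\<tau> k)) / real n \<le> 2 * A"
            using A n0 by (simp add: divide_le_eq del: of_nat_Suc)
          moreover have "0 \<le> 2 * A * real (\<tau> k) / real n" using A by simp
          moreover have "- A + 2 * A * real (\<tau> k) / real n < v k" "v k \<le> - A + 2 * A * real (Suc (\<tau> k)) / real n"
            using in1 k unfolding in_cell_def by auto
          ultimately show ?thesis by linarith
        qed
        then show False using False by blast
      qed
      have "(\<Sum>\<tau>\<in>?T. f (?c \<tau>) * of_bool (?in \<tau> v)) = 0"
        by (rule sum.neutral) (use no in auto)
      then show ?thesis using False bd[of "restrict v J"] e by simp
    qed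
  qed
qed

text \<open>The pointwise estimate integrated over the sample space; it serves both the prelimit
  vectors and the limit vector.\<close>

lemma (in prob_space) expectation_grid_approximation:
  fixes f :: "(nat \<Rightarrow> real) \<Rightarrow> real"
  assumes J: "finite J" and fm[measurable]: "f \<in> borel_measurable borel" and bd: "\<And>x. \<bar>f x\<bar> \<le> B"
    and app: "\<And>v. \<bar>f (restrict v J) - (\<Sum>\<tau>\<in>T. g \<tau> * of_bool (in_cell J A n \<tau> v))\<bar>
       \<le> e + B * of_bool (\<not> ((\<forall>k\<in>J. - A < v k) \<and> (\<forall>k\<in>J. v k \<le> A)))"
    and T: "finite T"
    and W[measurable]: "\<And>k. W k \<in> borel_measurable M"
  shows "\<bar>(\<integral>x. f x \<partial>distr M borel (\<lambda>\<omega>. restrict (\<lambda>k. W k \<omega>) J)) -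
           (\<Sum>\<tau>\<in>T. g \<tau> * prob {\<omega>\<in>space M. in_cell J A n \<tau> (\<lambda>k. W k \<omega>)})\<bar>
         \<le> e + B * (1 - prob {\<omega>\<in>space M. (\<forall>k\<in>J. - A < W k \<omega>) \<and> (\<forall>k\<in>J. W k \<omega> \<le> A)})"
proof -
  let ?R = "\<lambda>\<omega>. restrict (\<lambda>k. W k \<omega>) J"
  let ?C = "\<lambda>\<tau>. {\<omega>\<in>space M. in_cell J A n \<tau> (\<lambda>k. W k \<omega>)}"
  let ?box = "{\<omega>\<in>space M. (\<forall>k\<in>J. - A < W k \<omega>) \<and> (\<forall>k\<in>J. W k \<omega> \<le> A)}"
  have [measurable]: "?R \<in> borel_measurable M"
  proof (rule measurable_coordinatewise_then_product)
    show "(\<lambda>\<omega>. ?R \<omega> i) \<in> borel_measurable M" for i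
      by (cases "i \<in> J") auto
  qed
  note cJ[measurable] = countable_finite[OF J]
  have C[measurable]: "?C \<tau> \<in> events" for \<tau> unfolding in_cell_def by measurable
  have bx[measurable]: "?box \<in> events" by measurable
  have intf: "integrable M (\<lambda>\<omega>. f (?R \<omega>))"
    by (rule integrable_const_bound[where B=B]) (use bd in auto)
  have intC: "integrable M (\<lambda>\<omega>. indicator (?C \<tau>) \<omega> :: real)" for \<tau>
    using C by (intro integrable_real_indicator) (auto simp: emeasure_eq_measure)
  have intB: "integrable M (\<lambda>\<omega>. indicator ?box \<omega> :: real)"
    using bx by (intro integrable_real_indicator) (auto simp: emeasure_eq_measure)
  have ind: "of_bool (in_cell J A n \<tau> (\<lambda>k. W k \<omega>)) = (indicator (?C \<tau>) \<omega> :: real)" if "\<omega> \<in> space M" for \<tau> \<omega>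
    using that by (simp add: indicator_def)
  have "(\<integral>x. f x \<partial>distr M borel ?R) - (\<Sum>\<tau>\<in>T. g \<tau> * prob (?C \<tau>)) =
      expectation (\<lambda>\<omega>. f (?R \<omega>)) - (\<Sum>\<tau>\<in>T. expectation (\<lambda>\<omega>. g \<tau> * indicator (?C \<tau>) \<omega>))"
    by (simp add: integral_distr)
  also have "\<dots> = expectation (\<lambda>\<omega>. f (?R \<omega>) - (\<Sum>\<tau>\<in>T. g \<tau> * indicator (?C \<tau>) \<omega>))"
    using intf intC by (simp add: Bochner_Integration.integral_diff Bochner_Integration.integral_sum)
  also have "\<bar>\<dots>\<bar> \<le> expectation (\<lambda>\<omega>. \<bar>f (?R \<omega>) - (\<Sum>\<tau>\<in>T. g \<tau> * indicator (?C \<tau>) \<omega>)\<bar>)"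
    by (rule integral_abs_bound)
  also have "\<dots> \<le> expectation (\<lambda>\<omega>. e + B * (1 - indicator ?box \<omega>))"
  proof (rule integral_mono)
    show "integrable M (\<lambda>\<omega>. \<bar>f (?R \<omega>) - (\<Sum>\<tau>\<in>T. g \<tau> * indicator (?C \<tau>) \<omega>)\<bar>)"
      using intf intC by auto
    show "integrable M (\<lambda>\<omega>. e + B * (1 - indicator ?box \<omega>))"
      using intB by (intro Bochner_Integration.integrable_add integrable_mult_right Bochner_Integration.integrable_diff) auto
    fix \<omega> assume w: "\<omega> \<in> space M"
    show "\<bar>f (?R \<omega>) - (\<Sum>\<tau>\<in>T. g \<tau> * indicator (?C \<tau>) \<omega>)\<bar> \<le> e + B * (1 - indicator ?box \<omega>)"
    proof (cases "\<omega> \<in> ?box")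
      case True
      then show ?thesis using app[of "\<lambda>k. W k \<omega>"] unfolding ind[OF w] by (simp add: indicator_def)
    next
      case False
      then have "\<not> ((\<forall>k\<in>J. - A < W k \<omega>) \<and> (\<forall>k\<in>J. W k \<omega> \<le> A))" using w by simp
      then have "of_bool (\<not> ((\<forall>k\<in>J. - A < W k \<omega>) \<and> (\<forall>k\<in>J. W k \<omega> \<le> A))) = (1 - indicator ?box \<omega> :: real)"
        using False by simp
      then show ?thesis using app[of "\<lambda>k. W k \<omega>"] unfolding ind[OF w] by simp
    qed
  qed
  also have "\<dots> = e + B * (1 - prob ?box)"
    using intB bx by (simp add: prob_space Int_absorb1)
  finally show ?thesis .
qed

text \<open>Convergence at every \<open>x\<close> makes all rectangle probabilities converge,
  whatever the grid. Only the limit law is shown to be concentrated on a box; the prelimit laws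
  inherit this for large \<open>m\<close>, because the probability of that box converges as
  well.\<close>

lemma weak_conv_borel_of_joint_cdf:
  fixes V :: "nat \<Rightarrow> nat \<Rightarrow> 'a \<Rightarrow> real" and W :: "nat \<Rightarrow> 'b \<Rightarrow> real"
  assumes M: "prob_space M" and N: "prob_space N" and J: "finite J"
    and V[measurable]: "\<And>m k. V m k \<in> borel_measurable M"
    and W[measurable]: "\<And>k. W k \<in> borel_measurable N"
    and cdf: "\<And>x. (\<lambda>m. measure M {\<omega>\<in>space M. \<forall>k\<in>J. V m k \<omega> \<le> x k})
                 \<longlonglongrightarrow> measure N {\<omega>\<in>space N. \<forall>k\<in>J. W k \<omega> \<le> x k}"
  shows "weak_conv_borel (\<lambda>m. distr M borel (\<lambda>\<omega>. restrict (\<lambda>k. V m k \<omega>) J))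
           (distr N borel (\<lambda>\<omega>. restrict (\<lambda>k. W k \<omega>) J))"
proof -
  interpret M: prob_space M by fact
  interpret N: prob_space N by fact
  \<comment> \<open>A lower bound at \<open>s\<close> is a difference of two rectangles, the second
    with its upper bound at \<open>s\<close> lowered to \<open>a s\<close>. So the induction over
    \<open>S\<close> generalises \<open>b\<close>, and \<open>a k \<le> b k\<close> ensures that the
    second rectangle lies in the first.\<close>
  have rect: "(\<lambda>m. measure M {\<omega>\<in>space M. (\<forall>k\<in>S. a k < V m k \<omega>) \<and> (\<forall>k\<in>J. V m k \<omega> \<le> b k)})
       \<longlonglongrightarrow> measure N {\<omega>\<in>space N. (\<forall>k\<in>S. a k < W k \<omega>) \<and> (\<forall>k\<in>J. W k \<omega> \<le> b k)}"
    if "S \<subseteq> J" "\<And>k. k \<in> S \<Longrightarrow> a k \<le> b k" for S a b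
    using finite_subset[OF that(1) J] that
  proof (induction S arbitrary: b rule: finite_induct)
    case empty
    then show ?case using cdf[of b] by simp
  next
    case (insert s S)
    define b' where "b' = b(s := a s)"
    have sJ: "s \<in> J" "finite S" "S \<subseteq> J" using insert by auto
    have split: "measure Q {\<omega>\<in>space Q. (\<forall>k\<in>insert s S. a k < U k \<omega>) \<and> (\<forall>k\<in>J. U k \<omega> \<le> b k)} =
       measure Q {\<omega>\<in>space Q. (\<forall>k\<in>S. a k < U k \<omega>) \<and> (\<forall>k\<in>J. U k \<omega> \<le> b k)} -
       measure Q {\<omega>\<in>space Q. (\<forall>k\<in>S. a k < U k \<omega>) \<and> (\<forall>k\<in>J. U k \<omega> \<le> b' k)}"
      if Q: "prob_space Q" and U[measurable]: "\<And>k. U k \<in> borel_measurable Q"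
      for Q and U :: "nat \<Rightarrow> _ \<Rightarrow> real"
    proof -
      interpret Q: prob_space Q by fact
      note [measurable] = countable_finite[OF J] countable_finite[OF sJ(2)]
      let ?A = "{\<omega>\<in>space Q. (\<forall>k\<in>S. a k < U k \<omega>) \<and> (\<forall>k\<in>J. U k \<omega> \<le> b k)}"
      let ?B = "{\<omega>\<in>space Q. (\<forall>k\<in>S. a k < U k \<omega>) \<and> (\<forall>k\<in>J. U k \<omega> \<le> b' k)}"
      have ab: "a s \<le> b s" using insert.prems by auto
      have "{\<omega>\<in>space Q. (\<forall>k\<in>insert s S. a k < U k \<omega>) \<and> (\<forall>k\<in>J. U k \<omega> \<le> b k)} = ?A - ?B"
        using sJ(1) by (auto simp: b'_def)
      moreover have "?B \<subseteq> ?A" using ab by (auto simp: b'_def split: if_splits)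
      moreover have "?A \<in> sets Q" "?B \<in> sets Q" by measurable
      ultimately show ?thesis by (simp add: Q.finite_measure_Diff)
    qed
    show ?case unfolding split[OF M V] split[OF N W]
    proof (rule tendsto_diff)
      show "(\<lambda>m. measure M {\<omega>\<in>space M. (\<forall>k\<in>S. a k < V m k \<omega>) \<and> (\<forall>k\<in>J. V m k \<omega> \<le> b k)})
       \<longlonglongrightarrow> measure N {\<omega>\<in>space N. (\<forall>k\<in>S. a k < W k \<omega>) \<and> (\<forall>k\<in>J. W k \<omega> \<le> b k)}"
        using insert by auto
      show "(\<lambda>m. measure M {\<omega>\<in>space M. (\<forall>k\<in>S. a k < V m k \<omega>) \<and> (\<forall>k\<in>J. V m k \<omega> \<le> b' k)})
       \<longlonglongrightarrow> measure N {\<omega>\<in>space N. (\<forall>k\<in>S. a k < W k \<omega>) \<and> (\<forall>k\<in>J. W k \<omega> \<le> b' k)}"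
        by (rule insert.IH) (use insert in \<open>auto simp: b'_def\<close>)
    qed
  qed
  show ?thesis unfolding weak_conv_borel_def
  proof (intro allI impI, elim conjE)
    fix f :: "(nat \<Rightarrow> real) \<Rightarrow> real"
    assume cont: "continuous_on UNIV f" and "bounded (range f)"
    then obtain B where B: "B > 0" "\<And>x. \<bar>f x\<bar> \<le> B"
      unfolding bounded_pos by auto
    have fm: "f \<in> borel_measurable borel" by (rule borel_measurable_continuous_onI[OF cont])
    let ?EV = "\<lambda>m. \<integral>x. f x \<partial>distr M borel (\<lambda>\<omega>. restrict (\<lambda>k. V m k \<omega>) J)"
    let ?EW = "\<integral>x. f x \<partial>distr N borel (\<lambda>\<omega>. restrict (\<lambda>k. W k \<omega>) J)"
    show "?EV \<longlonglongrightarrow> ?EW"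
    proof (rule LIMSEQ_I)
      fix r :: real assume r: "r > 0"
      \<comment> \<open>Two approximation errors of at most \<open>e + B * e\<close> each and a
        difference of the grid sums below \<open>e\<close> must fit into
        \<open>r = 4 * (e + B * e)\<close>.\<close>
      define e where "e = r / (4 * (B + 1))"
      have e: "e > 0" "4 * (e + B * e) = r"
      proof -
        have "4 * (e + B * e) = 4 * (B + 1) * e" by (simp add: algebra_simps)
        then show "4 * (e + B * e) = r" using B(1) unfolding e_def by simp
      qed (use r B in \<open>simp add: e_def\<close>)
      note [measurable] = countable_finite[OF J]
      let ?box = "\<lambda>A. {\<omega>\<in>space N. (\<forall>k\<in>J. - A < W k \<omega>) \<and> (\<forall>k\<in>J. W k \<omega> \<le> A)}"
      obtain A where A: "A > 0" "1 - measure N (?box A) < e"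
      proof -
        have "(\<lambda>n. measure N (?box (real n))) \<longlonglongrightarrow> measure N (\<Union>n. ?box (real n))"
        proof (rule N.finite_Lim_measure_incseq)
          show "range (\<lambda>n. ?box (real n)) \<subseteq> sets N" by auto
          show "incseq (\<lambda>n. ?box (real n))"
            by (rule incseq_SucI) force
        qed
        moreover have "(\<Union>n. ?box (real n)) = space N"
        proof -
          have "\<exists>n. (\<forall>k\<in>J. - real n < W k \<omega>) \<and> (\<forall>k\<in>J. W k \<omega> \<le> real n)" for \<omega>
          proof -
            obtain n where n: "real n > (\<Sum>k\<in>J. \<bar>W k \<omega>\<bar>)" using reals_Archimedean2 by blast
            have "\<bar>W k \<omega>\<bar> < real n" if "k \<in> J" for k
              using member_le_sum[OF that, of "\<lambda>k. \<bar>W k \<omega>\<bar>"] J n by auto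
            then show ?thesis by (intro exI[of _ n]) (auto simp: abs_less_iff less_imp_le minus_less_iff)
          qed
          then show ?thesis by auto
        qed
        ultimately have "(\<lambda>n. measure N (?box (real n))) \<longlonglongrightarrow> 1" by (simp add: N.prob_space)
        then have "\<forall>\<^sub>F n in sequentially. measure N (?box (real n)) > 1 - e"
          using e by (intro order_tendstoD) auto
        then obtain n where "n \<ge> 1" "measure N (?box (real n)) > 1 - e"
          using eventually_ge_at_top[of 1] by (metis (mono_tags, lifting) eventually_conj eventually_happens sequentially_bot)
        then show ?thesis by (intro that[of "real n"]) auto
      qed
      obtain n where n: "n > 0"
        "\<And>v. \<bar>f (restrict v J) - (\<Sum>\<tau>\<in>PiE J (\<lambda>_. {..<n}). f (grid_corner J A n \<tau>) * of_bool (in_cell J A n \<tau> v))\<bar>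
          \<le> e + B * of_bool (\<not> ((\<forall>k\<in>J. - A < v k) \<and> (\<forall>k\<in>J. v k \<le> A)))"
        using grid_approximation[OF J cont B(2) A(1) e(1)] by blast
      let ?T = "PiE J (\<lambda>_. {..<n})"
      have finT: "finite ?T" using J by (intro finite_PiE) auto
      let ?gV = "\<lambda>m. \<Sum>\<tau>\<in>?T. f (grid_corner J A n \<tau>) * measure M {\<omega>\<in>space M. in_cell J A n \<tau> (\<lambda>k. V m k \<omega>)}"
      let ?gW = "\<Sum>\<tau>\<in>?T. f (grid_corner J A n \<tau>) * measure N {\<omega>\<in>space N. in_cell J A n \<tau> (\<lambda>k. W k \<omega>)}"
      let ?bV = "\<lambda>m. measure M {\<omega>\<in>space M. (\<forall>k\<in>J. - A < V m k \<omega>) \<and> (\<forall>k\<in>J. V m k \<omega> \<le> A)}"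
      have appV: "\<bar>?EV m - ?gV m\<bar> \<le> e + B * (1 - ?bV m)" for m
        by (rule M.expectation_grid_approximation[OF J fm B(2) n(2) finT V])
      have appW: "\<bar>?EW - ?gW\<bar> \<le> e + B * (1 - measure N (?box A))"
        by (rule N.expectation_grid_approximation[OF J fm B(2) n(2) finT W])
      have limg: "?gV \<longlonglongrightarrow> ?gW"
        unfolding in_cell_def
        by (intro tendsto_sum tendsto_mult tendsto_const rect order_refl)
           (use A(1) n(1) in \<open>auto simp: field_simps\<close>)
      have limb: "?bV \<longlonglongrightarrow> measure N (?box A)"
        by (rule rect) (use A(1) in auto)
      have "\<forall>\<^sub>F m in sequentially. 1 - ?bV m < e"
        using order_tendstoD(1)[OF limb, of "1 - e"] A(2) by (auto elim!: eventually_mono)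
      moreover have "\<forall>\<^sub>F m in sequentially. \<bar>?gV m - ?gW\<bar> < e"
        using LIMSEQ_D[OF limg e(1)] unfolding eventually_sequentially by auto
      ultimately have "\<forall>\<^sub>F m in sequentially. norm (?EV m - ?EW) < r"
      proof eventually_elim
        case (elim m)
        have "B * (1 - ?bV m) \<le> B * e" "B * (1 - measure N (?box A)) \<le> B * e"
          using elim A(2) B(1) by (auto intro!: mult_left_mono)
        then have dV: "\<bar>?EV m - ?gV m\<bar> \<le> e + B * e" and dW: "\<bar>?EW - ?gW\<bar> \<le> e + B * e"
          using appV[of m] appW by (meson add_left_mono order_trans)+
        have tri: "\<bar>a - b\<bar> < 2 * x + e" if "\<bar>a - g\<bar> \<le> x" "\<bar>b - h\<bar> \<le> x" "\<bar>g - h\<bar> < e" for a b g h x :: real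
          using that by linarith
        have "\<bar>?EV m - ?EW\<bar> < 2 * (e + B * e) + e"
          by (rule tri[OF dV dW elim(2)])
        also have "\<dots> \<le> r"
          using e mult_pos_pos[OF B(1) e(1)] by (simp add: distrib_left)
        finally show ?case by simp
      qed
      then show "\<exists>no. \<forall>m\<ge>no. norm (?EV m - ?EW) < r" unfolding eventually_sequentially .
    qed
  qed
qed

subsection \<open>Exponential inequalities, moments and almost sure limits\<close>

text \<open>Taylor's formula with Lagrange remainder. The factor \<open>exp \<bar>u\<bar>\<close>
  keeps the bound valid for large \<open>u\<close>: the Chernoff exponent used later, times the
  truncation level, grows like a logarithm.\<close>

lemma exp_le_quadratic:
  fixes u :: real
  shows "exp u \<le> 1 + u + u\<^sup>2 * exp \<bar>u\<bar>"
proof -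
  obtain t where t: "\<bar>t\<bar> \<le> \<bar>u\<bar>" "exp u = (\<Sum>m<2. (u ^ m) / fact m) + (exp t / fact 2) * u ^ 2"
    using Maclaurin_exp_le[of u 2] by blast
  have "exp t / 2 * u\<^sup>2 \<le> exp \<bar>u\<bar> * u\<^sup>2"
  proof (rule mult_right_mono)
    have "exp t \<le> exp \<bar>u\<bar>" using t(1) by simp
    then show "exp t / 2 \<le> exp \<bar>u\<bar>" using exp_ge_zero[of t] by linarith
  qed simp
  then show ?thesis using t(2) by (simp add: numeral_2_eq_2 mult.commute)
qed

text \<open>The zero mean removes the linear term, and \<open>1 + x \<le> exp x\<close> gives a form
  that multiplies well over independent summands.\<close>

lemma (in prob_space) centered_exp_bound:
  fixes U :: "'a \<Rightarrow> real"
  assumes [measurable]: "U \<in> borel_measurable M" and bd: "\<And>\<omega>. \<bar>U \<omega>\<bar> \<le> B"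
    and zero: "expectation U = 0" and h: "h \<ge> 0"
  shows "integrable M (\<lambda>\<omega>. exp (h * U \<omega>))"
    and "expectation (\<lambda>\<omega>. exp (h * U \<omega>)) \<le> exp (h\<^sup>2 * exp (h * B) * expectation (\<lambda>\<omega>. (U \<omega>)\<^sup>2))"
proof -
  have B: "B \<ge> 0" using bd[of undefined] by linarith
  have le: "h * U \<omega> \<le> h * B" "\<bar>h * U \<omega>\<bar> \<le> h * B" for \<omega>
    using bd[of \<omega>] h by (auto simp: abs_mult intro!: mult_left_mono)
  show int: "integrable M (\<lambda>\<omega>. exp (h * U \<omega>))"
    by (rule integrable_const_bound[where B="exp (h * B)"]) (use le in auto)
  have intU: "integrable M U"
    by (rule integrable_const_bound[where B=B]) (use bd in auto)
  have intU2: "integrable M (\<lambda>\<omega>. (U \<omega>)\<^sup>2)"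
    by (rule integrable_const_bound[where B="B\<^sup>2"])
       (use bd B in \<open>auto intro!: abs_le_square_iff[THEN iffD1]\<close>)
  have "expectation (\<lambda>\<omega>. exp (h * U \<omega>)) \<le>
        expectation (\<lambda>\<omega>. 1 + h * U \<omega> + h\<^sup>2 * exp (h * B) * (U \<omega>)\<^sup>2)"
  proof (rule integral_mono[OF int])
    show "integrable M (\<lambda>\<omega>. 1 + h * U \<omega> + h\<^sup>2 * exp (h * B) * (U \<omega>)\<^sup>2)"
      using intU intU2 by auto
    fix \<omega>
    have "exp (h * U \<omega>) \<le> 1 + h * U \<omega> + (h * U \<omega>)\<^sup>2 * exp \<bar>h * U \<omega>\<bar>"
      by (rule exp_le_quadratic)
    also have "(h * U \<omega>)\<^sup>2 * exp \<bar>h * U \<omega>\<bar> \<le> (h * U \<omega>)\<^sup>2 * exp (h * B)"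
      by (rule mult_left_mono) (use le in auto)
    finally show "exp (h * U \<omega>) \<le> 1 + h * U \<omega> + h\<^sup>2 * exp (h * B) * (U \<omega>)\<^sup>2"
      by (simp add: power_mult_distrib mult_ac)
  qed
  also have "\<dots> = 1 + h\<^sup>2 * exp (h * B) * expectation (\<lambda>\<omega>. (U \<omega>)\<^sup>2)"
    using intU intU2 zero by (simp add: prob_space)
  also have "\<dots> \<le> exp (h\<^sup>2 * exp (h * B) * expectation (\<lambda>\<omega>. (U \<omega>)\<^sup>2))"
    by (rule exp_ge_add_one_self)
  finally show "expectation (\<lambda>\<omega>. exp (h * U \<omega>)) \<le> exp (h\<^sup>2 * exp (h * B) * expectation (\<lambda>\<omega>. (U \<omega>)\<^sup>2))" .
qed

text \<open>Markov's inequality for the exponential, whose expectation factors by independence.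
  Centering may double the bound \<open>D\<close>, hence the 2 in \<open>exp (2 * h * D)\<close>,
  but it only lowers second moments, so \<open>V\<close> can bound the uncentered ones.\<close>

lemma (in prob_space) chernoff_centered_sum:
  fixes Y :: "'i \<Rightarrow> 'a \<Rightarrow> real"
  assumes fin: "finite F" and ind: "indep_vars (\<lambda>_. borel) Y F"
    and bd: "\<And>i \<omega>. i \<in> F \<Longrightarrow> \<bar>Y i \<omega>\<bar> \<le> D"
    and V: "(\<Sum>i\<in>F. expectation (\<lambda>\<omega>. (Y i \<omega>)\<^sup>2)) \<le> V" and h: "h \<ge> 0"
  shows "prob {\<omega>\<in>space M. (\<Sum>i\<in>F. Y i \<omega> - expectation (Y i)) > s} \<le> exp (- h * s + h\<^sup>2 * exp (2 * h * D) * V)"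
proof -
  define U where "U i \<omega> = Y i \<omega> - expectation (Y i)" for i \<omega>
  have meas[measurable]: "Y i \<in> borel_measurable M" if "i \<in> F" for i
    using ind that by (auto simp: indep_vars_def)
  have measU[measurable]: "U i \<in> borel_measurable M" if "i \<in> F" for i
    using meas[OF that] unfolding U_def by measurable
  have intY: "integrable M (Y i)" if "i \<in> F" for i
    by (rule integrable_const_bound[where B=D]) (use bd that in auto)
  have intY2: "integrable M (\<lambda>\<omega>. (Y i \<omega>)\<^sup>2)" if "i \<in> F" for i
  proof (rule integrable_const_bound[where B="D\<^sup>2"])
    show "AE \<omega> in M. norm ((Y i \<omega>)\<^sup>2) \<le> D\<^sup>2"
    proof (rule AE_I2)
      fix \<omega>
      have "\<bar>Y i \<omega>\<bar>\<^sup>2 \<le> D\<^sup>2" by (rule power_mono) (use bd that in auto)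
      then show "norm ((Y i \<omega>)\<^sup>2) \<le> D\<^sup>2" by simp
    qed
  qed (use that in measurable)
  have EY: "\<bar>expectation (Y i)\<bar> \<le> D" if "i \<in> F" for i
  proof -
    have "\<bar>expectation (Y i)\<bar> \<le> expectation (\<lambda>\<omega>. \<bar>Y i \<omega>\<bar>)" by (rule integral_abs_bound)
    also have "\<dots> \<le> expectation (\<lambda>\<omega>. D)"
      by (rule integral_mono) (use intY that bd in auto)
    finally show ?thesis by (simp add: prob_space)
  qed
  have Ubd: "\<bar>U i \<omega>\<bar> \<le> 2 * D" if "i \<in> F" for i \<omega>
    using EY[OF that] bd[OF that, of \<omega>] unfolding U_def by linarith
  have EU: "expectation (U i) = 0" if "i \<in> F" for i
    using intY[OF that] unfolding U_def by (simp add: prob_space)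
  have EU2: "expectation (\<lambda>\<omega>. (U i \<omega>)\<^sup>2) \<le> expectation (\<lambda>\<omega>. (Y i \<omega>)\<^sup>2)" if "i \<in> F" for i
    using variance_eq[OF intY[OF that] intY2[OF that]] unfolding U_def by simp
  have indU: "indep_vars (\<lambda>_. borel) (\<lambda>i \<omega>. exp (h * U i \<omega>)) F"
    unfolding U_def by (rule indep_vars_compose2[OF ind]) measurable
  note eb = centered_exp_bound[OF measU Ubd EU h]
  have inte: "integrable M (\<lambda>\<omega>. exp (h * U i \<omega>))" if "i \<in> F" for i
    using eb(1)[OF that that that] .
  let ?S = "\<lambda>\<omega>. \<Sum>i\<in>F. U i \<omega>"
  have eq: "exp (h * ?S \<omega>) = (\<Prod>i\<in>F. exp (h * U i \<omega>))" for \<omega>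
    by (simp add: sum_distrib_left exp_sum fin)
  have intS: "integrable M (\<lambda>\<omega>. exp (h * ?S \<omega>))"
    unfolding eq by (rule indep_vars_integrable[OF fin indU inte])
  have "expectation (\<lambda>\<omega>. exp (h * ?S \<omega>)) = (\<Prod>i\<in>F. expectation (\<lambda>\<omega>. exp (h * U i \<omega>)))"
    unfolding eq by (rule indep_vars_lebesgue_integral[OF fin indU inte])
  also have "\<dots> \<le> (\<Prod>i\<in>F. exp (h\<^sup>2 * exp (h * (2 * D)) * expectation (\<lambda>\<omega>. (U i \<omega>)\<^sup>2)))"
    by (rule prod_mono) (use eb(2) in \<open>auto intro!: integral_nonneg_AE\<close>)
  also have "\<dots> = exp (h\<^sup>2 * exp (h * (2 * D)) * (\<Sum>i\<in>F. expectation (\<lambda>\<omega>. (U i \<omega>)\<^sup>2)))"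
    by (simp add: exp_sum fin sum_distrib_left)
  also have "\<dots> \<le> exp (h\<^sup>2 * exp (2 * h * D) * V)"
  proof -
    have "(\<Sum>i\<in>F. expectation (\<lambda>\<omega>. (U i \<omega>)\<^sup>2)) \<le> V"
      using V by (rule order_trans[rotated]) (intro sum_mono EU2)
    then have "h\<^sup>2 * exp (2 * h * D) * (\<Sum>i\<in>F. expectation (\<lambda>\<omega>. (U i \<omega>)\<^sup>2)) \<le> h\<^sup>2 * exp (2 * h * D) * V"
      by (intro mult_left_mono) auto
    then show ?thesis by (simp add: mult_ac)
  qed
  finally have E: "expectation (\<lambda>\<omega>. exp (h * ?S \<omega>)) \<le> exp (h\<^sup>2 * exp (2 * h * D) * V)" .
  have mS[measurable]: "?S \<in> borel_measurable M" by (rule borel_measurable_sum) (rule measU)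
  have "prob {\<omega>\<in>space M. ?S \<omega> > s} \<le> prob {\<omega>\<in>space M. exp (h * ?S \<omega>) \<ge> exp (h * s)}"
    by (rule finite_measure_mono) (auto intro!: mult_left_mono h)
  also have "\<dots> \<le> expectation (\<lambda>\<omega>. exp (h * ?S \<omega>)) / exp (h * s)"
    by (rule integral_Markov_inequality_measure[OF intS, of "{}", simplified]) auto
  also have "\<dots> \<le> exp (h\<^sup>2 * exp (2 * h * D) * V) / exp (h * s)"
    by (rule divide_right_mono[OF E]) simp
  also have "\<dots> = exp (- h * s + h\<^sup>2 * exp (2 * h * D) * V)"
    unfolding exp_diff[symmetric] by (simp add: algebra_simps)
  finally show ?thesis unfolding U_def .
qed

lemma (in prob_space) chernoff_centered_sum_abs:
  fixes Y :: "'i \<Rightarrow> 'a \<Rightarrow> real"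
  assumes fin: "finite F" and ind: "indep_vars (\<lambda>_. borel) Y F"
    and bd: "\<And>i \<omega>. i \<in> F \<Longrightarrow> \<bar>Y i \<omega>\<bar> \<le> D"
    and V: "(\<Sum>i\<in>F. expectation (\<lambda>\<omega>. (Y i \<omega>)\<^sup>2)) \<le> V" and h: "h \<ge> 0"
  shows "prob {\<omega>\<in>space M. \<bar>(\<Sum>i\<in>F. Y i \<omega>) - (\<Sum>i\<in>F. expectation (Y i))\<bar> > s}
    \<le> 2 * exp (- h * s + h\<^sup>2 * exp (2 * h * D) * V)"
proof -
  have meas[measurable]: "Y i \<in> borel_measurable M" if "i \<in> F" for i
    using ind that by (auto simp: indep_vars_def)
  have mS[measurable]: "(\<lambda>\<omega>. \<Sum>i\<in>F. Y i \<omega>) \<in> borel_measurable M"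
    by (rule borel_measurable_sum) (rule meas)
  let ?A = "{\<omega>\<in>space M. (\<Sum>i\<in>F. Y i \<omega> - expectation (Y i)) > s}"
  let ?B = "{\<omega>\<in>space M. (\<Sum>i\<in>F. - Y i \<omega> - expectation (\<lambda>\<omega>. - Y i \<omega>)) > s}"
  have [measurable]: "?A \<in> events" "?B \<in> events"
    by (simp_all add: sum_subtractf sum_negf)
  have "prob {\<omega>\<in>space M. \<bar>(\<Sum>i\<in>F. Y i \<omega>) - (\<Sum>i\<in>F. expectation (Y i))\<bar> > s} \<le> prob (?A \<union> ?B)"
    by (rule finite_measure_mono) (auto simp: sum_subtractf sum_negf)
  also have "\<dots> \<le> prob ?A + prob ?B" by (rule measure_Un_le) auto
  also have "prob ?A \<le> exp (- h * s + h\<^sup>2 * exp (2 * h * D) * V)"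
    by (rule chernoff_centered_sum[OF fin ind bd V h])
  also have "prob ?B \<le> exp (- h * s + h\<^sup>2 * exp (2 * h * D) * V)"
  proof (rule chernoff_centered_sum[OF fin _ _ _ h])
    show "indep_vars (\<lambda>_. borel) (\<lambda>i \<omega>. - Y i \<omega>) F"
      by (rule indep_vars_compose2[OF ind]) measurable
  qed (use bd V in auto)
  finally show ?thesis by simp
qed

text \<open>Since \<open>m * a m\<close> converges, \<open>a m\<close> tends to 0. The upper bound
  is \<open>1 - a \<le> exp (- a)\<close>; the lower one is the second-order bound on the logarithm,
  whose accumulated error \<open>2 * (m * a m) * a m\<close> vanishes.\<close>

lemma power_one_minus_tendsto_exp:
  fixes a :: "nat \<Rightarrow> real"
  assumes lim: "(\<lambda>m. real m * a m) \<longlonglongrightarrow> l"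
  shows "(\<lambda>m. (1 - a m) ^ m) \<longlonglongrightarrow> exp (- l)"
proof -
  have a0: "a \<longlonglongrightarrow> 0"
  proof -
    have "(\<lambda>m. (real m * a m) * (1 / real m)) \<longlonglongrightarrow> l * 0"
      by (intro tendsto_mult lim lim_1_over_n)
    moreover have "\<forall>\<^sub>F m in sequentially. (real m * a m) * (1 / real m) = a m"
      using eventually_gt_at_top[of 0] by eventually_elim auto
    ultimately show ?thesis using tendsto_cong by fastforce
  qed
  show ?thesis
  proof (rule tendsto_sandwich)
    show "\<forall>\<^sub>F m in sequentially. (1 - a m) ^ m \<le> exp (- (real m * a m))"
    proof -
      have "\<forall>\<^sub>F m in sequentially. a m < 1"
        using order_tendstoD(2)[OF a0] by simp
      then show ?thesis
      proof eventually_elim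
        case (elim m)
        have "(1 - a m) ^ m \<le> exp (- a m) ^ m"
          by (rule power_mono) (use elim exp_ge_add_one_self[of "- a m"] in auto)
        then show ?case by (simp add: exp_of_nat_mult[symmetric])
      qed
    qed
    show "\<forall>\<^sub>F m in sequentially. exp (- (real m * a m) - 2 * (real m * a m) * a m) \<le> (1 - a m) ^ m"
    proof -
      have "\<forall>\<^sub>F m in sequentially. norm (a m) < 1/2"
        using tendsto_norm[OF a0] by (intro order_tendstoD(2)[where y=0]) auto
      then show ?thesis
      proof eventually_elim
        case (elim m)
        have "\<bar>ln (1 + - a m) - - a m\<bar> \<le> 2 * (- a m)\<^sup>2"
          by (rule abs_ln_one_plus_x_minus_x_bound) (use elim in auto)
        then have "- a m - 2 * (a m)\<^sup>2 \<le> ln (1 - a m)" by (simp add: abs_if split: if_splits)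
        then have "exp (- a m - 2 * (a m)\<^sup>2) \<le> 1 - a m"
          using elim by (subst (asm) ln_ge_iff) auto
        then have "exp (- a m - 2 * (a m)\<^sup>2) ^ m \<le> (1 - a m) ^ m" by (rule power_mono) simp
        then show ?case by (simp add: exp_of_nat_mult[symmetric] algebra_simps power2_eq_square)
      qed
    qed
    have "(\<lambda>m. exp (- (real m * a m) - 2 * (real m * a m) * a m)) \<longlonglongrightarrow> exp (- l - 2 * l * 0)"
      by (intro tendsto_intros lim a0)
    then show "(\<lambda>m. exp (- (real m * a m) - 2 * (real m * a m) * a m)) \<longlonglongrightarrow> exp (- l)" by simp
    show "(\<lambda>m. exp (- (real m * a m))) \<longlonglongrightarrow> exp (- l)" by (intro tendsto_intros lim)
  qed
qed

text \<open>Dyadic layers: on \<open>2 ^ k < \<bar>U\<bar> \<le> 2 ^ Suc k\<close> the power is at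
  most \<open>2 powr (Suc k * r)\<close>, and the tail bound leaves a geometric series with ratio
  \<open>2 powr (r - \<alpha>) < 1\<close>.\<close>

lemma (in prob_space) integrable_powr_of_tail:
  fixes U :: "'a \<Rightarrow> real"
  assumes [measurable]: "U \<in> borel_measurable M"
    and tail: "\<And>x. x > 0 \<Longrightarrow> prob {\<omega>\<in>space M. \<bar>U \<omega>\<bar> > x} \<le> C * x powr (- \<alpha>)"
    and r: "0 < r" "r < \<alpha>"
  shows "integrable M (\<lambda>\<omega>. \<bar>U \<omega>\<bar> powr r)"
proof (rule integrableI_bounded)
  let ?A = "\<lambda>k::nat. {\<omega>\<in>space M. \<bar>U \<omega>\<bar> > 2 ^ k}"
  let ?b = "\<lambda>k::nat. (2::real) powr (real (Suc k) * r)"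
  have C: "C \<ge> 0" using order_trans[OF measure_nonneg tail[of 1]] by simp
  have pt: "ennreal (norm (\<bar>U \<omega>\<bar> powr r)) \<le> 1 + (\<Sum>k. ennreal (?b k) * indicator (?A k) \<omega>)" if w: "\<omega> \<in> space M" for \<omega>
  proof (cases "\<bar>U \<omega>\<bar> \<le> 1")
    case True
    then have "\<bar>U \<omega>\<bar> powr r \<le> 1" using r by (intro powr_le1) auto
    then have "ennreal (norm (\<bar>U \<omega>\<bar> powr r)) \<le> 1" by (simp only: ennreal_le_1 real_norm_def abs_of_nonneg powr_ge_zero)
    then show ?thesis by (rule add_increasing2[rotated]) simp
  next
    case False
    define n where "n = (LEAST n. \<bar>U \<omega>\<bar> \<le> 2 ^ n)"
    have "\<exists>n. \<bar>U \<omega>\<bar> \<le> 2 ^ n" using real_arch_pow[of 2 "\<bar>U \<omega>\<bar>"] less_imp_le by auto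
    then have n: "\<bar>U \<omega>\<bar> \<le> 2 ^ n" unfolding n_def by (rule LeastI_ex)
    then have "n \<noteq> 0" using False by (intro notI) simp
    then obtain k where k: "n = Suc k" by (cases n) auto
    have gt: "\<bar>U \<omega>\<bar> > 2 ^ k" using not_less_Least[of k "\<lambda>n. \<bar>U \<omega>\<bar> \<le> 2 ^ n"] k unfolding n_def by auto
    have "\<bar>U \<omega>\<bar> powr r \<le> (2 ^ Suc k) powr r"
      using n r unfolding k by (intro powr_mono2) auto
    also have "(2 ^ Suc k) powr r = ?b k"
      by (simp only: powr_realpow[symmetric] powr_powr zero_less_numeral)
    finally have "ennreal (norm (\<bar>U \<omega>\<bar> powr r)) \<le> ennreal (?b k) * indicator (?A k) \<omega>"
      using gt w by (simp add: ennreal_leI)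
    also have "\<dots> \<le> (\<Sum>k. ennreal (?b k) * indicator (?A k) \<omega>)"
    proof -
      have "g k \<le> suminf g" for g :: "nat \<Rightarrow> ennreal"
        using sum_le_suminf[of g "{k}"] by simp
      then show ?thesis .
    qed
    finally show ?thesis by (rule add_increasing[rotated]) simp
  qed
  have "(\<integral>\<^sup>+\<omega>. ennreal (norm (\<bar>U \<omega>\<bar> powr r)) \<partial>M) \<le>
      (\<integral>\<^sup>+\<omega>. 1 + (\<Sum>k. ennreal (?b k) * indicator (?A k) \<omega>) \<partial>M)"
    by (rule nn_integral_mono) (rule pt)
  also have "\<dots> = 1 + (\<Sum>k. ennreal (?b k) * emeasure M (?A k))"
    by (simp add: nn_integral_add nn_integral_suminf nn_integral_cmult_indicator emeasure_space_1)
  also have "\<dots> \<le> 1 + (\<Sum>k. ennreal (C * 2 powr r * (2 powr (r - \<alpha>)) ^ k))"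
  proof (intro add_left_mono suminf_le)
    fix k
    have "?b k * prob (?A k) \<le> ?b k * (C * (2 ^ k) powr (- \<alpha>))"
      by (intro mult_left_mono tail) auto
    also have "(2 ^ k) powr (- \<alpha>) = (2::real) powr (- \<alpha> * real k)"
      by (simp add: powr_realpow[symmetric] powr_powr mult.commute del: powr_minus)
    also have "?b k * (C * 2 powr (- \<alpha> * real k)) = C * 2 powr r * (2 powr (r - \<alpha>)) ^ k"
    proof -
      have "?b k * (C * 2 powr (- \<alpha> * real k)) = C * 2 powr (real (Suc k) * r + - \<alpha> * real k)"
        by (simp only: powr_add) simp
      also have "real (Suc k) * r + - \<alpha> * real k = r + real k * (r - \<alpha>)" by (simp add: algebra_simps)
      also have "C * 2 powr (r + real k * (r - \<alpha>)) = C * 2 powr r * (2 powr (r - \<alpha>)) powr real k"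
        by (simp add: powr_add powr_powr mult.commute)
      finally show ?thesis by (simp add: powr_realpow)
    qed
    finally show "ennreal (?b k) * emeasure M (?A k) \<le> ennreal (C * 2 powr r * (2 powr (r - \<alpha>)) ^ k)"
      by (simp add: emeasure_eq_measure ennreal_mult[symmetric] ennreal_leI)
  qed auto
  also have "\<dots> < \<infinity>"
  proof -
    have "2 powr (r - \<alpha>) < (1::real)" using r by (simp add: powr_less_one)
    then have "summable (\<lambda>k. C * 2 powr r * (2 powr (r - \<alpha>)) ^ k)"
      by (intro summable_mult summable_geometric) simp
    then have "(\<Sum>k. ennreal (C * 2 powr r * (2 powr (r - \<alpha>)) ^ k)) \<noteq> \<top>"
      using C by (intro ennreal_suminf_neq_top) auto
    then show ?thesis by (simp add: top.not_eq_extremum)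
  qed
  finally show "(\<integral>\<^sup>+\<omega>. ennreal (norm (\<bar>U \<omega>\<bar> powr r)) \<partial>M) < \<infinity>" .
qed measurable

text \<open>A convergent sequence is bounded, so the events that all \<open>\<bar>T n\<bar>\<close>
  stay below \<open>K\<close> increase to a set of full measure, and one \<open>K\<close> serves
  every \<open>n\<close>.\<close>

lemma (in prob_space) tight_of_AE_convergent:
  fixes T :: "nat \<Rightarrow> 'a \<Rightarrow> real"
  assumes [measurable]: "\<And>n. T n \<in> borel_measurable M"
    and conv: "AE \<omega> in M. convergent (\<lambda>n. T n \<omega>)" and e: "e > 0"
  obtains K where "K > 0" "\<And>n. prob {\<omega>\<in>space M. \<bar>T n \<omega>\<bar> > K} < e"
proof -
  let ?A = "\<lambda>K::nat. {\<omega>\<in>space M. \<forall>n. \<bar>T n \<omega>\<bar> \<le> real K}"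
  have [measurable]: "?A K \<in> events" for K by measurable
  have "(\<lambda>K. prob (?A K)) \<longlonglongrightarrow> prob (\<Union>K. ?A K)"
    by (rule finite_Lim_measure_incseq) (auto intro!: incseq_SucI intro: order_trans)
  moreover have "prob (\<Union>K. ?A K) = 1"
  proof -
    have "AE \<omega> in M. \<omega> \<in> (\<Union>K. ?A K)"
      using conv AE_space
    proof eventually_elim
      case (elim \<omega>)
      then obtain K where K: "\<forall>n. \<bar>T n \<omega>\<bar> \<le> K"
        using convergent_imp_Bseq[of "\<lambda>n. T n \<omega>"] unfolding Bseq_def by auto
      obtain k :: nat where "K \<le> real k" using real_arch_simple by blast
      then show ?case using K elim(2) by (auto intro: order_trans)
    qed
    then show ?thesis by (subst prob_eq_1) auto
  qed
  ultimately have "(\<lambda>K. prob (?A K)) \<longlonglongrightarrow> 1" by simp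
  then have "\<forall>\<^sub>F K in sequentially. prob (?A K) > 1 - e"
    using e by (intro order_tendstoD) auto
  then obtain K where K: "K \<ge> 1" "prob (?A K) > 1 - e"
    using eventually_ge_at_top[of 1] by (metis (mono_tags, lifting) eventually_conj eventually_happens sequentially_bot)
  show ?thesis
  proof (rule that[of "real K"])
    fix n
    have "prob {\<omega>\<in>space M. \<bar>T n \<omega>\<bar> > real K} \<le> prob (space M - ?A K)"
      by (rule finite_measure_mono) (auto simp: not_le[symmetric])
    also have "\<dots> = 1 - prob (?A K)" by (rule prob_compl) simp
    finally show "prob {\<omega>\<in>space M. \<bar>T n \<omega>\<bar> > real K} < e" using K by linarith
  qed (use K in simp)
qed


text \<open>Needed for the reflected index \<open>j - i\<close>: the innovations seen from site
  \<open>j\<close> again form an independent family. By injectivity, events labelled by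
  \<open>i\<close> can be relabelled by \<open>f i\<close>.\<close>

lemma (in prob_space) indep_vars_inj_reindex:
  assumes ind: "indep_vars (\<lambda>_. N) U UNIV" and f: "inj f"
  shows "indep_vars (\<lambda>_. N) (\<lambda>i. U (f i)) UNIV"
  unfolding indep_vars_def2
proof (intro conjI ballI indep_setsI)
  show "random_variable N (U (f i))" for i using ind by (auto simp: indep_vars_def2)
  then show "{U (f i) -` A \<inter> space M |A. A \<in> sets N} \<subseteq> events" for i by (auto intro: measurable_sets)
  fix A J assume J: "J \<noteq> {}" "J \<subseteq> UNIV" "finite J"
    and A: "\<forall>i\<in>J. A i \<in> {U (f i) -` A \<inter> space M |A. A \<in> sets N}"
  have f': "inj_on f J" using f by (rule inj_on_subset) simp
  have "prob (\<Inter>k\<in>f ` J. A (inv f k)) = (\<Prod>k\<in>f ` J. prob (A (inv f k)))"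
    by (rule indep_setsD[of "\<lambda>k. {U k -` A \<inter> space M |A. A \<in> sets N}" UNIV])
       (use ind J A f in \<open>auto simp: indep_vars_def2 inv_f_f\<close>)
  then show "prob (\<Inter> (A ` J)) = (\<Prod>i\<in>J. prob (A i))"
    using f by (simp add: prod.reindex[OF f'] inv_f_f image_comp)
qed


text \<open>If the limit exceeds \<open>y\<close>, so do all late terms; the event is therefore
  covered, up to a null set, by the increasing events \<open>?A m\<close>, each of probability at
  most \<open>b\<close>. The strict inequality is essential, and \<open>G\<close> carries along a
  condition independent of \<open>n\<close>.\<close>

lemma (in prob_space) prob_greater_le_of_AE_tendsto:
  fixes T :: "nat \<Rightarrow> 'a \<Rightarrow> real" and U :: "'a \<Rightarrow> real"
  assumes [measurable]: "\<And>n. T n \<in> borel_measurable M" "U \<in> borel_measurable M" "G \<in> events"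
    and lim: "AE \<omega> in M. (\<lambda>n. T n \<omega>) \<longlonglongrightarrow> U \<omega>"
    and le: "\<And>n. n \<ge> N \<Longrightarrow> prob {\<omega>\<in>space M. T n \<omega> > y \<and> \<omega> \<in> G} \<le> b"
  shows "prob {\<omega>\<in>space M. U \<omega> > y \<and> \<omega> \<in> G} \<le> b"
proof -
  let ?A = "\<lambda>m. {\<omega>\<in>space M. (\<forall>n\<ge>m. T n \<omega> > y) \<and> \<omega> \<in> G}"
  have [measurable]: "?A m \<in> events" for m by measurable
  have "prob {\<omega>\<in>space M. U \<omega> > y \<and> \<omega> \<in> G} \<le> prob (\<Union>m. ?A m)"
  proof (rule finite_measure_mono_AE)
    show "AE \<omega> in M. \<omega> \<in> {\<omega>\<in>space M. U \<omega> > y \<and> \<omega> \<in> G} \<longrightarrow> \<omega> \<in> (\<Union>m. ?A m)"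
      using lim
    proof eventually_elim
      case (elim \<omega>)
      show ?case
      proof
        assume *: "\<omega> \<in> {\<omega>\<in>space M. U \<omega> > y \<and> \<omega> \<in> G}"
        then have "\<forall>\<^sub>F n in sequentially. T n \<omega> > y" using order_tendstoD(1)[OF elim] by simp
        then show "\<omega> \<in> (\<Union>m. ?A m)" using * unfolding eventually_sequentially by auto
      qed
    qed
  qed measurable
  also have "\<dots> \<le> b"
  proof (rule LIMSEQ_le_const2)
    show "(\<lambda>m. prob (?A m)) \<longlonglongrightarrow> prob (\<Union>m. ?A m)"
      by (rule finite_Lim_measure_incseq) (auto intro!: incseq_SucI)
    have "prob (?A m) \<le> b" for m
    proof -
      have "prob (?A m) \<le> prob {\<omega>\<in>space M. T (max m N) \<omega> > y \<and> \<omega> \<in> G}"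
        by (rule finite_measure_mono) auto
      also have "\<dots> \<le> b" by (rule le) simp
      finally show ?thesis .
    qed
    then show "\<exists>N. \<forall>m\<ge>N. prob (?A m) \<le> b" by blast
  qed
  finally show ?thesis .
qed


section \<open>Power decay and summability of the coefficients\<close>

lemma scaled_powr_neg_tendsto_0:
  fixes a K s :: real
  assumes "a > 0" "s > 0"
  shows "((\<lambda>y. K * (a * y) powr (- s)) \<longlongrightarrow> 0) at_top"
proof (rule tendsto_mult_right_zero, rule tendsto_neg_powr)
  show "LIM y at_top. a * y :> at_top"
    by (rule filterlim_tendsto_pos_mult_at_top[OF tendsto_const assms(1) filterlim_ident])
qed (use assms in simp)

text \<open>Every summand is at most the total \<open>T\<close>, so raising the exponent costs only
  the constant factor \<open>T powr ((r - s) / s)\<close>.\<close>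

lemma summable_on_abs_powr_mono:
  fixes c :: "'i \<Rightarrow> real"
  assumes sum: "(\<lambda>i. \<bar>c i\<bar> powr s) summable_on UNIV" and s: "0 < s" "s \<le> r"
  shows "(\<lambda>i. \<bar>c i\<bar> powr r) summable_on UNIV"
proof -
  define T where "T = (\<Sum>\<^sub>\<infinity>i. \<bar>c i\<bar> powr s)"
  have T: "\<bar>c i\<bar> powr s \<le> T" for i
    using finite_sum_le_infsum[OF sum, of "{i}"] unfolding T_def by simp
  have le: "\<bar>c i\<bar> powr r \<le> T powr ((r - s) / s) * \<bar>c i\<bar> powr s" for i
  proof -
    have "\<bar>c i\<bar> powr r = (\<bar>c i\<bar> powr s) powr ((r - s) / s) * \<bar>c i\<bar> powr s"
      using s by (simp add: powr_powr powr_add[symmetric])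
    also have "\<dots> \<le> T powr ((r - s) / s) * \<bar>c i\<bar> powr s"
      using s T by (intro mult_right_mono powr_mono2) auto
    finally show ?thesis .
  qed
  show ?thesis
    by (rule summable_on_comparison_test[OF summable_on_cmult_right[OF sum, of "T powr ((r - s) / s)"]])
       (use le in auto)
qed

text \<open>With a nonpositive exponent, a nonzero coefficient of size at most \<open>R\<close>
  contributes at least \<open>R powr s\<close>, and a finite total has room for finitely many of
  these. Zero coefficients are set apart because \<open>0 powr s = 0\<close>.\<close>

lemma finite_of_summable_abs_powr_nonpos:
  fixes c :: "'i \<Rightarrow> real"
  assumes sum: "(\<lambda>i. \<bar>c i\<bar> powr s) summable_on UNIV" and s: "s \<le> 0"
  shows "finite {i. c i \<noteq> 0 \<and> \<bar>c i\<bar> \<le> R}"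
proof (rule ccontr)
  assume inf: "infinite {i. c i \<noteq> 0 \<and> \<bar>c i\<bar> \<le> R}"
  let ?I = "{i. c i \<noteq> 0 \<and> \<bar>c i\<bar> \<le> R}"
  have ge: "R powr s \<le> \<bar>c i\<bar> powr s" if "i \<in> ?I" for i
    by (rule powr_mono2') (use that s in auto)
  obtain i0 where "i0 \<in> ?I" using inf by (metis finite.emptyI ex_in_conv)
  then have R: "R powr s > 0" by auto
  obtain n :: nat where n: "(\<Sum>\<^sub>\<infinity>i. \<bar>c i\<bar> powr s) < real n * R powr s"
    using reals_Archimedean3[OF R] by blast
  obtain F where F: "finite F" "card F = n" "F \<subseteq> ?I" using infinite_arbitrarily_large[OF inf] by blast
  have "real n * R powr s \<le> (\<Sum>i\<in>F. \<bar>c i\<bar> powr s)"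
    using sum_bounded_below[of F "R powr s" "\<lambda>i. \<bar>c i\<bar> powr s"] ge F by auto
  also have "\<dots> \<le> (\<Sum>\<^sub>\<infinity>i. \<bar>c i\<bar> powr s)"
    by (rule finite_sum_le_infsum[OF sum F(1)]) auto
  finally show False using n by simp
qed

text \<open>Covers a nonpositive exponent \<open>\<alpha> - \<epsilon>\<close> in the summability hypothesis, which by itself would allow
  nonzero coefficients tending to infinity; then the terms of the series could not tend to \<open>0\<close>.\<close>

lemma (in prob_space) finite_support_of_AE_bi_sums:
  fixes \<xi> :: "int \<Rightarrow> 'a \<Rightarrow> real" and c :: "int \<Rightarrow> real" and U :: "'a \<Rightarrow> real"
  assumes indep: "indep_vars (\<lambda>_. borel) \<xi> UNIV"
    and ident: "\<And>j k. distr M borel (\<xi> j) = distr M borel (\<xi> k)"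
    and unbounded: "\<And>x. prob {\<omega>\<in>space M. \<bar>\<xi> 0 \<omega>\<bar> > x} > 0"
    and conv: "AE \<omega> in M. bi_sums (\<lambda>i. c i * \<xi> (- i) \<omega>) (U \<omega>)"
    and fin: "\<And>R. finite {i. c i \<noteq> 0 \<and> \<bar>c i\<bar> \<le> R}"
  shows "finite {i. c i \<noteq> 0}"
proof (rule ccontr)
  assume inf: "infinite {i. c i \<noteq> 0}"
  have \<xi>[measurable]: "\<xi> k \<in> borel_measurable M" for k using indep by (auto simp: indep_vars_def)
  define S where "S n \<omega> = (\<Sum>i=- int n..int n. c i * \<xi> (- i) \<omega>)" for n \<omega>
  have S[measurable]: "S n \<in> borel_measurable M" for n unfolding S_def by measurable
  have same: "prob {\<omega>\<in>space M. P (\<xi> k \<omega>)} = prob {\<omega>\<in>space M. P (\<xi> 0 \<omega>)}"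
    if [measurable]: "Measurable.pred borel P" for P k
  proof -
    have "prob {\<omega>\<in>space M. P (\<xi> k \<omega>)} = measure (distr M borel (\<xi> k)) {t. P t}"
      by (subst measure_distr) (auto intro!: arg_cong[where f=prob])
    also have "\<dots> = measure (distr M borel (\<xi> 0)) {t. P t}" by (simp only: ident[of k 0])
    also have "\<dots> = prob {\<omega>\<in>space M. P (\<xi> 0 \<omega>)}"
      by (subst measure_distr) (auto intro!: arg_cong[where f=prob])
    finally show ?thesis .
  qed
  obtain t where t: "t > 0" "prob {\<omega>\<in>space M. \<bar>\<xi> 0 \<omega>\<bar> > t} < 1 / 2"
  proof (rule tight_of_AE_convergent[of "\<lambda>_. \<xi> 0" "1 / 2"])
    fix K assume "K > 0" "\<And>n::nat. prob {\<omega>\<in>space M. \<bar>\<xi> 0 \<omega>\<bar> > K} < 1 / 2"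
    then show thesis using that by blast
  qed (auto intro: convergent_const)
  have small: "prob {\<omega>\<in>space M. \<bar>\<xi> 0 \<omega>\<bar> \<le> t} \<ge> 1 / 2"
  proof -
    have "{\<omega>\<in>space M. \<bar>\<xi> 0 \<omega>\<bar> \<le> t} = space M - {\<omega>\<in>space M. \<bar>\<xi> 0 \<omega>\<bar> > t}" by auto
    then show ?thesis using t(2) by (simp add: prob_compl)
  qed
  \<comment> \<open>The thresholds \<open>t\<close> and \<open>t + 1\<close> differ by one: if
    \<open>\<bar>c (- i)\<bar> \<le> \<bar>c i\<bar>\<close>, then with probability at least
    \<open>q / 2\<close> the sum \<open>c i * \<xi> (- i) + c (- i) * \<xi> i\<close> has modulus at
    least \<open>\<bar>c i\<bar>\<close>.\<close>
  define q where "q = prob {\<omega>\<in>space M. \<bar>\<xi> 0 \<omega>\<bar> > t + 1}"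
  have q: "q > 0" unfolding q_def by (rule unbounded)
  have cS: "AE \<omega> in M. convergent (\<lambda>n. S n \<omega>)"
    using conv unfolding bi_sums_def S_def by eventually_elim (auto intro: convergentI)
  have "q / 4 > 0" using q by simp
  then obtain K where K: "K > 0" "\<And>n. prob {\<omega>\<in>space M. \<bar>S n \<omega>\<bar> > K} < q / 4"
    by (rule tight_of_AE_convergent[OF S cS]) blast
  \<comment> \<open>Symmetric partial sums gain the terms at \<open>i\<close> and \<open>- i\<close>
    together, so the sign of \<open>i\<close> is chosen to make its coefficient the dominant one.
    Including \<open>\<bar>c 0\<bar>\<close> in \<open>R\<close> forces \<open>i \<noteq> 0\<close>;
    an increment above \<open>2 * K\<close> puts one of two successive sums above
    \<open>K\<close>.\<close>
  obtain i where i: "i \<noteq> 0" "\<bar>c i\<bar> > 2 * K" "\<bar>c (- i)\<bar> \<le> \<bar>c i\<bar>"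
  proof -
    define R where "R = max (2 * K) \<bar>c 0\<bar>"
    have "\<not> {i. c i \<noteq> 0} \<subseteq> {i. c i \<noteq> 0 \<and> \<bar>c i\<bar> \<le> R}"
      using inf fin finite_subset by blast
    then obtain i where "\<not> \<bar>c i\<bar> \<le> R" by blast
    then have i: "\<bar>c i\<bar> > 2 * K" "\<bar>c i\<bar> > \<bar>c 0\<bar>" unfolding R_def by auto
    show thesis
    proof (cases "\<bar>c (- i)\<bar> \<le> \<bar>c i\<bar>")
      case True
      then show thesis using that[of i] i by auto
    next
      case False
      then show thesis using that[of "- i"] i by auto
    qed
  qed
  define n where "n = nat \<bar>i\<bar> - 1"
  have n: "int (Suc n) = \<bar>i\<bar>" using i(1) by (auto simp: n_def)
  have D: "S (Suc n) \<omega> - S n \<omega> = c i * \<xi> (- i) \<omega> + c (- i) * \<xi> i \<omega>" for \<omega>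
  proof -
    have "{- int (Suc n)..int (Suc n)} = insert i (insert (- i) {- int n..int n})"
      using n by (auto simp: abs_if split: if_splits)
    moreover have "i \<notin> {- int n..int n}" "- i \<notin> {- int n..int n}" "i \<noteq> - i" using n i(1) by auto
    ultimately show ?thesis unfolding S_def by simp
  qed
  have "q / 2 \<le> prob {\<omega>\<in>space M. \<bar>\<xi> (- i) \<omega>\<bar> > t + 1 \<and> \<bar>\<xi> i \<omega>\<bar> \<le> t}"
  proof -
    let ?A = "\<lambda>l. if l = i then {x::real. \<bar>x\<bar> \<le> t} else {x. \<bar>x\<bar> > t + 1}"
    have "prob (\<Inter>l\<in>{i, - i}. \<xi> l -` ?A l \<inter> space M) = (\<Prod>l\<in>{i, - i}. prob (\<xi> l -` ?A l \<inter> space M))"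
      by (rule indep_varsD[OF indep]) auto
    also have "\<dots> = prob {\<omega>\<in>space M. \<bar>\<xi> i \<omega>\<bar> \<le> t} * prob {\<omega>\<in>space M. \<bar>\<xi> (- i) \<omega>\<bar> > t + 1}"
      using i(1) by (simp add: vimage_def Int_def conj_commute)
    also have "\<dots> = prob {\<omega>\<in>space M. \<bar>\<xi> 0 \<omega>\<bar> \<le> t} * q"
      unfolding q_def using same[of "\<lambda>x. \<bar>x\<bar> \<le> t" i] same[of "\<lambda>x. \<bar>x\<bar> > t + 1" "- i"] by simp
    also have "(\<Inter>l\<in>{i, - i}. \<xi> l -` ?A l \<inter> space M) = {\<omega>\<in>space M. \<bar>\<xi> (- i) \<omega>\<bar> > t + 1 \<and> \<bar>\<xi> i \<omega>\<bar> \<le> t}"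
      using i(1) by auto
    finally show ?thesis using mult_right_mono[OF small, of q] q by simp
  qed
  also have "\<dots> \<le> prob ({\<omega>\<in>space M. \<bar>S (Suc n) \<omega>\<bar> > K} \<union> {\<omega>\<in>space M. \<bar>S n \<omega>\<bar> > K})"
  proof (rule finite_measure_mono)
    show "{\<omega>\<in>space M. \<bar>\<xi> (- i) \<omega>\<bar> > t + 1 \<and> \<bar>\<xi> i \<omega>\<bar> \<le> t} \<subseteq>
      {\<omega>\<in>space M. \<bar>S (Suc n) \<omega>\<bar> > K} \<union> {\<omega>\<in>space M. \<bar>S n \<omega>\<bar> > K}"
    proof (rule subsetI, rule ccontr)
      fix \<omega> assume a: "\<omega> \<in> {\<omega>\<in>space M. \<bar>\<xi> (- i) \<omega>\<bar> > t + 1 \<and> \<bar>\<xi> i \<omega>\<bar> \<le> t}"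
        and "\<omega> \<notin> {\<omega>\<in>space M. \<bar>S (Suc n) \<omega>\<bar> > K} \<union> {\<omega>\<in>space M. \<bar>S n \<omega>\<bar> > K}"
      then have "\<bar>S (Suc n) \<omega>\<bar> \<le> K" "\<bar>S n \<omega>\<bar> \<le> K" by auto
      then have "\<bar>c i * \<xi> (- i) \<omega> + c (- i) * \<xi> i \<omega>\<bar> \<le> 2 * K" unfolding D[symmetric] by linarith
      moreover have "\<bar>c (- i) * \<xi> i \<omega>\<bar> \<le> \<bar>c i\<bar> * t"
        unfolding abs_mult using i(3) a by (intro mult_mono) auto
      moreover have "\<bar>c i\<bar> * (t + 1) \<le> \<bar>c i * \<xi> (- i) \<omega>\<bar>"
        unfolding abs_mult using a by (intro mult_left_mono) auto
      ultimately show False using i(2) by (simp add: distrib_left)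
    qed
  qed measurable
  also have "\<dots> \<le> prob {\<omega>\<in>space M. \<bar>S (Suc n) \<omega>\<bar> > K} + prob {\<omega>\<in>space M. \<bar>S n \<omega>\<bar> > K}"
    by (rule measure_Un_le) measurable
  also have "\<dots> < q / 4 + q / 4" by (intro add_strict_mono K(2))
  finally show False by simp
qed

section \<open>Union bound, scaled tails and blocks of indices\<close>

lemma (in prob_space) prob_ex_le_sum:
  assumes "finite I" "\<And>i. i \<in> I \<Longrightarrow> {\<omega>\<in>space M. P i \<omega>} \<in> events"
  shows "prob {\<omega>\<in>space M. \<exists>i\<in>I. P i \<omega>} \<le> (\<Sum>i\<in>I. prob {\<omega>\<in>space M. P i \<omega>})"
proof -
  have "{\<omega>\<in>space M. \<exists>i\<in>I. P i \<omega>} = (\<Union>i\<in>I. {\<omega>\<in>space M. P i \<omega>})" by auto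
  moreover have "prob (\<Union>i\<in>I. {\<omega>\<in>space M. P i \<omega>}) \<le> (\<Sum>i\<in>I. prob {\<omega>\<in>space M. P i \<omega>})"
    by (rule finite_measure_subadditive_finite[OF assms(1)]) (use assms(2) in auto)
  ultimately show ?thesis by simp
qed

text \<open>Substitute \<open>y / c\<close> for the threshold. For \<open>c = 0\<close> the event is
  empty once \<open>y > 0\<close>, in agreement with \<open>0 powr \<alpha> = 0\<close>.\<close>

lemma (in prob_space) scaled_upper_tail:
  fixes U :: "'a \<Rightarrow> real"
  assumes lim: "((\<lambda>x. x powr \<alpha> * prob {\<omega>\<in>space M. U \<omega> > x}) \<longlongrightarrow> \<theta>) at_top" and c: "c \<ge> 0"
  shows "((\<lambda>y. y powr \<alpha> * prob {\<omega>\<in>space M. c * U \<omega> > y}) \<longlongrightarrow> c powr \<alpha> * \<theta>) at_top"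
proof (cases "c = 0")
  case True
  have "\<forall>\<^sub>F y::real in at_top. 0 = y powr \<alpha> * prob {\<omega>\<in>space M. c * U \<omega> > y}"
    using eventually_gt_at_top[of 0] by eventually_elim (simp add: True)
  then have "((\<lambda>y. y powr \<alpha> * prob {\<omega>\<in>space M. c * U \<omega> > y}) \<longlongrightarrow> 0) at_top"
    by (rule tendsto_eventually[OF eventually_mono]) simp
  then show ?thesis using True by simp
next
  case False
  then have c: "c > 0" using c by simp
  have "LIM y at_top. (1 / c) * y :> at_top"
    by (rule filterlim_tendsto_pos_mult_at_top[OF tendsto_const _ filterlim_ident]) (use c in simp)
  from filterlim_compose[OF lim this]
  have "((\<lambda>y. c powr \<alpha> * ((1 / c * y) powr \<alpha> * prob {\<omega>\<in>space M. U \<omega> > 1 / c * y})) \<longlongrightarrow> c powr \<alpha> * \<theta>) at_top"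
    by (intro tendsto_mult tendsto_const)
  moreover have "\<forall>\<^sub>F y in at_top. c powr \<alpha> * ((1 / c * y) powr \<alpha> * prob {\<omega>\<in>space M. U \<omega> > 1 / c * y})
      = y powr \<alpha> * prob {\<omega>\<in>space M. c * U \<omega> > y}"
    using eventually_gt_at_top[of 0]
  proof eventually_elim
    case (elim y)
    have "c powr \<alpha> * (1 / c * y) powr \<alpha> = y powr \<alpha>"
      using c elim by (simp add: powr_mult[symmetric])
    moreover have "{\<omega>\<in>space M. U \<omega> > 1 / c * y} = {\<omega>\<in>space M. c * U \<omega> > y}"
      using c by (auto simp: field_simps)
    ultimately show ?case by (simp add: mult.assoc[symmetric])
  qed
  ultimately show ?thesis by (rule Lim_transform_eventually)
qed

definition block :: "nat \<Rightarrow> nat \<Rightarrow> int set" where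
  "block m k = {int m * (int k - 1) + 1..int m * int k}"

lemma finite_block[simp]: "finite (block m k)" by (simp add: block_def)

lemma card_block[simp]: "card (block m k) = m" by (simp add: block_def algebra_simps)

text \<open>Blocks begin one past a multiple of \<open>m\<close>, hence \<open>l - 1\<close>.
  Recovering \<open>k\<close> from \<open>l\<close> alone gives the disjointness of the blocks and
  lets thresholds be written as functions of \<open>l\<close>.\<close>

lemma block_index:
  assumes "l \<in> block m k" "k \<ge> 1"
  shows "nat ((l - 1) div int m) + 1 = k"
proof -
  have "(l - 1) div int m = int k - 1"
    by (rule int_div_pos_eq[of _ _ _ "l - 1 - int m * (int k - 1)"])
       (use assms in \<open>auto simp: block_def algebra_simps\<close>)
  then show ?thesis using assms(2) by simp
qed

text \<open>Only the \<open>\<bar>i\<bar>\<close> indices next to one end can leave the block under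
  a shift by \<open>i\<close>. The count does not grow with \<open>m\<close>, which makes boundary
  effects negligible.\<close>

lemma card_block_exit: "card {l\<in>block m k. l + i \<notin> block m k} \<le> nat \<bar>i\<bar>"
proof -
  define a b where "a = int m * (int k - 1) + 1" and "b = int m * int k"
  have "{l\<in>block m k. l + i \<notin> block m k} \<subseteq> (if i \<ge> 0 then {b - i + 1..b} else {a..a - i - 1})"
    unfolding block_def a_def[symmetric] b_def[symmetric] by auto
  then have "card {l\<in>block m k. l + i \<notin> block m k} \<le> card (if i \<ge> 0 then {b - i + 1..b} else {a..a - i - 1})"
    by (rule card_mono[rotated]) auto
  also have "\<dots> \<le> nat \<bar>i\<bar>" by auto
  finally show ?thesis .
qed

lemma block_max_le_iff:
  assumes "m \<ge> 1"
  shows "block_max X m k \<omega> \<le> y \<longleftrightarrow> (\<forall>j\<in>block m k. X j \<omega> \<le> y)"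
proof -
  have img: "(\<lambda>i. int m * (int k - 1) + int i) ` {1..m} = block m k"
  proof (intro set_eqI iffI)
    fix j assume "j \<in> block m k"
    then have "j = int m * (int k - 1) + int (nat (j - int m * (int k - 1)))"
      "nat (j - int m * (int k - 1)) \<in> {1..m}"
      by (auto simp: block_def algebra_simps nat_le_iff)
    then show "j \<in> (\<lambda>i. int m * (int k - 1) + int i) ` {1..m}" by blast
  qed (auto simp: block_def algebra_simps)
  have "block_max X m k \<omega> \<le> y \<longleftrightarrow> (\<forall>i\<in>{1..m}. X (int m * (int k - 1) + int i) \<omega> \<le> y)"
    unfolding block_max_def using assms by (subst Max_le_iff) auto
  also have "\<dots> \<longleftrightarrow> (\<forall>j\<in>block m k. X j \<omega> \<le> y)"
    unfolding img[symmetric] by simp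
  finally show ?thesis .
qed

subsection \<open>The one-big-jump principle for linear processes\<close>

text \<open>Collects what the upper bounds use: a power bound on the two-sided tail instead of its
  asymptotics, and one exponent \<open>r\<close> for all values of \<open>\<alpha>\<close>. Exact
  tail constants and signs enter only in the locale that extends this one.\<close>

locale heavy_tailed_linear_process = prob_space M for M :: "'a measure" +
  fixes \<xi> X :: "int \<Rightarrow> 'a \<Rightarrow> real" and c :: "int \<Rightarrow> real" and \<alpha> C r :: real
  assumes indep: "indep_vars (\<lambda>_. borel) \<xi> UNIV"
    and ident: "\<And>j k. distr M borel (\<xi> j) = distr M borel (\<xi> k)"
    and tail: "\<And>k x. x > 0 \<Longrightarrow> prob {\<omega>\<in>space M. \<bar>\<xi> k \<omega>\<bar> > x} \<le> C * x powr (- \<alpha>)"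
    and r: "0 < r" "r \<le> 2" "r < \<alpha>"
    and csum: "(\<lambda>i. \<bar>c i\<bar> powr r) summable_on UNIV"
    and X[measurable]: "\<And>k. X k \<in> borel_measurable M"
    and conv: "\<And>k. AE \<omega> in M. bi_sums (\<lambda>i. c i * \<xi> (k - i) \<omega>) (X k \<omega>)"
begin

lemma \<xi>[measurable]: "\<xi> k \<in> borel_measurable M"
  using indep by (auto simp: indep_vars_def)

lemma \<alpha>: "\<alpha> > 0" using r by linarith

lemma C: "C \<ge> 0"
  using order_trans[OF measure_nonneg tail[of 1]] by simp

definition w :: "int \<Rightarrow> int \<Rightarrow> 'a \<Rightarrow> real" where "w j i \<omega> = c i * \<xi> (j - i) \<omega>"
definition S :: "nat \<Rightarrow> int \<Rightarrow> 'a \<Rightarrow> real" where "S n j \<omega> = (\<Sum>i=- int n..int n. w j i \<omega>)"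
text \<open>Large terms are replaced by 0 rather than clipped at \<open>D\<close>, so a partial sum
  with exactly one large term is that term plus the full sum of the \<open>Y\<close>.\<close>

definition Y :: "real \<Rightarrow> int \<Rightarrow> int \<Rightarrow> 'a \<Rightarrow> real" where
  "Y D j i \<omega> = (if \<bar>w j i \<omega>\<bar> \<le> D then w j i \<omega> else 0)"

lemma w_meas[measurable]: "w j i \<in> borel_measurable M" unfolding w_def by measurable
lemma S_meas[measurable]: "S n j \<in> borel_measurable M" unfolding S_def by measurable
lemma Y_meas[measurable]: "Y D j i \<in> borel_measurable M" unfolding Y_def by measurable

lemma S_tendsto: "AE \<omega> in M. (\<lambda>n. S n j \<omega>) \<longlonglongrightarrow> X j \<omega>"
  using conv[of j] unfolding bi_sums_def S_def w_def .

lemma indep_shift: "indep_vars (\<lambda>_. borel) (\<lambda>i. \<xi> (j - i)) UNIV"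
proof -
  have "inj (\<lambda>i. j - i)" by (rule injI) simp
  then show ?thesis by (rule indep_vars_inj_reindex[OF indep])
qed

lemma indep_w: "indep_vars (\<lambda>_. borel) (w j) F"
  unfolding w_def
  by (rule indep_vars_subset[OF indep_vars_compose2[OF indep_shift] subset_UNIV]) measurable

lemma indep_Y: "indep_vars (\<lambda>_. borel) (Y D j) F"
  unfolding Y_def by (rule indep_vars_compose2[OF indep_w]) measurable

text \<open>Independence and a common marginal determine the joint law as a product measure, which
  is the same from every site.\<close>

lemma distr_shift:
  "distr M (PiM UNIV (\<lambda>_. borel)) (\<lambda>\<omega> i. \<xi> (j - i) \<omega>) = distr M (PiM UNIV (\<lambda>_. borel)) (\<lambda>\<omega> i. \<xi> (- i) \<omega>)"
proof -
  have "distr M (PiM UNIV (\<lambda>_. borel)) (\<lambda>\<omega> i. \<xi> (k - i) \<omega>) = PiM UNIV (\<lambda>_. distr M borel (\<xi> 0))" for k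
  proof -
    have "distr M (PiM UNIV (\<lambda>_. borel)) (\<lambda>\<omega>. \<lambda>i\<in>UNIV. \<xi> (k - i) \<omega>) = PiM UNIV (\<lambda>i. distr M borel (\<xi> (k - i)))"
      using indep_shift[of k] by (subst (asm) indep_vars_iff_distr_eq_PiM) auto
    also have "\<dots> = PiM UNIV (\<lambda>_. distr M borel (\<xi> 0))"
      by (rule PiM_cong) (auto intro: ident)
    finally show ?thesis by (simp add: restrict_UNIV)
  qed
  from this[of j] this[of 0] show ?thesis by simp
qed

lemma prob_S_shift: "prob {\<omega>\<in>space M. \<bar>S n j \<omega>\<bar> > K} = prob {\<omega>\<in>space M. \<bar>S n 0 \<omega>\<bar> > K}"
proof -
  let ?P = "PiM UNIV (\<lambda>_::int. borel :: real measure)"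
  let ?B = "{z\<in>space ?P. \<bar>\<Sum>i=- int n..int n. c i * z i\<bar> > K}"
  have B[measurable]: "?B \<in> sets ?P" by measurable
  have "prob {\<omega>\<in>space M. \<bar>S n k \<omega>\<bar> > K} = measure (distr M ?P (\<lambda>\<omega> i. \<xi> (k - i) \<omega>)) ?B" for k
  proof -
    have m: "(\<lambda>\<omega> i. \<xi> (k - i) \<omega>) \<in> measurable M ?P"
      by (rule measurable_PiM_single') auto
    show ?thesis
      by (subst measure_distr[OF m B]) (auto simp: S_def w_def space_PiM intro!: arg_cong[where f=prob])
  qed
  from this[of j] this[of 0] show ?thesis by (simp add: distr_shift[of j])
qed

text \<open>Almost sure convergence bounds the partial sums at site 0, and stationarity carries the
  bound to every \<open>j\<close>. It serves twice: to control the centering, and to control what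
  remains of a sum when one term is removed.\<close>

lemma tight:
  assumes "e > 0"
  obtains K where "K > 0" "\<And>n j. prob {\<omega>\<in>space M. \<bar>S n j \<omega>\<bar> > K} < e"
proof -
  have "AE \<omega> in M. convergent (\<lambda>n. S n 0 \<omega>)"
    using S_tendsto[of 0] by eventually_elim (auto intro: convergentI)
  from tight_of_AE_convergent[OF S_meas this assms] show ?thesis
    using that prob_S_shift by metis
qed

section \<open>Probabilities of large terms\<close>

lemma w_tail:
  assumes "y > 0"
  shows "prob {\<omega>\<in>space M. \<bar>w j i \<omega>\<bar> > y} \<le> C * \<bar>c i\<bar> powr \<alpha> * y powr (- \<alpha>)"
proof (cases "c i = 0")
  case False
  have "{\<omega>\<in>space M. \<bar>w j i \<omega>\<bar> > y} = {\<omega>\<in>space M. \<bar>\<xi> (j - i) \<omega>\<bar> > y / \<bar>c i\<bar>}"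
    using False by (auto simp: w_def abs_mult field_simps)
  then have "prob {\<omega>\<in>space M. \<bar>w j i \<omega>\<bar> > y} \<le> C * (y / \<bar>c i\<bar>) powr (- \<alpha>)"
    using tail[of "y / \<bar>c i\<bar>" "j - i"] False assms by simp
  also have "(y / \<bar>c i\<bar>) powr (- \<alpha>) = \<bar>c i\<bar> powr \<alpha> * y powr (- \<alpha>)"
    using assms False by (simp add: powr_divide powr_minus field_simps)
  finally show ?thesis by (simp add: mult.assoc)
qed (use assms in \<open>simp add: w_def\<close>)

lemma csum_\<alpha>: "(\<lambda>i. \<bar>c i\<bar> powr \<alpha>) summable_on UNIV"
  by (rule summable_on_abs_powr_mono[OF csum r(1) less_imp_le[OF r(3)]])

definition c\<^sub>\<alpha> :: real where "c\<^sub>\<alpha> = (\<Sum>\<^sub>\<infinity>i. \<bar>c i\<bar> powr \<alpha>)"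

lemma sum_c\<alpha>: "finite F \<Longrightarrow> (\<Sum>i\<in>F. \<bar>c i\<bar> powr \<alpha>) \<le> c\<^sub>\<alpha>"
  unfolding c\<^sub>\<alpha>_def by (rule finite_sum_le_infsum[OF csum_\<alpha>]) auto

lemma c\<alpha>_nonneg: "0 \<le> c\<^sub>\<alpha>" using sum_c\<alpha>[of "{}"] by simp

text \<open>The Cauchy criterion for unconditional sums. It is phrased for all finite sets avoiding
  a window, so that one \<open>L\<close> works in the union bounds for every partial sum.\<close>

lemma c\<alpha>_tail:
  assumes "e > 0"
  obtains L :: nat where "\<And>F. finite F \<Longrightarrow> F \<inter> {- int L..int L} = {} \<Longrightarrow> (\<Sum>i\<in>F. \<bar>c i\<bar> powr \<alpha>) < e"
proof -
  have "((\<lambda>i. \<bar>c i\<bar> powr \<alpha>) has_sum c\<^sub>\<alpha>) UNIV"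
    using csum_\<alpha> unfolding c\<^sub>\<alpha>_def by simp
  then have "(sum (\<lambda>i. \<bar>c i\<bar> powr \<alpha>) \<longlongrightarrow> c\<^sub>\<alpha>) (finite_subsets_at_top UNIV)"
    by (simp add: has_sum_def)
  then have "\<forall>\<^sub>F F in finite_subsets_at_top UNIV. (\<Sum>i\<in>F. \<bar>c i\<bar> powr \<alpha>) > c\<^sub>\<alpha> - e"
    using assms by (intro order_tendstoD) auto
  then obtain G where G: "finite G" "\<And>F. finite F \<Longrightarrow> G \<subseteq> F \<Longrightarrow> (\<Sum>i\<in>F. \<bar>c i\<bar> powr \<alpha>) > c\<^sub>\<alpha> - e"
    unfolding eventually_finite_subsets_at_top by auto
  obtain L :: nat where L: "\<And>i. i \<in> G \<Longrightarrow> \<bar>i\<bar> \<le> int L"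
  proof -
    have "\<bar>i\<bar> \<le> int (nat (\<Sum>i\<in>G. \<bar>i\<bar>))" if "i \<in> G" for i
      using member_le_sum[OF that, of abs] G(1) by simp
    then show ?thesis using that by blast
  qed
  show ?thesis
  proof (rule that)
    fix F assume F: "finite F" "F \<inter> {- int L..int L} = {}"
    have "F \<inter> G = {}" using F(2) L by fastforce
    then have "(\<Sum>i\<in>F. \<bar>c i\<bar> powr \<alpha>) + (\<Sum>i\<in>G. \<bar>c i\<bar> powr \<alpha>) = (\<Sum>i\<in>F \<union> G. \<bar>c i\<bar> powr \<alpha>)"
      using F(1) G(1) by (simp add: sum.union_disjoint)
    also have "\<dots> \<le> c\<^sub>\<alpha>" using F(1) G(1) by (intro sum_c\<alpha>) auto
    finally show "(\<Sum>i\<in>F. \<bar>c i\<bar> powr \<alpha>) < e" using G(2)[OF G(1)] by simp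
  qed
qed

lemma some_w_large:
  assumes "finite F" "y > 0"
  shows "prob {\<omega>\<in>space M. \<exists>i\<in>F. \<bar>w j i \<omega>\<bar> > y} \<le> C * (\<Sum>i\<in>F. \<bar>c i\<bar> powr \<alpha>) * y powr (- \<alpha>)"
proof -
  have "prob {\<omega>\<in>space M. \<exists>i\<in>F. \<bar>w j i \<omega>\<bar> > y} = prob (\<Union>i\<in>F. {\<omega>\<in>space M. \<bar>w j i \<omega>\<bar> > y})"
    by (rule arg_cong[where f=prob]) auto
  also have "\<dots> \<le> (\<Sum>i\<in>F. prob {\<omega>\<in>space M. \<bar>w j i \<omega>\<bar> > y})"
    by (rule finite_measure_subadditive_finite) (use assms in auto)
  also have "\<dots> \<le> (\<Sum>i\<in>F. C * \<bar>c i\<bar> powr \<alpha> * y powr (- \<alpha>))"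
    by (intro sum_mono w_tail assms)
  finally show ?thesis by (simp add: sum_distrib_left sum_distrib_right)
qed

text \<open>Union bound over off-diagonal pairs, each of which factors by independence; adding the
  diagonal back completes a square.\<close>

lemma two_w_large:
  assumes F: "finite F" and y: "y > 0"
  shows "prob {\<omega>\<in>space M. \<exists>i\<in>F. \<exists>k\<in>F. i \<noteq> k \<and> \<bar>w j i \<omega>\<bar> > y \<and> \<bar>w j k \<omega>\<bar> > y} \<le> (C * c\<^sub>\<alpha> * y powr (- \<alpha>))\<^sup>2"
proof -
  let ?A = "\<lambda>i. {\<omega>\<in>space M. \<bar>w j i \<omega>\<bar> > y}"
  let ?I = "F \<times> F - Id"
  have finI: "finite ?I" using F by simp
  have two: "prob (?A i \<inter> ?A k) = prob (?A i) * prob (?A k)" if "i \<noteq> k" for i k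
  proof -
    have "prob (\<Inter>l\<in>{i,k}. w j l -` {x. \<bar>x\<bar> > y} \<inter> space M) = (\<Prod>l\<in>{i,k}. prob (w j l -` {x. \<bar>x\<bar> > y} \<inter> space M))"
      by (rule indep_varsD[OF indep_w[of j UNIV]]) auto
    moreover have "w j l -` {x. \<bar>x\<bar> > y} \<inter> space M = ?A l" for l by auto
    ultimately show ?thesis using that by simp
  qed
  have "prob {\<omega>\<in>space M. \<exists>i\<in>F. \<exists>k\<in>F. i \<noteq> k \<and> \<bar>w j i \<omega>\<bar> > y \<and> \<bar>w j k \<omega>\<bar> > y} = prob (\<Union>(i,k)\<in>?I. ?A i \<inter> ?A k)"
    by (rule arg_cong[where f=prob]) auto
  also have "\<dots> \<le> (\<Sum>(i,k)\<in>?I. prob (?A i \<inter> ?A k))"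
    unfolding case_prod_unfold by (rule finite_measure_subadditive_finite[OF finI]) auto
  also have "\<dots> = (\<Sum>(i,k)\<in>?I. prob (?A i) * prob (?A k))"
    by (rule sum.cong) (auto intro!: two)
  also have "\<dots> \<le> (\<Sum>(i,k)\<in>F \<times> F. prob (?A i) * prob (?A k))"
    by (rule sum_mono2) (use F in auto)
  also have "\<dots> = (\<Sum>i\<in>F. prob (?A i))\<^sup>2"
    by (simp add: sum.cartesian_product[symmetric] sum_product power2_eq_square)
  also have "\<dots> \<le> (C * c\<^sub>\<alpha> * y powr (- \<alpha>))\<^sup>2"
  proof (rule power_mono)
    have "(\<Sum>i\<in>F. prob (?A i)) \<le> (\<Sum>i\<in>F. C * \<bar>c i\<bar> powr \<alpha> * y powr (- \<alpha>))"
      by (intro sum_mono w_tail y)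
    also have "\<dots> = C * (\<Sum>i\<in>F. \<bar>c i\<bar> powr \<alpha>) * y powr (- \<alpha>)"
      by (simp add: sum_distrib_left sum_distrib_right)
    also have "\<dots> \<le> C * c\<^sub>\<alpha> * y powr (- \<alpha>)"
      by (intro mult_right_mono mult_left_mono sum_c\<alpha> F C) auto
    finally show "(\<Sum>i\<in>F. prob (?A i)) \<le> C * c\<^sub>\<alpha> * y powr (- \<alpha>)" .
  qed (auto intro: sum_nonneg)
  finally show ?thesis .
qed

text \<open>For \<open>\<bar>w\<bar> \<le> D\<close> the square is at most
  \<open>\<bar>w\<bar> powr r * D powr (2 - r)\<close>, as \<open>r \<le> 2\<close>, and the
  \<open>r\<close>-th moment is finite, as \<open>r < \<alpha>\<close>. The factor
  \<open>D powr (- r)\<close> gained over \<open>D powr 2\<close> is what the Chernoff bound lives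
  on.\<close>

lemma Y_second_moments:
  obtains K where "K \<ge> 0"
    "\<And>D j F. D > 0 \<Longrightarrow> finite F \<Longrightarrow> (\<Sum>i\<in>F. expectation (\<lambda>\<omega>. (Y D j i \<omega>)\<^sup>2)) \<le> K * D powr (2 - r)"
proof -
  define m where "m = expectation (\<lambda>\<omega>. \<bar>\<xi> 0 \<omega>\<bar> powr r)"
  have m: "expectation (\<lambda>\<omega>. \<bar>\<xi> k \<omega>\<bar> powr r) = m" for k
  proof -
    have "(\<integral>x. \<bar>x\<bar> powr r \<partial>distr M borel (\<xi> k)) = (\<integral>x. \<bar>x\<bar> powr r \<partial>distr M borel (\<xi> 0))"
      by (simp only: ident[of k 0])
    then show ?thesis unfolding m_def by (simp add: integral_distr)
  qed
  have m0: "m \<ge> 0" unfolding m_def by simp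
  have int: "integrable M (\<lambda>\<omega>. \<bar>\<xi> k \<omega>\<bar> powr r)" for k
    by (rule integrable_powr_of_tail[OF \<xi> tail r(1,3)])
  define T where "T = (\<Sum>\<^sub>\<infinity>i. \<bar>c i\<bar> powr r)"
  have one: "expectation (\<lambda>\<omega>. (Y D j i \<omega>)\<^sup>2) \<le> \<bar>c i\<bar> powr r * m * D powr (2 - r)" if D: "D > 0" for D j i
  proof -
    have "expectation (\<lambda>\<omega>. (Y D j i \<omega>)\<^sup>2) \<le> expectation (\<lambda>\<omega>. \<bar>c i\<bar> powr r * \<bar>\<xi> (j - i) \<omega>\<bar> powr r * D powr (2 - r))"
    proof (rule integral_mono')
      show "integrable M (\<lambda>\<omega>. \<bar>c i\<bar> powr r * \<bar>\<xi> (j - i) \<omega>\<bar> powr r * D powr (2 - r))"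
        using int by simp
      fix \<omega>
      show "(Y D j i \<omega>)\<^sup>2 \<le> \<bar>c i\<bar> powr r * \<bar>\<xi> (j - i) \<omega>\<bar> powr r * D powr (2 - r)"
      proof (cases "w j i \<omega> \<noteq> 0 \<and> \<bar>w j i \<omega>\<bar> \<le> D")
        case True
        have "(Y D j i \<omega>)\<^sup>2 = \<bar>w j i \<omega>\<bar> powr 2"
          using True by (simp add: Y_def)
        also have "\<dots> = \<bar>w j i \<omega>\<bar> powr r * \<bar>w j i \<omega>\<bar> powr (2 - r)"
          by (simp only: powr_add[symmetric]) simp
        also have "\<dots> \<le> \<bar>w j i \<omega>\<bar> powr r * D powr (2 - r)"
          using True r by (intro mult_left_mono powr_mono2) auto
        finally show ?thesis by (simp add: w_def abs_mult powr_mult)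
      qed (auto simp: Y_def)
    qed simp
    also have "\<dots> = \<bar>c i\<bar> powr r * m * D powr (2 - r)" by (simp add: m)
    finally show ?thesis .
  qed
  show ?thesis
  proof (rule that[of "T * m"])
    have "T \<ge> 0" unfolding T_def by (rule infsum_nonneg) simp
    then show "T * m \<ge> 0" using m0 by simp
    fix D :: real and j and F :: "int set" assume D: "D > 0" and F: "finite F"
    have "(\<Sum>i\<in>F. expectation (\<lambda>\<omega>. (Y D j i \<omega>)\<^sup>2)) \<le> (\<Sum>i\<in>F. \<bar>c i\<bar> powr r * m * D powr (2 - r))"
      by (intro sum_mono one D)
    also have "\<dots> = (\<Sum>i\<in>F. \<bar>c i\<bar> powr r) * m * D powr (2 - r)" by (simp add: sum_distrib_right)
    also have "\<dots> \<le> T * m * D powr (2 - r)"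
      unfolding T_def by (intro mult_right_mono finite_sum_le_infsum[OF csum F] m0) auto
    finally show "(\<Sum>i\<in>F. expectation (\<lambda>\<omega>. (Y D j i \<omega>)\<^sup>2)) \<le> T * m * D powr (2 - r)" .
  qed
qed

text \<open>The decay beats the target \<open>y powr (- \<alpha>)\<close> by one full power, so this
  error disappears even when summed over the sites of a block. Neither constant depends on
  \<open>j\<close> or \<open>F\<close>.\<close>

lemma centered_truncated_sum:
  assumes t: "t > 0"
  obtains \<delta> y\<^sub>0 where "\<delta> > 0" "y\<^sub>0 > 0"
    "\<And>y j F. y \<ge> y\<^sub>0 \<Longrightarrow> finite F \<Longrightarrow>
       prob {\<omega>\<in>space M. \<bar>(\<Sum>i\<in>F. Y (\<delta> * y) j i \<omega>) - (\<Sum>i\<in>F. expectation (Y (\<delta> * y) j i))\<bar> > t * y}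
         \<le> 6 * y powr (- (\<alpha> + 1))"
proof -
  obtain K where K: "K \<ge> 0"
    "\<And>D j F. D > 0 \<Longrightarrow> finite F \<Longrightarrow> (\<Sum>i\<in>F. expectation (\<lambda>\<omega>. (Y D j i \<omega>)\<^sup>2)) \<le> K * D powr (2 - r)"
    using Y_second_moments by blast
  \<comment> \<open>The Chernoff exponent \<open>\<kappa> * ln y / y\<close> makes the main factor \<open>y powr - (\<alpha> + 1)\<close>, and \<open>\<delta>\<close> is so small
    that the second-order factor \<open>exp (2 * h * \<delta> * y) = y powr (r / 2)\<close> does not outweigh \<open>y powr - r\<close>.\<close>
  define \<kappa> where "\<kappa> = (\<alpha> + 1) / t"
  define \<delta> where "\<delta> = r / (4 * \<kappa>)"
  have \<kappa>: "\<kappa> > 0" "\<kappa> * t = \<alpha> + 1" and \<delta>: "\<delta> > 0" "2 * \<kappa> * \<delta> = r / 2"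
  proof -
    show k: "\<kappa> > 0" "\<kappa> * t = \<alpha> + 1" using t \<alpha> by (auto simp: \<kappa>_def)
    show "\<delta> > 0" "2 * \<kappa> * \<delta> = r / 2" using k(1) r by (auto simp: \<delta>_def)
  qed
  \<comment> \<open>Collects the constants of the second-order term of the Chernoff exponent; the
    powers \<open>-2\<close>, \<open>r / 2\<close> and \<open>2 - r\<close> of \<open>y\<close> add
    up to \<open>- (r / 2)\<close>.\<close>
  define q where "q = \<kappa>\<^sup>2 * K * \<delta> powr (2 - r)"
  have "((\<lambda>y. q * (ln y)\<^sup>2 * y powr (- (r / 2))) \<longlongrightarrow> 0) at_top"
    using r(1) by real_asymp
  then have "\<forall>\<^sub>F y in at_top. q * (ln y)\<^sup>2 * y powr (- (r / 2)) < 1"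
    by (rule order_tendstoD) simp
  then obtain y1 where y1: "\<And>y. y \<ge> y1 \<Longrightarrow> q * (ln y)\<^sup>2 * y powr (- (r / 2)) < 1"
    unfolding eventually_at_top_linorder by auto
  show ?thesis
  proof (rule that[of \<delta> "max y1 1"])
    fix y j and F :: "int set" assume y: "max y1 1 \<le> y" and F: "finite F"
    define h where "h = \<kappa> * ln y / y"
    have y0: "y \<ge> 1" using y by simp
    have h: "h \<ge> 0" unfolding h_def using y0 \<kappa> by simp
    have D: "\<delta> * y > 0" using \<delta> y0 by simp
    have "prob {\<omega>\<in>space M. \<bar>(\<Sum>i\<in>F. Y (\<delta> * y) j i \<omega>) - (\<Sum>i\<in>F. expectation (Y (\<delta> * y) j i))\<bar> > t * y}
      \<le> 2 * exp (- h * (t * y) + h\<^sup>2 * exp (2 * h * (\<delta> * y)) * (K * (\<delta> * y) powr (2 - r)))"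
      by (rule chernoff_centered_sum_abs[OF F indep_Y _ K(2)[OF D F] h]) (use D in \<open>auto simp: Y_def\<close>)
    also have "h\<^sup>2 * exp (2 * h * (\<delta> * y)) * (K * (\<delta> * y) powr (2 - r)) = q * (ln y)\<^sup>2 * y powr (- (r / 2))"
    proof -
      have "2 * h * (\<delta> * y) = (2 * \<kappa> * \<delta>) * ln y" using y0 by (simp add: h_def)
      then have 1: "exp (2 * h * (\<delta> * y)) = y powr (r / 2)"
        using y0 \<delta>(2) by (simp add: powr_def)
      have 2: "h\<^sup>2 = \<kappa>\<^sup>2 * (ln y)\<^sup>2 * y powr (- 2)"
        using y0 by (simp add: h_def power_mult_distrib power_divide powr_minus_divide)
      have 3: "(\<delta> * y) powr (2 - r) = \<delta> powr (2 - r) * y powr (2 - r)"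
        using y0 \<delta> by (simp add: powr_mult)
      have 4: "y powr (- 2) * (y powr (r / 2) * y powr (2 - r)) = y powr (- (r / 2))"
        by (simp only: powr_add[symmetric]) simp
      show ?thesis unfolding 1 2 3 4[symmetric] q_def by (simp add: mult_ac)
    qed
    also have "- h * (t * y) = - (\<alpha> + 1) * ln y"
    proof -
      have "- h * (t * y) = - (\<kappa> * t) * ln y" using y0 by (simp add: h_def)
      then show ?thesis by (simp only: \<kappa>(2))
    qed
    \<comment> \<open>For \<open>y \<ge> y1\<close> the second-order term is below 1 and costs a
      factor \<open>exp 1\<close>; the constant 6 comes from \<open>exp 1 \<le> 3\<close>.\<close>
    also have "2 * exp (- (\<alpha> + 1) * ln y + q * (ln y)\<^sup>2 * y powr (- (r / 2))) \<le> 2 * exp (- (\<alpha> + 1) * ln y + 1)"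
      using y1[of y] y by simp
    also have "\<dots> = 2 * exp 1 * y powr (- (\<alpha> + 1))"
      using y0 by (simp add: powr_def exp_add)
    also have "\<dots> \<le> 6 * y powr (- (\<alpha> + 1))"
      by (rule mult_right_mono) (use exp_le in auto)
    finally show "prob {\<omega>\<in>space M. \<bar>(\<Sum>i\<in>F. Y (\<delta> * y) j i \<omega>) - (\<Sum>i\<in>F. expectation (Y (\<delta> * y) j i))\<bar> > t * y}
         \<le> 6 * y powr (- (\<alpha> + 1))" .
  qed (use \<delta> in auto)
qed

text \<open>The centering \<open>b\<close> is deterministic, so a single sample point suffices to
  bound it. Three exceptional events of probability below \<open>1 / 3\<close> each cannot cover the
  space: the partial sum is large, some term is truncated, the truncated sum is far from
  \<open>b\<close>.\<close>

lemma truncated_sum: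
  assumes t: "t > 0"
  obtains \<delta> y\<^sub>0 where "\<delta> > 0" "y\<^sub>0 > 0"
    "\<And>y j n. y \<ge> y\<^sub>0 \<Longrightarrow>
       prob {\<omega>\<in>space M. \<bar>\<Sum>i=- int n..int n. Y (\<delta> * y) j i \<omega>\<bar> > t * y} \<le> 6 * y powr (- (\<alpha> + 1))"
proof -
  obtain \<delta> y1 where \<delta>: "\<delta> > 0" "y1 > 0"
    "\<And>y j F. y \<ge> y1 \<Longrightarrow> finite F \<Longrightarrow>
       prob {\<omega>\<in>space M. \<bar>(\<Sum>i\<in>F. Y (\<delta> * y) j i \<omega>) - (\<Sum>i\<in>F. expectation (Y (\<delta> * y) j i))\<bar> > (t / 4) * y}
         \<le> 6 * y powr (- (\<alpha> + 1))"
    using centered_truncated_sum[of "t / 4"] t by auto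
  obtain K where K: "K > 0" "\<And>n j. prob {\<omega>\<in>space M. \<bar>S n j \<omega>\<bar> > K} < 1 / 3"
    using tight[of "1 / 3"] by auto
  have "((\<lambda>y. 6 * y powr (- (\<alpha> + 1))) \<longlongrightarrow> 0) at_top" using \<alpha> by real_asymp
  then have ev1: "\<forall>\<^sub>F y in at_top. 6 * y powr (- (\<alpha> + 1)) < 1 / 3" by (rule order_tendstoD) simp
  have "((\<lambda>y. C * c\<^sub>\<alpha> * (\<delta> * y) powr (- \<alpha>)) \<longlongrightarrow> 0) at_top" using \<alpha> \<delta>(1) by (intro scaled_powr_neg_tendsto_0) auto
  then have ev2: "\<forall>\<^sub>F y in at_top. C * c\<^sub>\<alpha> * (\<delta> * y) powr (- \<alpha>) < 1 / 3" by (rule order_tendstoD) simp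
  obtain y2 where y2: "\<And>y. y \<ge> y2 \<Longrightarrow> 6 * y powr (- (\<alpha> + 1)) < 1 / 3 \<and> C * c\<^sub>\<alpha> * (\<delta> * y) powr (- \<alpha>) < 1 / 3"
    using eventually_conj[OF ev1 ev2] unfolding eventually_at_top_linorder by auto
  show ?thesis
  proof (rule that[of \<delta> "max (max y1 y2) (4 * K / t)"])
    fix y j n assume y: "max (max y1 y2) (4 * K / t) \<le> y"
    let ?F = "{- int n..int n}"
    define b where "b = (\<Sum>i\<in>?F. expectation (Y (\<delta> * y) j i))"
    have y0: "y > 0" "\<delta> * y > 0" using y \<delta> by auto
    have yK: "K \<le> t / 4 * y" using y t by (simp add: divide_le_eq mult.commute)
    let ?A1 = "{\<omega>\<in>space M. \<bar>S n j \<omega>\<bar> > K}"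
    let ?A2 = "{\<omega>\<in>space M. \<exists>i\<in>?F. \<bar>w j i \<omega>\<bar> > \<delta> * y}"
    let ?A3 = "{\<omega>\<in>space M. \<bar>(\<Sum>i\<in>?F. Y (\<delta> * y) j i \<omega>) - b\<bar> > (t / 4) * y}"
    have [measurable]: "?A1 \<in> events" "?A2 \<in> events" "?A3 \<in> events" by measurable
    have A3: "prob ?A3 \<le> 6 * y powr (- (\<alpha> + 1))"
      unfolding b_def by (rule \<delta>(3)) (use y in auto)
    have "prob ?A2 \<le> C * (\<Sum>i\<in>?F. \<bar>c i\<bar> powr \<alpha>) * (\<delta> * y) powr (- \<alpha>)"
      by (rule some_w_large) (use y0 in auto)
    also have "\<dots> \<le> C * c\<^sub>\<alpha> * (\<delta> * y) powr (- \<alpha>)"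
      by (intro mult_right_mono mult_left_mono sum_c\<alpha> C) auto
    finally have A2: "prob ?A2 < 1 / 3" using y2[of y] y by auto
    have "prob (?A1 \<union> (?A2 \<union> ?A3)) \<le> prob ?A1 + prob (?A2 \<union> ?A3)"
      by (rule measure_Un_le) auto
    also have "\<dots> \<le> prob ?A1 + (prob ?A2 + prob ?A3)"
      by (intro add_left_mono measure_Un_le) auto
    also have "\<dots> < 1"
      using K(2)[of n j] A2 A3 y2[of y] y by auto
    finally have "?A1 \<union> (?A2 \<union> ?A3) \<noteq> space M" using prob_space by auto
    then obtain \<omega> where \<omega>: "\<omega> \<in> space M" "\<omega> \<notin> ?A1" "\<omega> \<notin> ?A2" "\<omega> \<notin> ?A3" by auto
    \<comment> \<open>At this point nothing is truncated, so the same number lies within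
      \<open>t / 4 * y\<close> of 0 and of \<open>b\<close>. The resulting
      \<open>\<bar>b\<bar> \<le> t / 2 * y\<close> holds outright, and a truncated sum beyond
      \<open>t * y\<close> is then farther than \<open>t / 4 * y\<close> from
      \<open>b\<close>.\<close>
    have "S n j \<omega> = (\<Sum>i\<in>?F. Y (\<delta> * y) j i \<omega>)"
      unfolding S_def by (rule sum.cong) (use \<omega> in \<open>auto simp: Y_def not_less\<close>)
    then have "\<bar>S n j \<omega> - b\<bar> \<le> t / 4 * y" "\<bar>S n j \<omega>\<bar> \<le> t / 4 * y" using \<omega> yK by auto
    then have b: "\<bar>b\<bar> \<le> t / 2 * y" by linarith
    have "prob {\<omega>\<in>space M. \<bar>\<Sum>i\<in>?F. Y (\<delta> * y) j i \<omega>\<bar> > t * y} \<le> prob ?A3"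
    proof (rule finite_measure_mono)
      have "\<bar>s - b\<bar> > (t / 4) * y" if "\<bar>s\<bar> > t * y" for s
        using that b mult_pos_pos[OF t y0(1)] by linarith
      then show "{\<omega>\<in>space M. \<bar>\<Sum>i\<in>?F. Y (\<delta> * y) j i \<omega>\<bar> > t * y} \<subseteq> ?A3" by blast
    qed simp
    with A3 show "prob {\<omega>\<in>space M. \<bar>\<Sum>i\<in>?F. Y (\<delta> * y) j i \<omega>\<bar> > t * y} \<le> 6 * y powr (- (\<alpha> + 1))"
      by linarith
  qed (use \<delta> in auto)
qed

text \<open>The level \<open>\<delta>\<close> is set by \<open>\<epsilon>\<close>, the window
  \<open>L\<close> then by \<open>\<eta>\<close> and \<open>\<delta>\<close>. Three failures get
  \<open>\<eta> / 3\<close> each: two terms above \<open>\<delta> * y\<close>, such a term outside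
  the window, a truncated sum above \<open>\<epsilon> * y\<close>. Otherwise the sum is at most
  \<open>(1 - \<epsilon>) * y + \<epsilon> * y\<close>.\<close>

lemma one_big_jump:
  assumes \<epsilon>: "0 < \<epsilon>" "\<epsilon> < 1" and \<eta>: "\<eta> > 0"
  obtains L :: nat and y\<^sub>0 where "y\<^sub>0 > 0"
    "\<And>y j. y \<ge> y\<^sub>0 \<Longrightarrow>
       prob {\<omega>\<in>space M. X j \<omega> > y \<and> (\<forall>i\<in>{- int L..int L}. w j i \<omega> \<le> (1 - \<epsilon>) * y)} \<le> \<eta> * y powr (- \<alpha>)"
proof -
  obtain \<delta> y1 where \<delta>: "\<delta> > 0" "y1 > 0"
    "\<And>y j n. y \<ge> y1 \<Longrightarrow>
       prob {\<omega>\<in>space M. \<bar>\<Sum>i=- int n..int n. Y (\<delta> * y) j i \<omega>\<bar> > \<epsilon> * y} \<le> 6 * y powr (- (\<alpha> + 1))"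
    using truncated_sum[OF \<epsilon>(1)] by blast
  \<comment> \<open>Budget for the coefficients outside the window: a term there exceeds
    \<open>\<delta> * y\<close> with probability at most
    \<open>C * e * (\<delta> * y) powr (- \<alpha>)\<close>. Writing \<open>C + 1\<close> guards
    against \<open>C = 0\<close>.\<close>
  define e where "e = \<eta> * \<delta> powr \<alpha> / (3 * (C + 1))"
  have e: "e > 0" "C * e * \<delta> powr (- \<alpha>) \<le> \<eta> / 3"
  proof -
    show "e > 0" using \<eta> \<delta> C by (simp add: e_def)
    have "C * e * \<delta> powr (- \<alpha>) = (C / (C + 1)) * (\<eta> / 3)"
      using \<delta>(1) C unfolding e_def powr_minus by (simp add: field_simps)
    also have "\<dots> \<le> 1 * (\<eta> / 3)"
      by (rule mult_right_mono) (use \<eta> C in \<open>auto simp: divide_le_eq\<close>)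
    finally show "C * e * \<delta> powr (- \<alpha>) \<le> \<eta> / 3" by simp
  qed
  obtain L where L: "\<And>F. finite F \<Longrightarrow> F \<inter> {- int L..int L} = {} \<Longrightarrow> (\<Sum>i\<in>F. \<bar>c i\<bar> powr \<alpha>) < e"
    using c\<alpha>_tail[OF e(1)] by blast
  have "((\<lambda>y. (C * c\<^sub>\<alpha> * \<delta> powr (- \<alpha>))\<^sup>2 * y powr (- \<alpha>)) \<longlongrightarrow> 0) at_top"
    using scaled_powr_neg_tendsto_0[of 1 \<alpha>] \<alpha> by simp
  then have ev1: "\<forall>\<^sub>F y in at_top. (C * c\<^sub>\<alpha> * \<delta> powr (- \<alpha>))\<^sup>2 * y powr (- \<alpha>) < \<eta> / 3"
    by (rule order_tendstoD) (use \<eta> in simp)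
  have "((\<lambda>y::real. 6 * y powr (- 1)) \<longlongrightarrow> 0) at_top" by real_asymp
  then have ev2: "\<forall>\<^sub>F y::real in at_top. 6 * y powr (- 1) < \<eta> / 3"
    by (rule order_tendstoD) (use \<eta> in simp)
  obtain y2 where y2: "\<And>y. y \<ge> y2 \<Longrightarrow> (C * c\<^sub>\<alpha> * \<delta> powr (- \<alpha>))\<^sup>2 * y powr (- \<alpha>) < \<eta> / 3 \<and> 6 * y powr (- 1) < \<eta> / 3"
    using eventually_conj[OF ev1 ev2] unfolding eventually_at_top_linorder by auto
  show ?thesis
  proof (rule that[of "max y1 y2" L])
    fix y j assume y: "max y1 y2 \<le> y"
    have y0: "y > 0" "\<delta> * y > 0" using y \<delta> by auto
    let ?G = "{\<omega>\<in>space M. \<forall>i\<in>{- int L..int L}. w j i \<omega> \<le> (1 - \<epsilon>) * y}"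
    have "prob {\<omega>\<in>space M. S n j \<omega> > y \<and> \<omega> \<in> ?G} \<le> \<eta> * y powr (- \<alpha>)" if n: "n \<ge> L" for n
    proof -
      let ?F = "{- int n..int n}"
      let ?B = "?F - {- int L..int L}"
      let ?A1 = "{\<omega>\<in>space M. \<exists>i\<in>?F. \<exists>k\<in>?F. i \<noteq> k \<and> \<bar>w j i \<omega>\<bar> > \<delta> * y \<and> \<bar>w j k \<omega>\<bar> > \<delta> * y}"
      let ?A2 = "{\<omega>\<in>space M. \<exists>i\<in>?B. \<bar>w j i \<omega>\<bar> > \<delta> * y}"
      let ?A3 = "{\<omega>\<in>space M. \<bar>\<Sum>i\<in>?F. Y (\<delta> * y) j i \<omega>\<bar> > \<epsilon> * y}"
      have [measurable]: "?A1 \<in> events" "?A2 \<in> events" "?A3 \<in> events" by measurable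
      have "{\<omega>\<in>space M. S n j \<omega> > y \<and> \<omega> \<in> ?G} \<subseteq> ?A1 \<union> (?A2 \<union> ?A3)"
      proof (rule subsetI, rule ccontr)
        fix \<omega> assume in1: "\<omega> \<in> {\<omega>\<in>space M. S n j \<omega> > y \<and> \<omega> \<in> ?G}" and "\<omega> \<notin> ?A1 \<union> (?A2 \<union> ?A3)"
        then have no: "\<omega> \<notin> ?A1" "\<omega> \<notin> ?A2" "\<omega> \<notin> ?A3" and \<omega>: "\<omega> \<in> space M" by auto
        have Yle: "(\<Sum>i\<in>?F. Y (\<delta> * y) j i \<omega>) \<le> \<epsilon> * y" using no(3) \<omega> by auto
        show False
        proof (cases "\<exists>i\<in>?F. \<bar>w j i \<omega>\<bar> > \<delta> * y")
          case True
          then obtain i where i: "i \<in> ?F" "\<bar>w j i \<omega>\<bar> > \<delta> * y" by blast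
          have iL: "i \<in> {- int L..int L}" using no(2) \<omega> i by blast
          have other: "\<bar>w j k \<omega>\<bar> \<le> \<delta> * y" if "k \<in> ?F - {i}" for k
          proof (rule ccontr)
            assume "\<not> \<bar>w j k \<omega>\<bar> \<le> \<delta> * y"
            then have "\<delta> * y < \<bar>w j k \<omega>\<bar>" by simp
            then have "\<omega> \<in> ?A1" using i that \<omega> by blast
            then show False using no(1) by simp
          qed
          have "S n j \<omega> = w j i \<omega> + (\<Sum>k\<in>?F - {i}. w j k \<omega>)"
            unfolding S_def using i(1) by (intro sum.remove) auto
          also have "(\<Sum>k\<in>?F - {i}. w j k \<omega>) = (\<Sum>k\<in>?F - {i}. Y (\<delta> * y) j k \<omega>)"
            by (rule sum.cong) (use other in \<open>auto simp: Y_def\<close>)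
          \<comment> \<open>The large term has \<open>Y = 0\<close>, so it can be put back and the
            bound on the full truncated sum applies.\<close>
          also have "\<dots> = (\<Sum>k\<in>?F. Y (\<delta> * y) j k \<omega>)"
            using i by (subst sum.remove[of ?F i]) (auto simp: Y_def)
          also have "w j i \<omega> + \<dots> \<le> (1 - \<epsilon>) * y + \<epsilon> * y"
            using in1 iL Yle by (intro add_mono) auto
          finally show False using in1 by (simp add: algebra_simps)
        next
          case False
          have "S n j \<omega> = (\<Sum>i\<in>?F. Y (\<delta> * y) j i \<omega>)"
            unfolding S_def by (rule sum.cong) (use False in \<open>auto simp: Y_def not_less\<close>)
          then have "y < \<epsilon> * y" using in1 Yle by auto
          then show False using \<epsilon>(2) y0 by simp
        qed
      qed
      then have "prob {\<omega>\<in>space M. S n j \<omega> > y \<and> \<omega> \<in> ?G} \<le> prob (?A1 \<union> (?A2 \<union> ?A3))"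
        by (rule finite_measure_mono) auto
      also have "\<dots> \<le> prob ?A1 + prob (?A2 \<union> ?A3)"
        by (rule measure_Un_le) auto
      also have "\<dots> \<le> prob ?A1 + (prob ?A2 + prob ?A3)"
        by (intro add_left_mono measure_Un_le) auto
      also have "\<dots> \<le> \<eta> / 3 * y powr (- \<alpha>) + (\<eta> / 3 * y powr (- \<alpha>) + \<eta> / 3 * y powr (- \<alpha>))"
      proof (intro add_mono)
        have pm: "(\<delta> * y) powr (- \<alpha>) = \<delta> powr (- \<alpha>) * y powr (- \<alpha>)"
          using \<delta> y0 by (simp add: powr_mult)
        have "prob ?A1 \<le> (C * c\<^sub>\<alpha> * (\<delta> * y) powr (- \<alpha>))\<^sup>2"
          by (rule two_w_large) (use y0 in auto)
        also have "\<dots> = (C * c\<^sub>\<alpha> * \<delta> powr (- \<alpha>))\<^sup>2 * y powr (- \<alpha>) * y powr (- \<alpha>)"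
          unfolding pm by (simp add: power2_eq_square)
        also have "\<dots> \<le> \<eta> / 3 * y powr (- \<alpha>)"
          using y2[of y] y by (intro mult_right_mono) auto
        finally show "prob ?A1 \<le> \<eta> / 3 * y powr (- \<alpha>)" .
        have "prob ?A2 \<le> C * (\<Sum>i\<in>?B. \<bar>c i\<bar> powr \<alpha>) * (\<delta> * y) powr (- \<alpha>)"
          by (rule some_w_large) (use y0 in auto)
        also have "\<dots> \<le> C * e * (\<delta> * y) powr (- \<alpha>)"
          by (intro mult_right_mono mult_left_mono C less_imp_le[OF L]) auto
        also have "\<dots> = C * e * \<delta> powr (- \<alpha>) * y powr (- \<alpha>)" unfolding pm by simp
        also have "\<dots> \<le> \<eta> / 3 * y powr (- \<alpha>)"
          by (intro mult_right_mono e(2)) simp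
        finally show "prob ?A2 \<le> \<eta> / 3 * y powr (- \<alpha>)" .
        have "prob ?A3 \<le> 6 * y powr (- (\<alpha> + 1))" by (rule \<delta>(3)) (use y in auto)
        also have "y powr (- (\<alpha> + 1)) = y powr (- 1) * y powr (- \<alpha>)"
          by (simp only: powr_add[symmetric]) (simp add: algebra_simps)
        also have "6 * (y powr (- 1) * y powr (- \<alpha>)) \<le> \<eta> / 3 * y powr (- \<alpha>)"
          unfolding mult.assoc[symmetric] using y2[of y] y by (intro mult_right_mono) auto
        finally show "prob ?A3 \<le> \<eta> / 3 * y powr (- \<alpha>)" .
      qed
      also have "\<dots> = \<eta> * y powr (- \<alpha>)" by simp
      finally show ?thesis .
    qed
    then have "prob {\<omega>\<in>space M. X j \<omega> > y \<and> \<omega> \<in> ?G} \<le> \<eta> * y powr (- \<alpha>)"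
      by (intro prob_greater_le_of_AE_tendsto[OF S_meas X _ S_tendsto]) auto
    moreover have "{\<omega>\<in>space M. X j \<omega> > y \<and> \<omega> \<in> ?G} =
      {\<omega>\<in>space M. X j \<omega> > y \<and> (\<forall>i\<in>{- int L..int L}. w j i \<omega> \<le> (1 - \<epsilon>) * y)}" by auto
    ultimately show "prob {\<omega>\<in>space M. X j \<omega> > y \<and> (\<forall>i\<in>{- int L..int L}. w j i \<omega> \<le> (1 - \<epsilon>) * y)} \<le> \<eta> * y powr (- \<alpha>)"
      by simp
  qed (use \<delta> in auto)
qed

text \<open>The rest of the sum is independent of the jump and tight, being a tight partial sum
  minus one term, so cancellation multiplies the jump probability by a small factor. The estimate is
  uniform in \<open>i\<close>.\<close>

lemma big_jump_not_cancelled: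
  assumes \<epsilon>: "0 < \<epsilon>" and \<eta>: "\<eta> > 0"
  obtains y\<^sub>0 where "y\<^sub>0 > 0"
    "\<And>y j i. y \<ge> y\<^sub>0 \<Longrightarrow>
       prob {\<omega>\<in>space M. X j \<omega> \<le> y \<and> w j i \<omega> > (1 + \<epsilon>) * y} \<le> \<eta> * y powr (- \<alpha>)"
proof -
  define \<eta>' where "\<eta>' = \<eta> / (C * c\<^sub>\<alpha> + 1)"
  have Cc: "C * c\<^sub>\<alpha> \<ge> 0" using C c\<alpha>_nonneg by simp
  have \<eta>': "\<eta>' > 0" using \<eta> Cc by (simp add: \<eta>'_def add_nonneg_pos)
  have "\<eta>' * (C * c\<^sub>\<alpha> + 1) = \<eta>" using Cc by (simp add: \<eta>'_def)
  then have \<eta>'C: "\<eta>' * (C * c\<^sub>\<alpha>) \<le> \<eta>" using \<eta>' by (simp add: distrib_left)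
  obtain K where K: "K > 0" "\<And>n j. prob {\<omega>\<in>space M. \<bar>S n j \<omega>\<bar> > K} < \<eta>' / 2"
    using tight[of "\<eta>' / 2"] \<eta>' by auto
  have wle: "prob {\<omega>\<in>space M. \<bar>w j i \<omega>\<bar> > y} \<le> C * c\<^sub>\<alpha> * y powr (- \<alpha>)" if "y > 0" for y j i
  proof -
    have "prob {\<omega>\<in>space M. \<bar>w j i \<omega>\<bar> > y} \<le> C * \<bar>c i\<bar> powr \<alpha> * y powr (- \<alpha>)"
      by (rule w_tail[OF that])
    also have "\<dots> \<le> C * c\<^sub>\<alpha> * y powr (- \<alpha>)"
      using sum_c\<alpha>[of "{i}"] by (intro mult_right_mono mult_left_mono C) auto
    finally show ?thesis .
  qed
  have "((\<lambda>y. C * c\<^sub>\<alpha> * (\<epsilon> / 4 * y) powr (- \<alpha>)) \<longlongrightarrow> 0) at_top" using \<alpha> \<epsilon> by (intro scaled_powr_neg_tendsto_0) auto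
  then have "\<forall>\<^sub>F y in at_top. C * c\<^sub>\<alpha> * (\<epsilon> / 4 * y) powr (- \<alpha>) < \<eta>' / 2"
    by (rule order_tendstoD) (use \<eta>' in simp)
  then obtain y2 where y2: "\<And>y. y \<ge> y2 \<Longrightarrow> C * c\<^sub>\<alpha> * (\<epsilon> / 4 * y) powr (- \<alpha>) < \<eta>' / 2"
    unfolding eventually_at_top_linorder by auto
  show ?thesis
  proof (rule that[of "max y2 (4 * K / \<epsilon>)"])
    show "0 < max y2 (4 * K / \<epsilon>)" using K \<epsilon> by (simp add: less_max_iff_disj)
    fix y j i assume y: "max y2 (4 * K / \<epsilon>) \<le> y"
    have "4 * K / \<epsilon> > 0" using K \<epsilon> by simp
    then have y0: "y > 0" using y by linarith
    have yK: "K \<le> \<epsilon> / 4 * y" using y \<epsilon> by (simp add: divide_le_eq mult.commute)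
    let ?G = "{\<omega>\<in>space M. w j i \<omega> > (1 + \<epsilon>) * y}"
    \<comment> \<open>The passage to the limit works for strict inequalities, so
      \<open>X j \<le> y\<close> is relaxed to \<open>X j < (1 + \<epsilon> / 2) * y\<close>. The
      other half of the margin forces the rest of the sum below
      \<open>- (\<epsilon> / 2) * y\<close>.\<close>
    have fin: "prob {\<omega>\<in>space M. - S n j \<omega> > - (1 + \<epsilon> / 2) * y \<and> \<omega> \<in> ?G} \<le> \<eta> * y powr (- \<alpha>)"
      if n: "n \<ge> nat \<bar>i\<bar>" for n
    proof -
      let ?F = "{- int n..int n} - {i}"
      let ?R = "\<lambda>\<omega>. \<Sum>k\<in>?F. w j k \<omega>"
      have iF: "insert i ?F = {- int n..int n}" using n by auto
      have S: "S n j \<omega> = w j i \<omega> + ?R \<omega>" for \<omega>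
        unfolding S_def using n by (intro sum.remove) auto
      have "indep_var borel (w j i) borel ?R"
        by (rule indep_vars_sum[OF _ _ indep_w]) auto
      from indep_varD[OF this, of "{x. x > (1 + \<epsilon>) * y}" "{x. x < - (\<epsilon> / 2 * y)}"]
      have ind: "prob {\<omega>\<in>space M. w j i \<omega> > (1 + \<epsilon>) * y \<and> ?R \<omega> < - (\<epsilon> / 2 * y)} =
        prob {\<omega>\<in>space M. w j i \<omega> > (1 + \<epsilon>) * y} * prob {\<omega>\<in>space M. ?R \<omega> < - (\<epsilon> / 2 * y)}"
        by (simp add: vimage_def Int_def conj_commute)
      have "prob {\<omega>\<in>space M. - S n j \<omega> > - (1 + \<epsilon> / 2) * y \<and> \<omega> \<in> ?G}
        \<le> prob {\<omega>\<in>space M. w j i \<omega> > (1 + \<epsilon>) * y \<and> ?R \<omega> < - (\<epsilon> / 2 * y)}"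
        by (rule finite_measure_mono) (auto simp: S algebra_simps)
      also have "\<dots> \<le> (C * c\<^sub>\<alpha> * y powr (- \<alpha>)) * \<eta>'"
        unfolding ind
      proof (rule mult_mono)
        have "y < (1 + \<epsilon>) * y" using \<epsilon> y0 by simp
        then have "prob {\<omega>\<in>space M. w j i \<omega> > (1 + \<epsilon>) * y} \<le> prob {\<omega>\<in>space M. \<bar>w j i \<omega>\<bar> > y}"
          by (intro finite_measure_mono) auto
        also have "\<dots> \<le> C * c\<^sub>\<alpha> * y powr (- \<alpha>)" by (rule wle[OF y0])
        finally show "prob {\<omega>\<in>space M. w j i \<omega> > (1 + \<epsilon>) * y} \<le> C * c\<^sub>\<alpha> * y powr (- \<alpha>)" .
        let ?A1 = "{\<omega>\<in>space M. \<bar>S n j \<omega>\<bar> > K}"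
        let ?A2 = "{\<omega>\<in>space M. \<bar>w j i \<omega>\<bar> > \<epsilon> / 4 * y}"
        have "prob {\<omega>\<in>space M. ?R \<omega> < - (\<epsilon> / 2 * y)} \<le> prob (?A1 \<union> ?A2)"
        proof (rule finite_measure_mono)
          show "{\<omega>\<in>space M. ?R \<omega> < - (\<epsilon> / 2 * y)} \<subseteq> ?A1 \<union> ?A2"
          proof (rule subsetI, rule ccontr)
            fix \<omega> assume a: "\<omega> \<in> {\<omega>\<in>space M. ?R \<omega> < - (\<epsilon> / 2 * y)}" "\<omega> \<notin> ?A1 \<union> ?A2"
            then have "\<bar>S n j \<omega>\<bar> \<le> \<epsilon> / 4 * y" "\<bar>w j i \<omega>\<bar> \<le> \<epsilon> / 4 * y" using yK by auto
            moreover have "?R \<omega> = S n j \<omega> - w j i \<omega>" using S by simp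
            moreover have "?R \<omega> < - (\<epsilon> / 2 * y)" using a(1) by simp
            moreover have "\<epsilon> / 2 * y = \<epsilon> / 4 * y + \<epsilon> / 4 * y" by simp
            ultimately show False by linarith
          qed
        qed auto
        also have "\<dots> \<le> prob ?A1 + prob ?A2" by (rule measure_Un_le) auto
        also have "\<dots> \<le> \<eta>' / 2 + \<eta>' / 2"
        proof (rule add_mono)
          show "prob ?A1 \<le> \<eta>' / 2" using K(2) by (rule less_imp_le)
          have "prob ?A2 \<le> C * c\<^sub>\<alpha> * (\<epsilon> / 4 * y) powr (- \<alpha>)" by (rule wle) (use \<epsilon> y0 in simp)
          then show "prob ?A2 \<le> \<eta>' / 2" using y2[of y] y by auto
        qed
        finally show "prob {\<omega>\<in>space M. ?R \<omega> < - (\<epsilon> / 2 * y)} \<le> \<eta>'" by simp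
        show "0 \<le> C * c\<^sub>\<alpha> * y powr (- \<alpha>)" using Cc by simp
      qed simp
      also have "\<dots> = (\<eta>' * (C * c\<^sub>\<alpha>)) * y powr (- \<alpha>)" by simp
      also have "\<dots> \<le> \<eta> * y powr (- \<alpha>)" by (rule mult_right_mono[OF \<eta>'C]) simp
      finally show ?thesis .
    qed
    have lim: "AE \<omega> in M. (\<lambda>n. - S n j \<omega>) \<longlonglongrightarrow> - X j \<omega>"
      using S_tendsto[of j] by eventually_elim (rule tendsto_minus)
    have "prob {\<omega>\<in>space M. X j \<omega> \<le> y \<and> w j i \<omega> > (1 + \<epsilon>) * y} \<le>
      prob {\<omega>\<in>space M. - X j \<omega> > - (1 + \<epsilon> / 2) * y \<and> \<omega> \<in> ?G}"
    proof (rule finite_measure_mono)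
      have "y < (1 + \<epsilon> / 2) * y" using \<epsilon> y0 by simp
      then have "- x > - (1 + \<epsilon> / 2) * y" if "x \<le> y" for x using that by (simp only: mult_minus_left)
      then show "{\<omega>\<in>space M. X j \<omega> \<le> y \<and> w j i \<omega> > (1 + \<epsilon>) * y} \<subseteq>
        {\<omega>\<in>space M. - X j \<omega> > - (1 + \<epsilon> / 2) * y \<and> \<omega> \<in> ?G}" by blast
    qed auto
    also have "\<dots> \<le> \<eta> * y powr (- \<alpha>)"
      by (rule prob_greater_le_of_AE_tendsto[OF _ _ _ lim fin]) auto
    finally show "prob {\<omega>\<in>space M. X j \<omega> \<le> y \<and> w j i \<omega> > (1 + \<epsilon>) * y} \<le> \<eta> * y powr (- \<alpha>)" .
  qed
qed

subsection \<open>Block maxima and maxima of the innovations\<close>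

text \<open>At level \<open>x * u m\<close> a probability of order
  \<open>y powr (- \<alpha>)\<close> is of order \<open>1 / m\<close>, which balances the
  \<open>m\<close> sites of a block.\<close>

definition u :: "nat \<Rightarrow> real" where "u m = real m powr (1 / \<alpha>)"

lemma u_pos: "m \<ge> 1 \<Longrightarrow> u m > 0" by (simp add: u_def)

lemma u_at_top: "filterlim u at_top sequentially"
  unfolding u_def
  using \<alpha> by real_asymp

lemma xu_at_top: "x > 0 \<Longrightarrow> filterlim (\<lambda>m. x * u m) at_top sequentially"
  by (rule filterlim_tendsto_pos_mult_at_top[OF tendsto_const _ u_at_top])

lemma xu_powr: "x > 0 \<Longrightarrow> m \<ge> 1 \<Longrightarrow> (x * u m) powr (- \<alpha>) = x powr (- \<alpha>) / real m"
  using \<alpha> by (simp add: u_def powr_mult powr_powr powr_minus divide_inverse)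

lemma eventually_xu_ge: "x > 0 \<Longrightarrow> \<forall>\<^sub>F m in sequentially. m \<ge> 1 \<and> x * u m \<ge> y"
  using xu_at_top[of x] eventually_ge_at_top[of 1]
  by (auto simp: filterlim_at_top intro: eventually_conj)

text \<open>Rules out large terms that link a site to an innovation in another block. For each
  \<open>i\<close> at most \<open>\<bar>i\<bar>\<close> pairs cross the boundary, each large with
  probability \<open>O(1 / m)\<close>. The first event starts from the site \<open>j\<close>, the
  second from the innovation \<open>l\<close>.\<close>

lemma block_exit_bound:
  assumes I: "finite I" and x: "x > 0" and \<eta>: "\<eta> > 0"
  shows "\<forall>\<^sub>F m in sequentially. \<forall>k.
    prob {\<omega>\<in>space M. \<exists>i\<in>I. \<exists>j\<in>{j\<in>block m k. j - i \<notin> block m k}. \<bar>w j i \<omega>\<bar> > x * u m} \<le> \<eta> \<and>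
    prob {\<omega>\<in>space M. \<exists>i\<in>I. \<exists>l\<in>{l\<in>block m k. l + i \<notin> block m k}. \<bar>w (l + i) i \<omega>\<bar> > x * u m} \<le> \<eta>"
proof -
  define B where "B = (\<Sum>i\<in>I. real (nat \<bar>i\<bar>) * (C * c\<^sub>\<alpha> * x powr (- \<alpha>)))"
  have "(\<lambda>m. B / real m) \<longlonglongrightarrow> 0" by (rule lim_const_over_n)
  then have "\<forall>\<^sub>F m in sequentially. B / real m < \<eta>" using \<eta> by (rule order_tendstoD)
  then show ?thesis using eventually_ge_at_top[of 1]
  proof eventually_elim
    case (elim m)
    have y: "x * u m > 0" using x u_pos[OF elim(2)] by simp
    have gen: "prob {\<omega>\<in>space M. \<exists>i\<in>I. \<exists>j\<in>T i. \<bar>w (f i j) i \<omega>\<bar> > x * u m} \<le> \<eta>"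
      if T: "\<And>i. finite (T i)" "\<And>i. card (T i) \<le> nat \<bar>i\<bar>" for T :: "int \<Rightarrow> int set" and f
    proof -
      have "prob {\<omega>\<in>space M. \<exists>i\<in>I. \<exists>j\<in>T i. \<bar>w (f i j) i \<omega>\<bar> > x * u m} \<le>
        (\<Sum>i\<in>I. prob {\<omega>\<in>space M. \<exists>j\<in>T i. \<bar>w (f i j) i \<omega>\<bar> > x * u m})"
        by (rule prob_ex_le_sum[OF I]) (use countable_finite[OF T(1)] in measurable)
      also have "\<dots> \<le> (\<Sum>i\<in>I. \<Sum>j\<in>T i. prob {\<omega>\<in>space M. \<bar>w (f i j) i \<omega>\<bar> > x * u m})"
        by (intro sum_mono prob_ex_le_sum T) measurable
      also have "\<dots> \<le> (\<Sum>i\<in>I. \<Sum>j\<in>T i. C * c\<^sub>\<alpha> * (x * u m) powr (- \<alpha>))"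
      proof (intro sum_mono)
        fix i j
        have "prob {\<omega>\<in>space M. \<bar>w (f i j) i \<omega>\<bar> > x * u m} \<le> C * \<bar>c i\<bar> powr \<alpha> * (x * u m) powr (- \<alpha>)"
          by (rule w_tail[OF y])
        also have "\<dots> \<le> C * c\<^sub>\<alpha> * (x * u m) powr (- \<alpha>)"
          using sum_c\<alpha>[of "{i}"] by (intro mult_right_mono mult_left_mono C) auto
        finally show "prob {\<omega>\<in>space M. \<bar>w (f i j) i \<omega>\<bar> > x * u m} \<le> C * c\<^sub>\<alpha> * (x * u m) powr (- \<alpha>)" .
      qed
      also have "\<dots> = (\<Sum>i\<in>I. real (card (T i)) * (C * c\<^sub>\<alpha> * (x * u m) powr (- \<alpha>)))" by simp
      also have "\<dots> \<le> (\<Sum>i\<in>I. real (nat \<bar>i\<bar>) * (C * c\<^sub>\<alpha> * (x * u m) powr (- \<alpha>)))"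
        using T(2) C c\<alpha>_nonneg by (intro sum_mono mult_right_mono) (auto simp del: of_nat_nat)
      also have "\<dots> = B / real m"
        unfolding B_def xu_powr[OF x elim(2)] by (simp add: sum_divide_distrib del: of_nat_nat)
      finally show ?thesis using elim(1) by linarith
    qed
    show ?case
    proof (intro allI conjI)
      fix k
      show "prob {\<omega>\<in>space M. \<exists>i\<in>I. \<exists>j\<in>{j\<in>block m k. j - i \<notin> block m k}. \<bar>w j i \<omega>\<bar> > x * u m} \<le> \<eta>"
        by (rule gen[of "\<lambda>i. {j\<in>block m k. j - i \<notin> block m k}" "\<lambda>i j. j"])
           (use card_block_exit[of m k "- i" for i] in auto)
      show "prob {\<omega>\<in>space M. \<exists>i\<in>I. \<exists>l\<in>{l\<in>block m k. l + i \<notin> block m k}. \<bar>w (l + i) i \<omega>\<bar> > x * u m} \<le> \<eta>"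
        by (rule gen[of "\<lambda>i. {l\<in>block m k. l + i \<notin> block m k}" "\<lambda>i l. l + i"])
           (use card_block_exit[of m k] in auto)
    qed
  qed
qed

text \<open>The factor \<open>x powr \<alpha>\<close> in the hypothesis cancels the dependence on
  the threshold, so that \<open>m\<close> summands of size \<open>\<eta> / m\<close> give exactly
  \<open>\<eta>\<close>.\<close>

lemma block_sum_bound:
  assumes x: "x > 0" and m: "m \<ge> 1" and [measurable]: "\<And>j. {\<omega>\<in>space M. P j \<omega>} \<in> events"
    and le: "\<And>j. prob {\<omega>\<in>space M. P j \<omega>} \<le> \<eta> * x powr \<alpha> * (x * u m) powr (- \<alpha>)"
  shows "prob {\<omega>\<in>space M. \<exists>j\<in>block m k. P j \<omega>} \<le> \<eta>"
proof -
  have "prob {\<omega>\<in>space M. \<exists>j\<in>block m k. P j \<omega>} \<le> (\<Sum>j\<in>block m k. prob {\<omega>\<in>space M. P j \<omega>})"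
    by (rule prob_ex_le_sum) auto
  also have "\<dots> \<le> (\<Sum>j\<in>block m k. \<eta> * x powr \<alpha> * (x * u m) powr (- \<alpha>))"
    by (intro sum_mono le)
  also have "\<dots> = real m * (\<eta> * x powr \<alpha> * (x * u m) powr (- \<alpha>))" by simp
  also have "\<dots> = \<eta>"
    unfolding xu_powr[OF x m] using x m by (simp add: powr_minus)
  finally show ?thesis .
qed

lemma block_one_big_jump:
  assumes \<epsilon>: "0 < \<epsilon>" "\<epsilon> < 1" and x: "x > 0" and \<eta>: "\<eta> > 0"
  obtains L :: nat where "\<forall>\<^sub>F m in sequentially. \<forall>k.
    prob {\<omega>\<in>space M. \<exists>j\<in>block m k. X j \<omega> > x * u m \<and> (\<forall>i\<in>{- int L..int L}. w j i \<omega> \<le> (1 - \<epsilon>) * (x * u m))} \<le> \<eta>"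
proof -
  have "\<eta> * x powr \<alpha> > 0" using \<eta> x by simp
  then show ?thesis
  proof (rule one_big_jump[OF \<epsilon>])
    fix L :: nat and y0
    assume L: "\<And>y j. y \<ge> y0 \<Longrightarrow>
       prob {\<omega>\<in>space M. X j \<omega> > y \<and> (\<forall>i\<in>{- int L..int L}. w j i \<omega> \<le> (1 - \<epsilon>) * y)} \<le> \<eta> * x powr \<alpha> * y powr (- \<alpha>)"
    show ?thesis
    proof (rule that[of L])
      show "\<forall>\<^sub>F m in sequentially. \<forall>k.
        prob {\<omega>\<in>space M. \<exists>j\<in>block m k. X j \<omega> > x * u m \<and> (\<forall>i\<in>{- int L..int L}. w j i \<omega> \<le> (1 - \<epsilon>) * (x * u m))} \<le> \<eta>"
        using eventually_xu_ge[OF x, of y0]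
      proof eventually_elim
        case (elim m)
        show ?case
        proof
          fix k
          show "prob {\<omega>\<in>space M. \<exists>j\<in>block m k. X j \<omega> > x * u m \<and> (\<forall>i\<in>{- int L..int L}. w j i \<omega> \<le> (1 - \<epsilon>) * (x * u m))} \<le> \<eta>"
          proof (rule block_sum_bound[OF x])
            show "prob {\<omega>\<in>space M. X j \<omega> > x * u m \<and> (\<forall>i\<in>{- int L..int L}. w j i \<omega> \<le> (1 - \<epsilon>) * (x * u m))}
              \<le> \<eta> * x powr \<alpha> * (x * u m) powr (- \<alpha>)" for j
              by (rule L) (use elim in simp)
          qed (use elim in \<open>simp, measurable\<close>)
        qed
      qed
    qed
  qed
qed

lemma block_big_jump_not_cancelled:
  assumes \<epsilon>: "0 < \<epsilon>" and x: "x > 0" and \<eta>: "\<eta> > 0"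
  shows "\<forall>\<^sub>F m in sequentially. \<forall>k i.
    prob {\<omega>\<in>space M. \<exists>j\<in>block m k. X j \<omega> \<le> x * u m \<and> w j i \<omega> > (1 + \<epsilon>) * (x * u m)} \<le> \<eta>"
proof -
  have "\<eta> * x powr \<alpha> > 0" using \<eta> x by simp
  then show ?thesis
  proof (rule big_jump_not_cancelled[OF \<epsilon>])
    fix y0
    assume y0: "\<And>y j i. y \<ge> y0 \<Longrightarrow>
       prob {\<omega>\<in>space M. X j \<omega> \<le> y \<and> w j i \<omega> > (1 + \<epsilon>) * y} \<le> \<eta> * x powr \<alpha> * y powr (- \<alpha>)"
    show ?thesis
      using eventually_xu_ge[OF x, of y0]
    proof eventually_elim
      case (elim m)
      show ?case
      proof (intro allI)
        fix k i
        show "prob {\<omega>\<in>space M. \<exists>j\<in>block m k. X j \<omega> \<le> x * u m \<and> w j i \<omega> > (1 + \<epsilon>) * (x * u m)} \<le> \<eta>"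
        proof (rule block_sum_bound[OF x])
          show "prob {\<omega>\<in>space M. X j \<omega> \<le> x * u m \<and> w j i \<omega> > (1 + \<epsilon>) * (x * u m)}
            \<le> \<eta> * x powr \<alpha> * (x * u m) powr (- \<alpha>)" for j
            by (rule y0) (use elim in simp)
        qed (use elim in \<open>simp, measurable\<close>)
      qed
    qed
  qed
qed

section \<open>Extreme coefficients and the function \<open>\<phi>\<close>\<close>

lemma c_abs_ge_finite:
  assumes "e > 0"
  shows "finite {i. \<bar>c i\<bar> \<ge> e}"
proof -
  obtain L where L: "\<And>F. finite F \<Longrightarrow> F \<inter> {- int L..int L} = {} \<Longrightarrow> (\<Sum>i\<in>F. \<bar>c i\<bar> powr \<alpha>) < e powr \<alpha>"
    using c\<alpha>_tail[of "e powr \<alpha>"] assms by auto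
  have "{i. \<bar>c i\<bar> \<ge> e} \<subseteq> {- int L..int L}"
  proof (rule subsetI, rule ccontr)
    fix i assume i: "i \<in> {i. \<bar>c i\<bar> \<ge> e}" "i \<notin> {- int L..int L}"
    then have "e powr \<alpha> \<le> \<bar>c i\<bar> powr \<alpha>" using assms \<alpha> by (intro powr_mono2) auto
    moreover have "\<bar>c i\<bar> powr \<alpha> < e powr \<alpha>" using L[of "{i}"] i(2) by simp
    ultimately show False by simp
  qed
  then show ?thesis by (rule finite_subset) simp
qed

text \<open>Stated for \<open>f\<close> with \<open>\<bar>f i\<bar> = \<bar>c i\<bar>\<close> to
  serve both \<open>c\<close> and its negative. A negative supremum would keep all infinitely many
  coefficients away from 0. A positive one is attained, since only finitely many values reach half
  of it.\<close>

lemma SUP_coefficients: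
  fixes f :: "int \<Rightarrow> real"
  assumes f: "\<And>i. \<bar>f i\<bar> = \<bar>c i\<bar>"
  shows "f i \<le> (SUP i. f i)" "0 \<le> (SUP i. f i)" "0 < (SUP i. f i) \<Longrightarrow> \<exists>i. f i = (SUP i. f i)"
proof -
  have fin: "finite {i. f i \<ge> e}" if "e > 0" for e
    by (rule finite_subset[OF _ c_abs_ge_finite[OF that]]) (use f in \<open>auto simp: f[symmetric]\<close>)
  have bdd: "bdd_above (range f)"
  proof -
    have "bdd_above (f ` {i. f i \<ge> 1} \<union> {..1})"
      using fin[of 1] by (auto intro!: bdd_above_finite)
    then show ?thesis by (rule bdd_above_mono) auto
  qed
  show up: "f i \<le> (SUP i. f i)" for i by (rule cSUP_upper[OF _ bdd]) simp
  show ge0: "0 \<le> (SUP i. f i)"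
  proof (rule ccontr)
    assume "\<not> 0 \<le> (SUP i. f i)"
    then have neg: "(SUP i. f i) < 0" by simp
    have "{i. \<bar>c i\<bar> \<ge> - (SUP i. f i)} = UNIV"
    proof -
      have "\<bar>c i\<bar> \<ge> - (SUP i. f i)" for i using up[of i] f[of i] by linarith
      then show ?thesis by auto
    qed
    then show False using c_abs_ge_finite[of "- (SUP i. f i)"] neg infinite_UNIV_int by simp
  qed
  assume pos: "0 < (SUP i. f i)"
  let ?s = "SUP i. f i"
  let ?T = "{i. f i \<ge> ?s / 2}"
  have finT: "finite ?T" using fin[of "?s / 2"] pos by simp
  have "\<exists>i. f i > ?s / 2" using less_cSUP_iff[of UNIV f "?s / 2"] bdd pos by simp
  then have ne: "?T \<noteq> {}" by (auto intro: less_imp_le)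
  obtain i where i: "i \<in> ?T" "f i = Max (f ` ?T)"
    using Max_in[of "f ` ?T"] finT ne by fastforce
  have i': "f k \<le> f i" if "k \<in> ?T" for k
    unfolding i(2) by (rule Max_ge) (use finT that in auto)
  have "?s \<le> f i"
  proof (rule cSUP_least)
    fix k show "f k \<le> f i" using i(1) i'[of k] by (cases "k \<in> ?T") auto
  qed simp
  then show "\<exists>i. f i = ?s" using up[of i] by (intro exI[of _ i]) simp
qed

lemma coefficients:
  shows "c i \<le> c_plus c" "0 \<le> c_plus c" "0 < c_plus c \<Longrightarrow> \<exists>i. c i = c_plus c"
    and "- c i \<le> c_minus c" "0 \<le> c_minus c" "0 < c_minus c \<Longrightarrow> \<exists>i. - c i = c_minus c"
  using SUP_coefficients[of c] SUP_coefficients[of "\<lambda>i. - c i"] unfolding c_plus_def c_minus_def by auto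

definition \<phi> :: "real \<Rightarrow> real" where "\<phi> t = max (c_plus c * t) (- (c_minus c * t))"

lemma \<phi>_meas[measurable]: "\<phi> \<in> borel_measurable borel" unfolding \<phi>_def by measurable

lemma coefficient_le_\<phi>: "c i * t \<le> \<phi> t"
proof (cases "t \<ge> 0")
  case True
  then show ?thesis using mult_right_mono[OF coefficients(1)[of i] True] by (simp add: \<phi>_def le_max_iff_disj)
next
  case False
  then show ?thesis using mult_right_mono[OF coefficients(4)[of i], of "- t"] by (simp add: \<phi>_def le_max_iff_disj)
qed

text \<open>Two indices suffice, a maximiser of \<open>c\<close> and one of \<open>- c\<close>. If a
  supremum is 0 the chosen index may be arbitrary, but \<open>\<phi> t > 0\<close> forces the
  supremum actually used to be positive, hence attained.\<close>

lemma \<phi>_attained: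
  obtains I where "finite I" "\<And>t. \<phi> t > 0 \<Longrightarrow> \<exists>i\<in>I. \<phi> t = c i * t"
proof (rule that)
  define ip im where "ip = (SOME i. c i = c_plus c)" and "im = (SOME i. - c i = c_minus c)"
  show "finite {ip, im}" by simp
  fix t assume pos: "\<phi> t > 0"
  show "\<exists>i\<in>{ip, im}. \<phi> t = c i * t"
  proof (cases "\<phi> t = c_plus c * t")
    case True
    then have "0 < c_plus c" using pos coefficients(2) by (cases "c_plus c = 0") auto
    then have "c ip = c_plus c" unfolding ip_def by (rule someI_ex[OF coefficients(3)])
    then show ?thesis using True by simp
  next
    case False
    then have eq: "\<phi> t = - c_minus c * t" by (simp add: \<phi>_def max_def split: if_splits)
    then have "0 < c_minus c" using pos coefficients(5) by (cases "c_minus c = 0") auto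
    then have "- c im = c_minus c" unfolding im_def by (rule someI_ex[OF coefficients(6)])
    then have "\<phi> t = c im * t" using eq by (metis mult_minus_left minus_minus)
    then show ?thesis by simp
  qed
qed

end

section \<open>Limits of the joint distribution functions\<close>

locale regularly_varying_linear_process = heavy_tailed_linear_process +
  fixes \<theta>p \<theta>n :: real
  assumes upper_tail: "((\<lambda>x. x powr \<alpha> * prob {\<omega>\<in>space M. \<xi> 0 \<omega> > x}) \<longlongrightarrow> \<theta>p) at_top"
    and lower_tail: "((\<lambda>x. x powr \<alpha> * prob {\<omega>\<in>space M. - \<xi> 0 \<omega> > x}) \<longlongrightarrow> \<theta>n) at_top"
begin

text \<open>The \<open>\<alpha>\<close>-th power of the limiting Frechet scale. The tail constants
  \<open>\<theta>p\<close> and \<open>\<theta>n\<close> will be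
  \<open>\<sigma>\<xi> powr \<alpha>\<close> times \<open>p\<close> and
  \<open>1 - p\<close>.\<close>

definition \<theta> :: real where "\<theta> = c_plus c powr \<alpha> * \<theta>p + c_minus c powr \<alpha> * \<theta>n"

definition innovations_below :: "nat \<Rightarrow> nat set \<Rightarrow> (nat \<Rightarrow> real) \<Rightarrow> 'a set" where
  "innovations_below m J x = {\<omega>\<in>space M. \<forall>k\<in>J. \<forall>l\<in>block m k. \<phi> (\<xi> l \<omega>) \<le> x k * u m}"

definition maxima_below :: "nat \<Rightarrow> nat set \<Rightarrow> (nat \<Rightarrow> real) \<Rightarrow> 'a set" where
  "maxima_below m J x = {\<omega>\<in>space M. \<forall>k\<in>J. 1 / real m powr (1 / \<alpha>) * block_max X m k \<omega> \<le> x k}"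

text \<open>For \<open>m = 0\<close> the maximum is over the empty set and unspecified, so the
  description by sites starts at \<open>m = 1\<close>.\<close>

lemma maxima_below_eq:
  "m \<ge> 1 \<Longrightarrow> maxima_below m J x = {\<omega>\<in>space M. \<forall>k\<in>J. \<forall>j\<in>block m k. X j \<omega> \<le> x k * u m}"
  using u_pos[of m] unfolding maxima_below_def
  by (simp add: u_def[symmetric] pos_divide_le_eq block_max_le_iff)

lemma innovations_below_event: "finite J \<Longrightarrow> innovations_below m J x \<in> events"
  unfolding innovations_below_def using countable_finite[of J] countable_finite[OF finite_block]
  by measurable

lemma maxima_below_event: "finite J \<Longrightarrow> m \<ge> 1 \<Longrightarrow> maxima_below m J x \<in> events"
  unfolding maxima_below_eq using countable_finite[of J] countable_finite[OF finite_block]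
  by measurable

text \<open>For \<open>y > 0\<close> the event splits into two disjoint parts by the sign of the
  innovation, because both suprema are nonnegative; their tails add.\<close>

lemma \<phi>_tail: "((\<lambda>y. y powr \<alpha> * prob {\<omega>\<in>space M. \<phi> (\<xi> 0 \<omega>) > y}) \<longlongrightarrow> \<theta>) at_top"
proof -
  let ?P = "\<lambda>y. {\<omega>\<in>space M. c_plus c * \<xi> 0 \<omega> > y}" and ?N = "\<lambda>y. {\<omega>\<in>space M. c_minus c * - \<xi> 0 \<omega> > y}"
  have "((\<lambda>y. y powr \<alpha> * prob (?P y) + y powr \<alpha> * prob (?N y)) \<longlongrightarrow> \<theta>) at_top"
    unfolding \<theta>_def
    by (intro tendsto_add scaled_upper_tail upper_tail lower_tail coefficients)
  moreover have "\<forall>\<^sub>F y in at_top. y powr \<alpha> * prob (?P y) + y powr \<alpha> * prob (?N y) =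
      y powr \<alpha> * prob {\<omega>\<in>space M. \<phi> (\<xi> 0 \<omega>) > y}"
    using eventually_gt_at_top[of 0]
  proof eventually_elim
    case (elim y)
    have disj: "\<not> (c_plus c * t > y \<and> c_minus c * - t > y)" for t
    proof (cases "t \<ge> 0")
      case True
      then have "c_minus c * - t \<le> 0" using coefficients(5) by (intro mult_nonneg_nonpos) simp_all
      then show ?thesis using elim by linarith
    next
      case False
      then have "c_plus c * t \<le> 0" using coefficients(2) by (intro mult_nonneg_nonpos) simp_all
      then show ?thesis using elim by linarith
    qed
    have "{\<omega>\<in>space M. \<phi> (\<xi> 0 \<omega>) > y} = ?P y \<union> ?N y"
      unfolding \<phi>_def less_max_iff_disj mult_minus_right by blast
    moreover have "prob (?P y \<union> ?N y) = prob (?P y) + prob (?N y)"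
    proof (rule finite_measure_Union)
      show "?P y \<inter> ?N y = {}" using disj by blast
    qed measurable
    ultimately have "prob {\<omega>\<in>space M. \<phi> (\<xi> 0 \<omega>) > y} = prob (?P y) + prob (?N y)" by simp
    then show ?case by (simp add: distrib_left)
  qed
  ultimately show ?thesis by (rule Lim_transform_eventually)
qed

lemma prob_\<phi>_ident: "prob (\<xi> l -` {t. \<phi> t \<le> y} \<inter> space M) = 1 - prob {\<omega>\<in>space M. \<phi> (\<xi> 0 \<omega>) > y}"
proof -
  have "prob (\<xi> l -` {t. \<phi> t \<le> y} \<inter> space M) = measure (distr M borel (\<xi> l)) {t. \<phi> t \<le> y}"
    by (rule measure_distr[symmetric]) auto
  also have "\<dots> = measure (distr M borel (\<xi> 0)) {t. \<phi> t \<le> y}" by (simp only: ident[of l 0])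
  also have "\<dots> = prob (\<xi> 0 -` {t. \<phi> t \<le> y} \<inter> space M)"
    by (rule measure_distr) auto
  also have "\<dots> = prob (space M - {\<omega>\<in>space M. \<phi> (\<xi> 0 \<omega>) > y})"
    by (rule arg_cong[where f=prob]) auto
  also have "\<dots> = 1 - prob {\<omega>\<in>space M. \<phi> (\<xi> 0 \<omega>) > y}" by (rule prob_compl) measurable
  finally show ?thesis .
qed

text \<open>The event constrains distinct independent innovations one by one, so it factors over all
  sites, and the sites group into disjoint blocks with a common threshold.\<close>

lemma prob_innovations_below:
  assumes J: "finite J" "J \<subseteq> {1..}" and m: "m \<ge> 1"
  shows "prob (innovations_below m J x) = (\<Prod>k\<in>J. (1 - prob {\<omega>\<in>space M. \<phi> (\<xi> 0 \<omega>) > x k * u m}) ^ m)"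
proof (cases "J = {}")
  case True
  then show ?thesis by (simp add: innovations_below_def prob_space)
next
  case False
  \<comment> \<open>The block number as a function of the site turns the thresholds
    \<open>x k\<close> into one family indexed by the sites, as the product formula for independent
    variables requires.\<close>
  define b where "b l = nat ((l - 1) div int m) + 1" for l
  have b: "b l = k" if "l \<in> block m k" "k \<in> J" for l k
    unfolding b_def using block_index[OF that(1)] that(2) J(2) by auto
  let ?U = "\<Union>k\<in>J. block m k"
  have ne: "?U \<noteq> {}"
  proof -
    obtain k where "k \<in> J" using False by blast
    moreover have "card (block m k) \<noteq> 0" using m by simp
    then have "block m k \<noteq> {}" by fastforce
    ultimately show ?thesis by blast
  qed
  have "innovations_below m J x = (\<Inter>l\<in>?U. \<xi> l -` {t. \<phi> t \<le> x (b l) * u m} \<inter> space M)"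
    unfolding innovations_below_def using ne b by auto
  also have "prob \<dots> = (\<Prod>l\<in>?U. prob (\<xi> l -` {t. \<phi> t \<le> x (b l) * u m} \<inter> space M))"
    by (rule indep_varsD[OF indep ne]) (use J in auto)
  also have "\<dots> = (\<Prod>l\<in>?U. 1 - prob {\<omega>\<in>space M. \<phi> (\<xi> 0 \<omega>) > x (b l) * u m})"
    by (rule prod.cong[OF refl prob_\<phi>_ident])
  also have "\<dots> = (\<Prod>k\<in>J. \<Prod>l\<in>block m k. 1 - prob {\<omega>\<in>space M. \<phi> (\<xi> 0 \<omega>) > x (b l) * u m})"
  proof (rule prod.UNION_disjoint[OF J(1)])
    show "\<forall>k\<in>J. \<forall>k'\<in>J. k \<noteq> k' \<longrightarrow> block m k \<inter> block m k' = {}" using b by blast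
  qed simp
  also have "\<dots> = (\<Prod>k\<in>J. \<Prod>l\<in>block m k. 1 - prob {\<omega>\<in>space M. \<phi> (\<xi> 0 \<omega>) > x k * u m})"
    by (intro prod.cong) (auto simp: b)
  finally show ?thesis by simp
qed

lemma innovations_below_tendsto:
  assumes J: "finite J" "J \<subseteq> {1..}" and x: "\<And>k. k \<in> J \<Longrightarrow> x k > 0"
  shows "(\<lambda>m. prob (innovations_below m J x)) \<longlonglongrightarrow> (\<Prod>k\<in>J. exp (- (\<theta> * x k powr (- \<alpha>))))"
proof -
  have "(\<lambda>m. real m * prob {\<omega>\<in>space M. \<phi> (\<xi> 0 \<omega>) > x k * u m}) \<longlonglongrightarrow> \<theta> * x k powr (- \<alpha>)" if k: "k \<in> J" for k
  proof -
    have "(\<lambda>m. (x k * u m) powr \<alpha> * prob {\<omega>\<in>space M. \<phi> (\<xi> 0 \<omega>) > x k * u m} * x k powr (- \<alpha>)) \<longlonglongrightarrow> \<theta> * x k powr (- \<alpha>)"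
      by (intro tendsto_mult tendsto_const filterlim_compose[OF \<phi>_tail xu_at_top] x k)
    moreover have "\<forall>\<^sub>F m in sequentially. (x k * u m) powr \<alpha> * prob {\<omega>\<in>space M. \<phi> (\<xi> 0 \<omega>) > x k * u m} * x k powr (- \<alpha>)
      = real m * prob {\<omega>\<in>space M. \<phi> (\<xi> 0 \<omega>) > x k * u m}"
      using eventually_ge_at_top[of 1]
    proof eventually_elim
      case (elim m)
      have "(x k * u m) powr \<alpha> * x k powr (- \<alpha>) = real m"
        using x[OF k] elim \<alpha> by (simp add: u_def powr_mult powr_powr powr_minus)
      have "(x k * u m) powr \<alpha> * P * x k powr (- \<alpha>) = ((x k * u m) powr \<alpha> * x k powr (- \<alpha>)) * P" for P
        by (simp only: mult_ac)
      then show ?case by (simp only: \<open>(x k * u m) powr \<alpha> * x k powr (- \<alpha>) = real m\<close>)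
    qed
    ultimately show ?thesis by (rule Lim_transform_eventually)
  qed
  then have "(\<lambda>m. \<Prod>k\<in>J. (1 - prob {\<omega>\<in>space M. \<phi> (\<xi> 0 \<omega>) > x k * u m}) ^ m) \<longlonglongrightarrow> (\<Prod>k\<in>J. exp (- (\<theta> * x k powr (- \<alpha>))))"
    by (intro tendsto_prod power_one_minus_tendsto_exp)
  moreover have "\<forall>\<^sub>F m in sequentially. (\<Prod>k\<in>J. (1 - prob {\<omega>\<in>space M. \<phi> (\<xi> 0 \<omega>) > x k * u m}) ^ m) = prob (innovations_below m J x)"
    using eventually_ge_at_top[of 1] by eventually_elim (simp add: prob_innovations_below[OF J])
  ultimately show ?thesis by (rule Lim_transform_eventually)
qed

text \<open>An innovation with \<open>\<phi> (\<xi> l) > (1 + \<epsilon>) * x k * u m\<close> makes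
  the term \<open>w (l + i) i\<close> large for some \<open>i\<close> in a fixed finite set. If site
  \<open>l + i\<close> is in the block, a small maximum means cancellation; if not, a boundary event
  occurs.\<close>

lemma prob_maxima_below_le:
  assumes J: "finite J" and x: "\<And>k. k \<in> J \<Longrightarrow> x k > 0" and \<epsilon>: "\<epsilon> > 0" and \<eta>: "\<eta> > 0"
  shows "\<forall>\<^sub>F m in sequentially. prob (maxima_below m J x) \<le> prob (innovations_below m J (\<lambda>k. (1 + \<epsilon>) * x k)) + \<eta>"
proof -
  obtain I where I: "finite I" "\<And>t. \<phi> t > 0 \<Longrightarrow> \<exists>i\<in>I. \<phi> t = c i * t" using \<phi>_attained by blast
  \<comment> \<open>Each \<open>k\<close> in \<open>J\<close> has \<open>card I\<close> cancellation
    events and one boundary event, of probability at most \<open>e\<close> each; the added ones keep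
    the quotient meaningful for empty sets.\<close>
  define e where "e = \<eta> / ((real (card J) + 1) * (real (card I) + 1))"
  have e: "e > 0" using \<eta> by (simp add: e_def)
  have eJ: "real (card J) * (real (card I) * e + e) \<le> \<eta>"
  proof -
    have "real (card J) * (real (card I) * e + e) = real (card J) * ((real (card I) + 1) * e)" by (simp add: algebra_simps)
    also have "\<dots> \<le> (real (card J) + 1) * ((real (card I) + 1) * e)"
      using e by (intro mult_right_mono) auto
    also have "\<dots> = \<eta>" by (simp add: e_def)
    finally show ?thesis .
  qed
  have "\<forall>\<^sub>F m in sequentially. \<forall>k\<in>J. \<forall>k' i.
    prob {\<omega>\<in>space M. \<exists>j\<in>block m k'. X j \<omega> \<le> x k * u m \<and> w j i \<omega> > (1 + \<epsilon>) * (x k * u m)} \<le> e"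
    by (intro eventually_ball_finite J ballI block_big_jump_not_cancelled \<epsilon> e x)
  moreover have "\<forall>\<^sub>F m in sequentially. \<forall>k\<in>J. \<forall>k'.
    prob {\<omega>\<in>space M. \<exists>i\<in>I. \<exists>j\<in>{j\<in>block m k'. j - i \<notin> block m k'}. \<bar>w j i \<omega>\<bar> > x k * u m} \<le> e \<and>
    prob {\<omega>\<in>space M. \<exists>i\<in>I. \<exists>l\<in>{l\<in>block m k'. l + i \<notin> block m k'}. \<bar>w (l + i) i \<omega>\<bar> > x k * u m} \<le> e"
    by (intro eventually_ball_finite J ballI block_exit_bound I e x)
  ultimately show ?thesis using eventually_ge_at_top[of 1]
  proof eventually_elim
    case (elim m)
    note [measurable] = countable_finite[OF J] countable_finite[OF I(1)] countable_finite[OF finite_block]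
      innovations_below_event[OF J]
    have [measurable]: "countable {l\<in>block m k. l + i \<notin> block m k}" for i k
      by (rule countable_finite) simp
    let ?E = "\<lambda>k i. {\<omega>\<in>space M. \<exists>j\<in>block m k. X j \<omega> \<le> x k * u m \<and> w j i \<omega> > (1 + \<epsilon>) * (x k * u m)}"
    let ?H = "\<lambda>k. {\<omega>\<in>space M. \<exists>i\<in>I. \<exists>l\<in>{l\<in>block m k. l + i \<notin> block m k}. \<bar>w (l + i) i \<omega>\<bar> > x k * u m}"
    let ?D = "\<lambda>k. (\<Union>i\<in>I. ?E k i) \<union> ?H k"
    have E[measurable]: "?E k i \<in> events" for k i by measurable
    have H[measurable]: "?H k \<in> events" for k by measurable
    have D[measurable]: "?D k \<in> events" for k using I(1) E H by auto
    have sub: "maxima_below m J x \<subseteq> innovations_below m J (\<lambda>k. (1 + \<epsilon>) * x k) \<union> (\<Union>k\<in>J. ?D k)"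
    proof (rule subsetI, rule ccontr)
      fix \<omega> assume max: "\<omega> \<in> maxima_below m J x"
        and "\<omega> \<notin> innovations_below m J (\<lambda>k. (1 + \<epsilon>) * x k) \<union> (\<Union>k\<in>J. ?D k)"
      then have no: "\<omega> \<notin> innovations_below m J (\<lambda>k. (1 + \<epsilon>) * x k)" "\<And>k. k \<in> J \<Longrightarrow> \<omega> \<notin> ?D k"
        and sp: "\<omega> \<in> space M" by (auto simp: maxima_below_def)
      from no(1) sp obtain k l where kl: "k \<in> J" "l \<in> block m k" "\<phi> (\<xi> l \<omega>) > (1 + \<epsilon>) * x k * u m"
        by (auto simp: innovations_below_def not_le)
      have pos: "x k * u m > 0" using x[OF kl(1)] u_pos[OF elim(3)] by simp
      have "1 * (x k * u m) < (1 + \<epsilon>) * (x k * u m)"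
        by (rule mult_strict_right_mono[OF _ pos]) (use \<epsilon> in simp)
      then have gt: "x k * u m < (1 + \<epsilon>) * (x k * u m)" by simp
      have "\<phi> (\<xi> l \<omega>) > 0" using kl(3) gt pos by (simp add: mult.assoc)
      then obtain i where i: "i \<in> I" "\<phi> (\<xi> l \<omega>) = c i * \<xi> l \<omega>" using I(2) by blast
      have wi: "w (l + i) i \<omega> > (1 + \<epsilon>) * (x k * u m)" using i(2) kl(3) by (simp add: w_def mult.assoc)
      show False
      proof (cases "l + i \<in> block m k")
        case True
        then have "X (l + i) \<omega> \<le> x k * u m" using max kl(1) maxima_below_eq[OF elim(3)] by auto
        then have "\<omega> \<in> ?E k i" using True wi sp by blast
        then show False using no(2)[OF kl(1)] i(1) by blast
      next
        case False
        have "\<bar>w (l + i) i \<omega>\<bar> > x k * u m" using wi gt by linarith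
        then have "\<omega> \<in> ?H k" using False kl(2) i(1) sp by blast
        then show False using no(2)[OF kl(1)] by blast
      qed
    qed
    have Dle: "prob (?D k) \<le> real (card I) * e + e" if k: "k \<in> J" for k
    proof -
      have "prob (?D k) \<le> prob (\<Union>i\<in>I. ?E k i) + prob (?H k)"
        by (rule measure_Un_le) (use I(1) in auto)
      also have "prob (\<Union>i\<in>I. ?E k i) \<le> (\<Sum>i\<in>I. prob (?E k i))"
        by (rule finite_measure_subadditive_finite) (use I(1) E in auto)
      also have "\<dots> \<le> (\<Sum>i\<in>I. e)" using elim(1) k by (intro sum_mono) blast
      also have "prob (?H k) \<le> e" using elim(2) k by blast
      finally show ?thesis by simp
    qed
    have "prob (maxima_below m J x) \<le> prob (innovations_below m J (\<lambda>k. (1 + \<epsilon>) * x k) \<union> (\<Union>k\<in>J. ?D k))"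
      by (rule finite_measure_mono[OF sub]) (use J D in \<open>auto intro!: innovations_below_event\<close>)
    also have "\<dots> \<le> prob (innovations_below m J (\<lambda>k. (1 + \<epsilon>) * x k)) + prob (\<Union>k\<in>J. ?D k)"
      by (rule measure_Un_le) (use J D in \<open>auto intro!: innovations_below_event\<close>)
    also have "prob (\<Union>k\<in>J. ?D k) \<le> (\<Sum>k\<in>J. prob (?D k))"
      by (rule finite_measure_subadditive_finite[OF J]) (use D in auto)
    also have "\<dots> \<le> (\<Sum>k\<in>J. real (card I) * e + e)" by (intro sum_mono Dle)
    also have "\<dots> \<le> \<eta>" using eJ by simp
    finally show ?case by simp
  qed
qed

text \<open>A site with \<open>X j > x k * u m\<close> has, outside the exceptional events, a term
  \<open>w j i\<close> above \<open>(1 - \<epsilon>)\<close> times that level with \<open>i\<close>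
  in the window. Its innovation \<open>j - i\<close> then violates the bound on
  \<open>\<phi>\<close> or lies in another block.\<close>

lemma prob_innovations_below_le:
  assumes J: "finite J" and x: "\<And>k. k \<in> J \<Longrightarrow> x k > 0" and \<epsilon>: "0 < \<epsilon>" "\<epsilon> < 1" and \<eta>: "\<eta> > 0"
  shows "\<forall>\<^sub>F m in sequentially. prob (innovations_below m J (\<lambda>k. (1 - \<epsilon>) * x k)) \<le> prob (maxima_below m J x) + \<eta>"
proof -
  define e where "e = \<eta> / (2 * (real (card J) + 1))"
  have e: "e > 0" using \<eta> by (simp add: e_def)
  have eJ: "real (card J) * (e + e) \<le> \<eta>"
  proof -
    have "real (card J) * (e + e) \<le> (real (card J) + 1) * (e + e)"
      using e by (intro mult_right_mono) auto
    also have "\<dots> = 2 * (real (card J) + 1) * e" by (simp add: algebra_simps)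
    also have "\<dots> = \<eta>" by (simp add: e_def)
    finally show ?thesis .
  qed
  have "\<forall>k\<in>J. \<exists>L::nat. \<forall>\<^sub>F m in sequentially. \<forall>k'.
    prob {\<omega>\<in>space M. \<exists>j\<in>block m k'. X j \<omega> > x k * u m \<and> (\<forall>i\<in>{- int L..int L}. w j i \<omega> \<le> (1 - \<epsilon>) * (x k * u m))} \<le> e"
  proof
    fix k assume "k \<in> J"
    show "\<exists>L::nat. \<forall>\<^sub>F m in sequentially. \<forall>k'.
      prob {\<omega>\<in>space M. \<exists>j\<in>block m k'. X j \<omega> > x k * u m \<and> (\<forall>i\<in>{- int L..int L}. w j i \<omega> \<le> (1 - \<epsilon>) * (x k * u m))} \<le> e"
    proof (rule block_one_big_jump[OF \<epsilon> x[OF \<open>k \<in> J\<close>] e])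
      fix L :: nat assume "\<forall>\<^sub>F m in sequentially. \<forall>k'.
        prob {\<omega>\<in>space M. \<exists>j\<in>block m k'. X j \<omega> > x k * u m \<and> (\<forall>i\<in>{- int L..int L}. w j i \<omega> \<le> (1 - \<epsilon>) * (x k * u m))} \<le> e"
      then show ?thesis by (rule exI[where x=L])
    qed
  qed
  \<comment> \<open>The error allowed at a single site depends on the threshold \<open>x k\<close>,
    so each \<open>k\<close> has its own window; finiteness of \<open>J\<close> merges the eventual
    statements.\<close>
  then obtain L :: "nat \<Rightarrow> nat" where L: "\<And>k. k \<in> J \<Longrightarrow> \<forall>\<^sub>F m in sequentially. \<forall>k'.
    prob {\<omega>\<in>space M. \<exists>j\<in>block m k'. X j \<omega> > x k * u m \<and> (\<forall>i\<in>{- int (L k)..int (L k)}. w j i \<omega> \<le> (1 - \<epsilon>) * (x k * u m))} \<le> e"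
    unfolding bchoice_iff by blast
  have "\<forall>\<^sub>F m in sequentially. \<forall>k\<in>J. \<forall>k'.
    prob {\<omega>\<in>space M. \<exists>j\<in>block m k'. X j \<omega> > x k * u m \<and> (\<forall>i\<in>{- int (L k)..int (L k)}. w j i \<omega> \<le> (1 - \<epsilon>) * (x k * u m))} \<le> e"
    by (intro eventually_ball_finite J ballI L)
  moreover have "\<forall>\<^sub>F m in sequentially. \<forall>k\<in>J. \<forall>k'.
    prob {\<omega>\<in>space M. \<exists>i\<in>{- int (L k)..int (L k)}. \<exists>j\<in>{j\<in>block m k'. j - i \<notin> block m k'}. \<bar>w j i \<omega>\<bar> > ((1 - \<epsilon>) * x k) * u m} \<le> e \<and>
    prob {\<omega>\<in>space M. \<exists>i\<in>{- int (L k)..int (L k)}. \<exists>l\<in>{l\<in>block m k'. l + i \<notin> block m k'}. \<bar>w (l + i) i \<omega>\<bar> > ((1 - \<epsilon>) * x k) * u m} \<le> e"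
    by (intro eventually_ball_finite J ballI block_exit_bound e) (use x \<epsilon> in auto)
  ultimately show ?thesis using eventually_ge_at_top[of 1]
  proof eventually_elim
    case (elim m)
    note [measurable] = countable_finite[OF J] countable_finite[OF finite_block]
    have [measurable]: "countable {j\<in>block m k. j - i \<notin> block m k}" for i k
      by (rule countable_finite) simp
    let ?E = "\<lambda>k. {\<omega>\<in>space M. \<exists>j\<in>block m k. X j \<omega> > x k * u m \<and> (\<forall>i\<in>{- int (L k)..int (L k)}. w j i \<omega> \<le> (1 - \<epsilon>) * (x k * u m))}"
    let ?H = "\<lambda>k. {\<omega>\<in>space M. \<exists>i\<in>{- int (L k)..int (L k)}. \<exists>j\<in>{j\<in>block m k. j - i \<notin> block m k}. \<bar>w j i \<omega>\<bar> > ((1 - \<epsilon>) * x k) * u m}"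
    let ?D = "\<lambda>k. ?E k \<union> ?H k"
    have E[measurable]: "?E k \<in> events" for k by measurable
    have H[measurable]: "?H k \<in> events" for k by measurable
    have D[measurable]: "?D k \<in> events" for k using E H by auto
    have sub: "innovations_below m J (\<lambda>k. (1 - \<epsilon>) * x k) \<subseteq> maxima_below m J x \<union> (\<Union>k\<in>J. ?D k)"
    proof (rule subsetI, rule ccontr)
      fix \<omega> assume inn: "\<omega> \<in> innovations_below m J (\<lambda>k. (1 - \<epsilon>) * x k)"
        and "\<omega> \<notin> maxima_below m J x \<union> (\<Union>k\<in>J. ?D k)"
      then have no: "\<omega> \<notin> maxima_below m J x" "\<And>k. k \<in> J \<Longrightarrow> \<omega> \<notin> ?D k"
        and sp: "\<omega> \<in> space M" by (auto simp: innovations_below_def)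
      from no(1) sp obtain k j where kj: "k \<in> J" "j \<in> block m k" "X j \<omega> > x k * u m"
        unfolding maxima_below_eq[OF elim(3)] by (auto simp: not_le)
      have "\<omega> \<notin> ?E k" using no(2)[OF kj(1)] by blast
      then obtain i where i: "i \<in> {- int (L k)..int (L k)}" "w j i \<omega> > (1 - \<epsilon>) * (x k * u m)"
        using kj(2,3) sp by (auto simp: not_le)
      show False
      proof (cases "j - i \<in> block m k")
        case True
        then have "\<phi> (\<xi> (j - i) \<omega>) \<le> (1 - \<epsilon>) * x k * u m"
          using inn kj(1) unfolding innovations_below_def by blast
        then show False
          using i(2) coefficient_le_\<phi>[of i "\<xi> (j - i) \<omega>"] by (simp add: w_def mult.assoc)
      next
        case False
        have "\<bar>w j i \<omega>\<bar> > ((1 - \<epsilon>) * x k) * u m" using i(2) by (simp add: mult.assoc)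
        then have "\<omega> \<in> ?H k" using False kj(2) i(1) sp by blast
        then show False using no(2)[OF kj(1)] by blast
      qed
    qed
    have Dle: "prob (?D k) \<le> e + e" if k: "k \<in> J" for k
    proof -
      have "prob (?D k) \<le> prob (?E k) + prob (?H k)" by (rule measure_Un_le) auto
      also have "prob (?E k) \<le> e" using elim(1) k by blast
      also have "prob (?H k) \<le> e" using elim(2) k by blast
      finally show ?thesis by simp
    qed
    have "prob (innovations_below m J (\<lambda>k. (1 - \<epsilon>) * x k)) \<le> prob (maxima_below m J x \<union> (\<Union>k\<in>J. ?D k))"
      by (rule finite_measure_mono[OF sub]) (use J D elim(3) in \<open>auto intro!: maxima_below_event\<close>)
    also have "\<dots> \<le> prob (maxima_below m J x) + prob (\<Union>k\<in>J. ?D k)"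
      by (rule measure_Un_le) (use J D elim(3) in \<open>auto intro!: maxima_below_event\<close>)
    also have "prob (\<Union>k\<in>J. ?D k) \<le> (\<Sum>k\<in>J. prob (?D k))"
      by (rule finite_measure_subadditive_finite[OF J]) (use D in auto)
    also have "\<dots> \<le> (\<Sum>k\<in>J. e + e)" by (intro sum_mono Dle)
    also have "\<dots> \<le> \<eta>" using eJ by simp
    finally show ?case by simp
  qed
qed

text \<open>The two comparisons squeeze the probability between the limits for thresholds scaled by
  \<open>1 - \<epsilon>\<close> and \<open>1 + \<epsilon>\<close>, and \<open>G\<close> is
  continuous at 0. Half of the remaining gap to \<open>a\<close> absorbs the error
  \<open>\<eta>\<close>.\<close>

lemma maxima_below_tendsto_pos:
  assumes J: "finite J" "J \<subseteq> {1..}" and x: "\<And>k. k \<in> J \<Longrightarrow> x k > 0"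
  shows "(\<lambda>m. prob (maxima_below m J x)) \<longlonglongrightarrow> (\<Prod>k\<in>J. exp (- (\<theta> * x k powr (- \<alpha>))))"
proof (rule order_tendstoI)
  define G where "G s = (\<Prod>k\<in>J. exp (- (\<theta> * ((1 + s) * x k) powr (- \<alpha>))))" for s
  have G0: "G 0 = (\<Prod>k\<in>J. exp (- (\<theta> * x k powr (- \<alpha>))))" by (simp add: G_def)
  have cont: "isCont G 0"
    unfolding G_def using x by (intro continuous_intros) (auto simp: less_imp_neq[symmetric])
  fix a
  {
    assume "a < (\<Prod>k\<in>J. exp (- (\<theta> * x k powr (- \<alpha>))))"
    then have "a < G 0" using G0 by simp
    then have "\<forall>\<^sub>F s in at 0. a < G s"
      using cont unfolding isCont_def by (intro order_tendstoD(1))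
    then obtain d where d: "d > 0" "\<And>s. s \<noteq> 0 \<Longrightarrow> \<bar>s\<bar> < d \<Longrightarrow> a < G s"
      unfolding eventually_at by (auto simp: dist_real_def)
    \<comment> \<open>The cap \<open>1 / 2\<close> keeps the scaled thresholds
      \<open>(1 - \<epsilon>) * x k\<close> positive.\<close>
    define \<epsilon> where "\<epsilon> = min (d / 2) (1 / 2)"
    have \<epsilon>: "0 < \<epsilon>" "\<epsilon> < 1" "\<epsilon> < d" using d(1) by (auto simp: \<epsilon>_def)
    define \<eta> where "\<eta> = (G (- \<epsilon>) - a) / 2"
    have \<eta>: "\<eta> > 0" using d(2)[of "- \<epsilon>"] \<epsilon> by (simp add: \<eta>_def)
    have "(\<lambda>m. prob (innovations_below m J (\<lambda>k. (1 - \<epsilon>) * x k))) \<longlonglongrightarrow> G (- \<epsilon>)"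
      unfolding G_def using innovations_below_tendsto[OF J, of "\<lambda>k. (1 - \<epsilon>) * x k"] x \<epsilon> by simp
    moreover have "a + \<eta> < G (- \<epsilon>)" using \<eta> by (simp add: \<eta>_def field_simps)
    ultimately have "\<forall>\<^sub>F m in sequentially. a + \<eta> < prob (innovations_below m J (\<lambda>k. (1 - \<epsilon>) * x k))"
      by (rule order_tendstoD)
    moreover have "\<forall>\<^sub>F m in sequentially. prob (innovations_below m J (\<lambda>k. (1 - \<epsilon>) * x k)) \<le> prob (maxima_below m J x) + \<eta>"
      by (rule prob_innovations_below_le[OF J(1) _ \<epsilon>(1,2) \<eta>]) (rule x)
    ultimately show "\<forall>\<^sub>F m in sequentially. a < prob (maxima_below m J x)"
      by eventually_elim simp
  }
  {
    assume "(\<Prod>k\<in>J. exp (- (\<theta> * x k powr (- \<alpha>)))) < a"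
    then have "G 0 < a" using G0 by simp
    then have "\<forall>\<^sub>F s in at 0. G s < a"
      using cont unfolding isCont_def by (intro order_tendstoD(2))
    then obtain d where d: "d > 0" "\<And>s. s \<noteq> 0 \<Longrightarrow> \<bar>s\<bar> < d \<Longrightarrow> G s < a"
      unfolding eventually_at by (auto simp: dist_real_def)
    define \<epsilon> where "\<epsilon> = d / 2"
    have \<epsilon>: "0 < \<epsilon>" "\<epsilon> < d" using d(1) by (auto simp: \<epsilon>_def)
    define \<eta> where "\<eta> = (a - G \<epsilon>) / 2"
    have \<eta>: "\<eta> > 0" using d(2)[of \<epsilon>] \<epsilon> by (simp add: \<eta>_def)
    have "(\<lambda>m. prob (innovations_below m J (\<lambda>k. (1 + \<epsilon>) * x k))) \<longlonglongrightarrow> G \<epsilon>"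
      unfolding G_def using innovations_below_tendsto[OF J, of "\<lambda>k. (1 + \<epsilon>) * x k"] x \<epsilon> by simp
    moreover have "G \<epsilon> < a - \<eta>" using \<eta> by (simp add: \<eta>_def field_simps)
    ultimately have "\<forall>\<^sub>F m in sequentially. prob (innovations_below m J (\<lambda>k. (1 + \<epsilon>) * x k)) < a - \<eta>"
      by (rule order_tendstoD)
    moreover have "\<forall>\<^sub>F m in sequentially. prob (maxima_below m J x) \<le> prob (innovations_below m J (\<lambda>k. (1 + \<epsilon>) * x k)) + \<eta>"
      by (rule prob_maxima_below_le[OF J(1) _ \<epsilon>(1) \<eta>]) (rule x)
    ultimately show "\<forall>\<^sub>F m in sequentially. prob (maxima_below m J x) < a"
      by eventually_elim simp
  }
qed

text \<open>A nonpositive threshold is raised to a small \<open>s > 0\<close>. By monotonicity the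
  probability is eventually below any \<open>a > 0\<close>, since \<open>\<theta> > 0\<close> makes
  \<open>exp (- (\<theta> * s powr (- \<alpha>)))\<close> tend to 0 with \<open>s\<close>.\<close>

lemma maxima_below_tendsto:
  assumes J: "finite J" "J \<subseteq> {1..}" and \<theta>: "\<theta> > 0"
  shows "(\<lambda>m. prob (maxima_below m J x)) \<longlonglongrightarrow>
    (\<Prod>k\<in>J. if x k > 0 then exp (- (\<theta> * x k powr (- \<alpha>))) else 0)"
proof (cases "\<forall>k\<in>J. x k > 0")
  case True
  then show ?thesis using maxima_below_tendsto_pos[OF J, of x] by simp
next
  case False
  then obtain k0 where k0: "k0 \<in> J" "x k0 \<le> 0" by (auto simp: not_less)
  have zero: "(\<Prod>k\<in>J. if x k > 0 then exp (- (\<theta> * x k powr (- \<alpha>))) else 0) = 0"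
    using J k0 by (intro prod_zero) (auto intro!: bexI[of _ k0])
  have "(\<lambda>m. prob (maxima_below m J x)) \<longlonglongrightarrow> 0"
  proof (rule order_tendstoI)
    fix a :: real assume "a < 0"
    then show "\<forall>\<^sub>F m in sequentially. a < prob (maxima_below m J x)"
      by (intro always_eventually allI) (use measure_nonneg less_le_trans in blast)
  next
    fix a :: real assume a: "0 < a"
    \<comment> \<open>Chosen so that \<open>exp (- T) < a\<close>; \<open>s\<close> then solves
      \<open>\<theta> * s powr (- \<alpha>) = T\<close>.\<close>
    define T where "T = \<bar>ln a\<bar> + 1"
    define s where "s = (T / \<theta>) powr (- (1 / \<alpha>))"
    have T: "T > 0" "exp (- T) < a"
    proof -
      have "- T < ln a" unfolding T_def by linarith
      then show "exp (- T) < a" using a by (metis exp_less_mono exp_ln)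
    qed (simp add: T_def)
    have s: "s > 0" "\<theta> * s powr (- \<alpha>) = T"
      using T \<theta> \<alpha> by (auto simp: s_def powr_powr)
    let ?x = "\<lambda>k. max (x k) s"
    have "(\<lambda>m. prob (maxima_below m J ?x)) \<longlonglongrightarrow> (\<Prod>k\<in>J. exp (- (\<theta> * ?x k powr (- \<alpha>))))"
      using maxima_below_tendsto_pos[OF J, of ?x] s(1) by (simp add: less_max_iff_disj)
    moreover have "(\<Prod>k\<in>J. exp (- (\<theta> * ?x k powr (- \<alpha>)))) < a"
    proof -
      have "(\<Prod>k\<in>J. exp (- (\<theta> * ?x k powr (- \<alpha>)))) =
        exp (- (\<theta> * ?x k0 powr (- \<alpha>))) * (\<Prod>k\<in>J - {k0}. exp (- (\<theta> * ?x k powr (- \<alpha>))))"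
        using J k0 by (intro prod.remove) auto
      also have "\<dots> \<le> exp (- (\<theta> * ?x k0 powr (- \<alpha>))) * 1"
        by (intro mult_left_mono prod_le_1) (use \<theta> in auto)
      also have "\<dots> = exp (- T)" using s k0 by (simp add: max_absorb2)
      finally show ?thesis using T(2) by simp
    qed
    ultimately have "\<forall>\<^sub>F m in sequentially. prob (maxima_below m J ?x) < a" by (rule order_tendstoD)
    then show "\<forall>\<^sub>F m in sequentially. prob (maxima_below m J x) < a"
      using eventually_ge_at_top[of 1]
    proof eventually_elim
      case (elim m)
      have "prob (maxima_below m J x) \<le> prob (maxima_below m J ?x)"
        by (rule finite_measure_mono[OF _ maxima_below_event[OF J(1) elim(2)]])
           (auto simp: maxima_below_def le_max_iff_disj)
      then show ?case using elim(1) by linarith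
    qed
  qed
  then show ?thesis using zero by simp
qed

end

subsection \<open>The limit theorem\<close>

theorem lemma3p1:
  fixes M :: "'a measure" and N :: "'b measure"
    and \<xi> X :: "int \<Rightarrow> 'a \<Rightarrow> real" and c :: "int \<Rightarrow> real"
    and Z :: "nat \<Rightarrow> 'b \<Rightarrow> real"
    and \<alpha> \<sigma>\<xi> p :: real
  assumes "prob_space M" and "prob_space N"
    and "\<alpha> > 0" and "\<sigma>\<xi> > 0" and "p \<in> {0..1}"
    and "iid_vars M \<xi> UNIV"
    and "\<And>k. (\<lambda>x. \<P>(\<omega> in M. \<bar>\<xi> k \<omega>\<bar> > x)) \<sim>[at_top] (\<lambda>x. \<sigma>\<xi> powr \<alpha> * x powr (- \<alpha>))"
    and "\<And>k. ((\<lambda>x. \<P>(\<omega> in M. \<xi> k \<omega> > x) / \<P>(\<omega> in M. \<bar>\<xi> k \<omega>\<bar> > x)) \<longlongrightarrow> p) at_top"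
    and "\<alpha> > 2 \<Longrightarrow> (\<lambda>i. (c i)\<^sup>2) summable_on UNIV"
    and "\<alpha> \<le> 2 \<Longrightarrow> \<exists>\<epsilon>>0. (\<lambda>i. \<bar>c i\<bar> powr (\<alpha> - \<epsilon>)) summable_on UNIV"
    and "\<And>k. X k \<in> borel_measurable M"
    and "\<And>k. AE \<omega> in M. bi_sums (\<lambda>i. c i * \<xi> (k - i) \<omega>) (X k \<omega>)"
    and "p * c_plus c > 0 \<or> (1 - p) * c_minus c > 0"
    and "iid_vars N Z {1..}"
    and "\<And>k. k \<ge> 1 \<Longrightarrow>
           frechet_rv N \<alpha> (\<sigma>\<xi> * (p * c_plus c powr \<alpha> + (1 - p) * c_minus c powr \<alpha>) powr (1 / \<alpha>)) (Z k)"
  shows "fdd_conv {1..} M (\<lambda>m k \<omega>. 1 / real m powr (1 / \<alpha>) * block_max X m k \<omega>) N Z"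
proof -
  interpret M: prob_space M by fact
  interpret N: prob_space N by fact
  note \<alpha> = \<open>\<alpha> > 0\<close> and \<sigma> = \<open>\<sigma>\<xi> > 0\<close>
  have indep: "M.indep_vars (\<lambda>_. borel) \<xi> UNIV"
    and ident: "\<And>j k. distr M borel (\<xi> j) = distr M borel (\<xi> k)"
    using assms(6) unfolding iid_vars_def by auto
  have \<xi>[measurable]: "\<xi> k \<in> borel_measurable M" for k using indep by (auto simp: M.indep_vars_def)
  let ?T = "\<lambda>x. M.prob {\<omega>\<in>space M. \<bar>\<xi> 0 \<omega>\<bar> > x}" and ?U = "\<lambda>x. M.prob {\<omega>\<in>space M. \<xi> 0 \<omega> > x}"
  have T: "((\<lambda>x. x powr \<alpha> * ?T x) \<longlongrightarrow> \<sigma>\<xi> powr \<alpha>) at_top"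
  proof -
    have "(\<lambda>x. x powr \<alpha> * ?T x) \<sim>[at_top] (\<lambda>x. x powr \<alpha> * (\<sigma>\<xi> powr \<alpha> * x powr (- \<alpha>)))"
      by (intro asymp_equiv_mult asymp_equiv_refl assms(7))
    moreover have "((\<lambda>x. x powr \<alpha> * (\<sigma>\<xi> powr \<alpha> * x powr (- \<alpha>))) \<longlongrightarrow> \<sigma>\<xi> powr \<alpha>) at_top"
    proof (rule tendsto_eventually)
      show "\<forall>\<^sub>F x in at_top. x powr \<alpha> * (\<sigma>\<xi> powr \<alpha> * x powr (- \<alpha>)) = \<sigma>\<xi> powr \<alpha>"
        using eventually_gt_at_top[of 0] by eventually_elim (simp add: powr_minus)
    qed
    ultimately show ?thesis using tendsto_asymp_equiv_cong by blast
  qed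
  have U: "((\<lambda>x. x powr \<alpha> * ?U x) \<longlongrightarrow> \<sigma>\<xi> powr \<alpha> * p) at_top"
  proof -
    have "((\<lambda>x. (x powr \<alpha> * ?T x) * (?U x / ?T x)) \<longlongrightarrow> \<sigma>\<xi> powr \<alpha> * p) at_top"
      by (intro tendsto_mult T assms(8))
    \<comment> \<open>Where \<open>?T x = 0\<close> the quotient is 0 by convention and
      \<open>?U x\<close> vanishes as well, so the identity holds for every
      \<open>x\<close>.\<close>
    moreover have "(x powr \<alpha> * ?T x) * (?U x / ?T x) = x powr \<alpha> * ?U x" for x
    proof -
      have "?U x \<le> ?T x" by (rule M.finite_measure_mono) auto
      then show ?thesis using measure_nonneg[of M "{\<omega>\<in>space M. \<xi> 0 \<omega> > x}"] by (cases "?T x = 0") auto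
    qed
    ultimately show ?thesis by simp
  qed
  have L: "((\<lambda>x. x powr \<alpha> * M.prob {\<omega>\<in>space M. - \<xi> 0 \<omega> > x}) \<longlongrightarrow> \<sigma>\<xi> powr \<alpha> * (1 - p)) at_top"
  proof -
    have "((\<lambda>x. x powr \<alpha> * ?T x - x powr \<alpha> * ?U x) \<longlongrightarrow> \<sigma>\<xi> powr \<alpha> - \<sigma>\<xi> powr \<alpha> * p) at_top"
      by (intro tendsto_diff T U)
    moreover have "\<forall>\<^sub>F x in at_top. x powr \<alpha> * ?T x - x powr \<alpha> * ?U x = x powr \<alpha> * M.prob {\<omega>\<in>space M. - \<xi> 0 \<omega> > x}"
      using eventually_gt_at_top[of 0]
    proof eventually_elim
      case (elim x)
      have "{\<omega>\<in>space M. - \<xi> 0 \<omega> > x} = {\<omega>\<in>space M. \<bar>\<xi> 0 \<omega>\<bar> > x} - {\<omega>\<in>space M. \<xi> 0 \<omega> > x}"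
        using elim by auto
      moreover have "M.prob ({\<omega>\<in>space M. \<bar>\<xi> 0 \<omega>\<bar> > x} - {\<omega>\<in>space M. \<xi> 0 \<omega> > x}) = ?T x - ?U x"
        by (rule M.finite_measure_Diff) auto
      ultimately have "M.prob {\<omega>\<in>space M. - \<xi> 0 \<omega> > x} = ?T x - ?U x" by simp
      then show ?case by (simp add: right_diff_distrib)
    qed
    ultimately have "((\<lambda>x. x powr \<alpha> * M.prob {\<omega>\<in>space M. - \<xi> 0 \<omega> > x}) \<longlongrightarrow> \<sigma>\<xi> powr \<alpha> - \<sigma>\<xi> powr \<alpha> * p) at_top"
      by (rule Lim_transform_eventually)
    then show ?thesis by (simp add: right_diff_distrib)
  qed
  have s\<alpha>: "\<sigma>\<xi> powr \<alpha> > 0" using \<sigma> by simp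
  \<comment> \<open>The asymptotics give \<open>2 * \<sigma>\<xi> powr \<alpha>\<close> beyond some
    \<open>x0\<close>; below \<open>x0\<close> a probability is at most 1, which accounts for
    \<open>x0 powr \<alpha>\<close>.\<close>
  obtain C where tail: "\<And>k x. x > 0 \<Longrightarrow> M.prob {\<omega>\<in>space M. \<bar>\<xi> k \<omega>\<bar> > x} \<le> C * x powr (- \<alpha>)"
  proof -
    have "\<forall>\<^sub>F x in at_top. x powr \<alpha> * ?T x < 2 * \<sigma>\<xi> powr \<alpha>"
      using T by (rule order_tendstoD) (use s\<alpha> in simp)
    then obtain x0 where x0: "\<And>x. x \<ge> x0 \<Longrightarrow> x powr \<alpha> * ?T x < 2 * \<sigma>\<xi> powr \<alpha>"
      unfolding eventually_at_top_linorder by auto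
    have b0: "?T x \<le> max (2 * \<sigma>\<xi> powr \<alpha>) (x0 powr \<alpha>) * x powr (- \<alpha>)" if x: "x > 0" for x
    proof -
      have "x powr \<alpha> * ?T x \<le> max (2 * \<sigma>\<xi> powr \<alpha>) (x0 powr \<alpha>)"
      proof (cases "x \<ge> x0")
        case False
        have "x powr \<alpha> * ?T x \<le> x0 powr \<alpha> * 1"
          using False x \<alpha> by (intro mult_mono powr_mono2) auto
        then show ?thesis by simp
      qed (use x0[of x] in simp)
      then show ?thesis using x by (simp add: powr_minus_divide pos_le_divide_eq mult.commute)
    qed
    have b1: "M.prob {\<omega>\<in>space M. \<bar>\<xi> k \<omega>\<bar> > x} = ?T x" for k x
    proof -
      have "M.prob {\<omega>\<in>space M. \<bar>\<xi> k \<omega>\<bar> > x} = measure (distr M borel (\<xi> k)) {t. \<bar>t\<bar> > x}" for k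
        by (subst measure_distr) (auto intro!: arg_cong[where f="M.prob"])
      then show ?thesis by (simp only: ident[of k 0])
    qed
    show thesis
    proof (rule that)
      fix k and x :: real assume "x > 0"
      then show "M.prob {\<omega>\<in>space M. \<bar>\<xi> k \<omega>\<bar> > x} \<le> max (2 * \<sigma>\<xi> powr \<alpha>) (x0 powr \<alpha>) * x powr (- \<alpha>)"
        by (subst b1) (rule b0)
    qed
  qed
  have unbounded: "?T x > 0" for x
  proof -
    have "\<forall>\<^sub>F y in at_top. y powr \<alpha> * ?T y > 0" using T s\<alpha> by (rule order_tendstoD)
    then obtain y where "y \<ge> x" "y powr \<alpha> * ?T y > 0"
      using eventually_ge_at_top[of x] by (metis (mono_tags, lifting) eventually_conj eventually_happens' trivial_limit_at_top_linorder)
    moreover from this have "?T y \<le> ?T x" by (intro M.finite_measure_mono) auto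
    ultimately show ?thesis by (metis mult_eq_0_iff less_irrefl measure_nonneg order.not_eq_order_implies_strict order.strict_trans1)
  qed
  \<comment> \<open>Take 2 for \<open>\<alpha> > 2\<close>, and \<open>\<alpha> - \<epsilon>\<close>
    for \<open>\<alpha> \<le> 2\<close> if it is positive. Otherwise the support of \<open>c\<close>
    is finite and \<open>\<alpha> / 2\<close> serves.\<close>
  obtain r where r: "0 < r" "r \<le> 2" "r < \<alpha>" "(\<lambda>i. \<bar>c i\<bar> powr r) summable_on UNIV"
  proof (cases "\<alpha> > 2")
    case True
    have "\<bar>c i\<bar> powr 2 = (c i)\<^sup>2" for i by simp
    then show thesis using that[of 2] assms(9)[OF True] True by simp
  next
    case False
    then obtain \<epsilon> where \<epsilon>: "\<epsilon> > 0" "(\<lambda>i. \<bar>c i\<bar> powr (\<alpha> - \<epsilon>)) summable_on UNIV" using assms(10) by auto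
    show thesis
    proof (cases "\<alpha> - \<epsilon> > 0")
      case True
      then show thesis using that[of "\<alpha> - \<epsilon>"] \<epsilon> False by auto
    next
      case nonpos: False
      have "finite {i. c i \<noteq> 0}"
        by (rule M.finite_support_of_AE_bi_sums[OF indep ident unbounded _ finite_of_summable_abs_powr_nonpos[OF \<epsilon>(2)]])
           (use assms(12)[of 0] nonpos in auto)
      then have "(\<lambda>i. \<bar>c i\<bar> powr (\<alpha> / 2)) summable_on {i. c i \<noteq> 0}" by (rule summable_on_finite)
      then have "(\<lambda>i. \<bar>c i\<bar> powr (\<alpha> / 2)) summable_on UNIV"
        by (rule summable_on_cong_neutral[THEN iffD1, rotated -1]) auto
      then show thesis using that[of "\<alpha> / 2"] \<alpha> False by auto
    qed
  qed
  interpret L: regularly_varying_linear_process M \<xi> X c \<alpha> C r "\<sigma>\<xi> powr \<alpha> * p" "\<sigma>\<xi> powr \<alpha> * (1 - p)"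
    by unfold_locales (fact indep ident tail r assms(11,12) U L)+
  define s where "s = \<sigma>\<xi> * (p * c_plus c powr \<alpha> + (1 - p) * c_minus c powr \<alpha>) powr (1 / \<alpha>)"
  have p: "0 \<le> p" "p \<le> 1" using assms(5) by auto
  \<comment> \<open>The hypothesis concerns \<open>c_plus\<close> and \<open>c_minus\<close>
    themselves; their nonnegativity turns a positive product into positive factors, and so into
    positive powers.\<close>
  have pos: "p * c_plus c powr \<alpha> + (1 - p) * c_minus c powr \<alpha> > 0"
    using assms(13)
  proof
    assume "p * c_plus c > 0"
    then have "p > 0" "c_plus c > 0" using p L.coefficients(2) by (auto simp: zero_less_mult_iff)
    then show ?thesis using p by (intro add_pos_nonneg) auto
  next
    assume "(1 - p) * c_minus c > 0"
    then have "1 - p > 0" "c_minus c > 0" using p L.coefficients(5) by (auto simp: zero_less_mult_iff)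
    then show ?thesis using p by (intro add_nonneg_pos) auto
  qed
  have s: "s powr \<alpha> = L.\<theta>"
    unfolding s_def L.\<theta>_def using \<sigma> pos \<alpha> by (simp add: powr_mult powr_powr algebra_simps)
  have \<theta>: "L.\<theta> > 0" unfolding s[symmetric] s_def using \<sigma> pos by simp
  have fr: "frechet_rv N \<alpha> s (Z k)" if "k \<ge> 1" for k using assms(15)[OF that] unfolding s_def .
  show ?thesis unfolding fdd_conv_def
  proof (intro allI impI, elim conjE)
    fix J :: "nat set" assume J: "finite J" "J \<subseteq> {1..}"
    \<comment> \<open>\<open>Z k\<close> is known to be measurable only for
      \<open>k \<ge> 1\<close>. Setting the coordinates outside \<open>J\<close> to 0 makes all of
      them measurable and leaves the restricted vector unchanged.\<close>
    define W where "W k = (if k \<in> J then Z k else (\<lambda>_. 0))" for k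
    have W[measurable]: "W k \<in> borel_measurable N" for k
      using fr[of k] J(2) unfolding W_def by (auto simp: frechet_rv_def)
    have WZ: "(\<lambda>\<omega>. restrict (\<lambda>k. Z k \<omega>) J) = (\<lambda>\<omega>. restrict (\<lambda>k. W k \<omega>) J)"
      by (auto simp: W_def fun_eq_iff)
    have cdfW: "N.prob {\<omega>\<in>space N. \<forall>k\<in>J. W k \<omega> \<le> x k} =
      (\<Prod>k\<in>J. if x k > 0 then exp (- (L.\<theta> * x k powr (- \<alpha>))) else 0)" for x
    proof (cases "J = {}")
      case False
      have "N.indep_vars (\<lambda>_. borel) Z {1..}" using assms(14) unfolding iid_vars_def by simp
      from N.indep_varsD[OF this False J, of "\<lambda>k. {..x k}"]
      have "N.prob (\<Inter>k\<in>J. Z k -` {..x k} \<inter> space N) = (\<Prod>k\<in>J. N.prob (Z k -` {..x k} \<inter> space N))"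
        by simp
      moreover have "(\<Inter>k\<in>J. Z k -` {..x k} \<inter> space N) = {\<omega>\<in>space N. \<forall>k\<in>J. W k \<omega> \<le> x k}"
        using False by (auto simp: W_def)
      moreover have "N.prob (Z k -` {..x k} \<inter> space N) = (if x k > 0 then exp (- (L.\<theta> * x k powr (- \<alpha>))) else 0)"
        if "k \<in> J" for k
      proof -
        have "Z k -` {..x k} \<inter> space N = {\<omega>\<in>space N. Z k \<omega> \<le> x k}" by auto
        moreover have "k \<ge> 1" using that J(2) by auto
        ultimately show ?thesis using fr[of k] s unfolding frechet_rv_def by simp
      qed
      ultimately show ?thesis by simp
    qed (simp add: N.prob_space)
    have Vm: "(\<lambda>\<omega>. 1 / real m powr (1 / \<alpha>) * block_max X m k \<omega>) \<in> borel_measurable M" for m k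
      unfolding block_max_def by (intro borel_measurable_times borel_measurable_const borel_measurable_Max) auto
    show "weak_conv_borel
      (\<lambda>m. distr M borel (\<lambda>\<omega>. restrict (\<lambda>k. 1 / real m powr (1 / \<alpha>) * block_max X m k \<omega>) J))
      (distr N borel (\<lambda>\<omega>. restrict (\<lambda>k. Z k \<omega>) J))"
      unfolding WZ
      by (rule weak_conv_borel_of_joint_cdf[OF assms(1,2) J(1) Vm W])
         (use L.maxima_below_tendsto[OF J \<theta>] in \<open>simp add: cdfW L.maxima_below_def\<close>)
  qed
qed

end
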